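(* Let $s>1$ and let $U$ be a bounded open subset of $\mathbb{R}^d$. i) Let $h>0$ be fixed. Every element $\varphi$ of $\mathcal{D}^{(s)}_{L^p,h}(U)$, for $1\le p\le\infty$, can be extended to a $\mathcal{C}^\infty$ function on $\mathbb{R}^d$ with support in $\overline U$. Moreover $\mathcal{D}^{(s)}_{L^\infty,h}(U)$ can be identified with a closed subspace of $\mathcal{D}^{s,1/h}_{\overline U}$. ii) $\dot{\mathcal{B}}^{(s)}(U)$ can be identified with a closed subspace of $\mathcal{D}^{(s)}_{\overline U}$. iii) $\dot{\mathcal{B}}^{(s)}(U)$ is a nuclear $(FS)$-space. Moreover, in the representation $\dot{\mathcal{B}}^{(s)}(U)=\varprojlim_{h\to\infty}\mathcal{D}^{(s)}_{L^\infty,h}(U)$, the linking inclusions in the projective limit $\mathcal{D}^{(s)}_{L^\infty,h_1}(U)\to\mathcal{D}^{(s)}_{L^\infty,h}(U)$ are compact for $h_1>h$.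
   Context: $D^\alpha=D_1^{\alpha_1}\cdots D_d^{\alpha_d}$ with $D_j=i^{-1}\partial_{x_j}$. For a compact set $K\subset\mathbb{R}^d$ and $k>0$, $\mathcal{D}^{s,k}_K$ is the Banach space of all $\varphi\in\mathcal{C}^\infty(\mathbb{R}^d)$ with support in $K$ and $\sup_{\alpha}\sup_{x\in K}|D^\alpha\varphi(x)|/(k^{|\alpha|}\alpha!^s)<\infty$ (with this expression as norm); $\mathcal{D}^{(s)}_K=\varprojlim_{k\to0}\mathcal{D}^{s,k}_K$; $\mathcal{D}^{(s)}(U)=\varinjlim_{K\subset\subset U}\mathcal{D}^{(s)}_K$. $\mathcal{D}^s_{L^p,h}(U)$ is the Banach space of all $\varphi\in\mathcal{C}^\infty(U)$ with finite norm $\left(\sum_{\alpha\in\mathbb{N}^d}h^{p|\alpha|}\|D^\alpha\varphi\|_{L^p(U)}^p/\alpha!^{ps}\right)^{1/p}$ (for $p=\infty$: $\sup_\alpha h^{|\alpha|}\|D^\alpha\varphi\|_{L^\infty(U)}/\alpha!^s$), and $\mathcal{D}^{(s)}_{L^p,h}(U)$ is the closure of $\mathcal{D}^{(s)}(U)$ in it. $\dot{\mathcal{B}}^{(s)}(U)$ is the closure of $\mathcal{D}^{(s)}(U)$ in $\varprojlim_{h\to\infty}\mathcal{D}^s_{L^\infty,h}(U)$; it equals $\varprojlim_{h\to\infty}\mathcal{D}^{(s)}_{L^\infty,h}(U)$. The identifications in i) and ii) are via extension of functions by zero outside $U$. An $(FS)$-space is a Fréchet–Schwartz space. *)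

theory Defs
  imports
    "HOL-Analysis.Analysis"
    "HOL-Probability.Essential_Supremum"
    "HOL-Library.Function_Algebras"
begin

section \<open>Locally convex spaces of complex-valued functions\<close>

text \<open>
  A topological vector space is a topology whose \<^const>\<open>topspace\<close> is a complex linear subspace
  of the function space \<open>'x \<Rightarrow> complex\<close> with its pointwise operations.
\<close>

definition cscale :: "complex \<Rightarrow> ('x \<Rightarrow> complex) \<Rightarrow> 'x \<Rightarrow> complex" where
  "cscale c f = (\<lambda>x. c * f x)"

interpretation cfun: vector_space "cscale :: complex \<Rightarrow> ('x \<Rightarrow> complex) \<Rightarrow> 'x \<Rightarrow> complex"
  by unfold_locales (auto simp: cscale_def fun_eq_iff algebra_simps)

definition linear_between ::
    "('x \<Rightarrow> complex) set \<Rightarrow> ('y \<Rightarrow> complex) set \<Rightarrow> (('x \<Rightarrow> complex) \<Rightarrow> ('y \<Rightarrow> complex)) \<Rightarrow> bool" where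
  "linear_between V W J \<longleftrightarrow>
     J ` V \<subseteq> W \<and>
     (\<forall>f\<in>V. \<forall>g\<in>V. J (f + g) = J f + J g) \<and>
     (\<forall>c. \<forall>f\<in>V. J (cscale c f) = cscale c (J f))"

definition norm_topology :: "'v::minus set \<Rightarrow> ('v \<Rightarrow> real) \<Rightarrow> 'v topology" where
  "norm_topology V n =
     topology_generated_by {{y \<in> V. n (y - x) < \<epsilon>} | x \<epsilon>. x \<in> V \<and> 0 < \<epsilon>}"

text \<open>
  The projective limit of a family of spaces linked by inclusions: the intersection, with the
  coarsest topology making every inclusion into a member of the family continuous.
\<close>

definition proj_lim :: "'i set \<Rightarrow> ('i \<Rightarrow> 'v topology) \<Rightarrow> 'v topology" where
  "proj_lim I T =
     topology_generated_by {(\<Inter>i\<in>I. topspace (T i)) \<inter> W | i W. i \<in> I \<and> openin (T i) W}"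

definition zero_nhd :: "('x \<Rightarrow> complex) topology \<Rightarrow> ('x \<Rightarrow> complex) set \<Rightarrow> bool" where
  "zero_nhd T W \<longleftrightarrow> W \<subseteq> topspace T \<and> (\<exists>G. openin T G \<and> 0 \<in> G \<and> G \<subseteq> W)"

definition absolutely_convex :: "('x \<Rightarrow> complex) set \<Rightarrow> bool" where
  "absolutely_convex W \<longleftrightarrow>
     (\<forall>f\<in>W. \<forall>g\<in>W. \<forall>a b. cmod a + cmod b \<le> 1 \<longrightarrow> cscale a f + cscale b g \<in> W)"

definition tvs :: "('x \<Rightarrow> complex) topology \<Rightarrow> bool" where
  "tvs T \<longleftrightarrow>
     cfun.subspace (topspace T) \<and>
     continuous_map (prod_topology T T) T (\<lambda>(f, g). f + g) \<and>
     continuous_map (prod_topology euclidean T) T (\<lambda>(c, f). cscale c f)"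

definition locally_convex :: "('x \<Rightarrow> complex) topology \<Rightarrow> bool" where
  "locally_convex T \<longleftrightarrow>
     tvs T \<and> (\<forall>W. zero_nhd T W \<longrightarrow> (\<exists>V. zero_nhd T V \<and> absolutely_convex V \<and> V \<subseteq> W))"

definition tvs_Cauchy :: "('x \<Rightarrow> complex) topology \<Rightarrow> (nat \<Rightarrow> 'x \<Rightarrow> complex) \<Rightarrow> bool" where
  "tvs_Cauchy T \<sigma> \<longleftrightarrow>
     range \<sigma> \<subseteq> topspace T \<and>
     (\<forall>W. zero_nhd T W \<longrightarrow> (\<exists>N. \<forall>m\<ge>N. \<forall>n\<ge>N. \<sigma> m - \<sigma> n \<in> W))"

definition Frechet_space :: "('x \<Rightarrow> complex) topology \<Rightarrow> bool" where
  "Frechet_space T \<longleftrightarrow>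
     locally_convex T \<and> metrizable_space T \<and>
     (\<forall>\<sigma>. tvs_Cauchy T \<sigma> \<longrightarrow> (\<exists>l. limitin T \<sigma> l sequentially))"

definition Schwartz_space :: "('x \<Rightarrow> complex) topology \<Rightarrow> bool" where
  "Schwartz_space T \<longleftrightarrow>
     locally_convex T \<and>
     (\<forall>W. zero_nhd T W \<and> absolutely_convex W \<longrightarrow>
        (\<exists>V. zero_nhd T V \<and>
           (\<forall>\<epsilon>>0. \<exists>F. finite F \<and> F \<subseteq> topspace T \<and>
              V \<subseteq> {f + cscale (of_real \<epsilon>) w | f w. f \<in> F \<and> w \<in> W})))"

definition FS_space :: "('x \<Rightarrow> complex) topology \<Rightarrow> bool" where
  "FS_space T \<longleftrightarrow> Frechet_space T \<and> Schwartz_space T"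

definition continuous_seminorm ::
    "('x \<Rightarrow> complex) topology \<Rightarrow> (('x \<Rightarrow> complex) \<Rightarrow> real) \<Rightarrow> bool" where
  "continuous_seminorm T p \<longleftrightarrow>
     (\<forall>f\<in>topspace T. \<forall>g\<in>topspace T. p (f + g) \<le> p f + p g) \<and>
     (\<forall>c. \<forall>f\<in>topspace T. p (cscale c f) = cmod c * p f) \<and>
     continuous_map T euclideanreal p"

definition linear_functional ::
    "('x \<Rightarrow> complex) topology \<Rightarrow> (('x \<Rightarrow> complex) \<Rightarrow> complex) \<Rightarrow> bool" where
  "linear_functional T u \<longleftrightarrow>
     (\<forall>f\<in>topspace T. \<forall>g\<in>topspace T. u (f + g) = u f + u g) \<and>
     (\<forall>c. \<forall>f\<in>topspace T. u (cscale c f) = c * u f)"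

text \<open>
  For a continuous seminorm \<open>p\<close> on a space \<open>E\<close>, an element of the completion of the normed space
  \<open>E / p\<^sup>-\<^sup>1(0)\<close> is represented by a \<open>p\<close>-Cauchy sequence in \<open>E\<close>, and its norm is
  the limit of the values of \<open>p\<close> along that sequence; an element \<open>f\<close> of \<open>E\<close> is sent to the class of
  the constant sequence.
\<close>

definition completion_rep ::
    "('x \<Rightarrow> complex) topology \<Rightarrow> (('x \<Rightarrow> complex) \<Rightarrow> real) \<Rightarrow> (nat \<Rightarrow> 'x \<Rightarrow> complex) \<Rightarrow> bool" where
  "completion_rep T p y \<longleftrightarrow>
     range y \<subseteq> topspace T \<and> (\<forall>\<epsilon>>0. \<exists>N. \<forall>m\<ge>N. \<forall>n\<ge>N. p (y m - y n) < \<epsilon>)"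

definition completion_norm ::
    "(('x \<Rightarrow> complex) \<Rightarrow> real) \<Rightarrow> (nat \<Rightarrow> 'x \<Rightarrow> complex) \<Rightarrow> real" where
  "completion_norm p y = lim (\<lambda>k. p (y k))"

text \<open>
  \<open>E\<close> is nuclear if for every continuous seminorm \<open>p\<close> the canonical map from \<open>E\<close> to the completion
  of \<open>E / p\<^sup>-\<^sup>1(0)\<close> is nuclear, i.e. of the form \<open>f \<mapsto> \<Sum>\<^sub>n c\<^sub>n u\<^sub>n(f) y\<^sub>n\<close> with
  \<open>c\<close> absolutely summable, \<open>u\<close> an equicontinuous sequence of linear functionals on \<open>E\<close>, and \<open>y\<close> a
  bounded sequence in the completion.
\<close>

definition nuclear_space :: "('x \<Rightarrow> complex) topology \<Rightarrow> bool" where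
  "nuclear_space T \<longleftrightarrow>
     locally_convex T \<and>
     (\<forall>p. continuous_seminorm T p \<longrightarrow>
        (\<exists>(c :: nat \<Rightarrow> complex) u y.
           summable (\<lambda>n. cmod (c n)) \<and>
           (\<forall>n. linear_functional T (u n)) \<and>
           (\<exists>V. zero_nhd T V \<and> (\<forall>n. \<forall>f\<in>V. cmod (u n f) \<le> 1)) \<and>
           (\<forall>n. completion_rep T p (y n)) \<and>
           (\<exists>C. \<forall>n. completion_norm p (y n) \<le> C) \<and>
           (\<forall>f\<in>topspace T.
              (\<lambda>N. completion_norm p (\<lambda>k. f - (\<Sum>n<N. cscale (c n * u n f) (y n k))))
                \<longlonglongrightarrow> 0)))"

definition compact_linear_map ::
    "('x \<Rightarrow> complex) topology \<Rightarrow> ('y \<Rightarrow> complex) topology \<Rightarrow>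
       (('x \<Rightarrow> complex) \<Rightarrow> ('y \<Rightarrow> complex)) \<Rightarrow> bool" where
  "compact_linear_map X Y J \<longleftrightarrow>
     linear_between (topspace X) (topspace Y) J \<and>
     (\<exists>V. zero_nhd X V \<and> (\<exists>C. compactin Y C \<and> J ` V \<subseteq> C))"

definition identifies_with_closed_subspace ::
    "('x \<Rightarrow> complex) topology \<Rightarrow> ('y \<Rightarrow> complex) topology \<Rightarrow>
       (('x \<Rightarrow> complex) \<Rightarrow> ('y \<Rightarrow> complex)) \<Rightarrow> bool" where
  "identifies_with_closed_subspace X Y J \<longleftrightarrow>
     linear_between (topspace X) (topspace Y) J \<and>
     embedding_map X Y J \<and>
     closedin Y (J ` topspace X)"


section \<open>Smooth functions and derivatives\<close>

type_synonym 'd pt = "(real, 'd) vec"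

definition Dj :: "'d::finite \<Rightarrow> ('d pt \<Rightarrow> complex) \<Rightarrow> 'd pt \<Rightarrow> complex" where
  "Dj j f x = inverse \<i> * vector_derivative (\<lambda>t. f (x + t *\<^sub>R axis j 1)) (at 0)"

text \<open>Only used for open \<open>U\<close>, where differentiability within \<open>U\<close> is differentiability.\<close>

primrec Ck_on :: "nat \<Rightarrow> ('d::finite) pt set \<Rightarrow> ('d pt \<Rightarrow> complex) \<Rightarrow> bool" where
  "Ck_on 0 U f \<longleftrightarrow> continuous_on U f"
| "Ck_on (Suc k) U f \<longleftrightarrow> f differentiable_on U \<and> (\<forall>j. Ck_on k U (Dj j f))"

definition smooth_on :: "('d::finite) pt set \<Rightarrow> ('d pt \<Rightarrow> complex) \<Rightarrow> bool" where
  "smooth_on U f \<longleftrightarrow> (\<forall>k. Ck_on k U f)"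

definition supp :: "(('d::finite) pt \<Rightarrow> complex) \<Rightarrow> 'd pt set" where
  "supp f = closure {x. f x \<noteq> 0}"

text \<open>
  The index type is linearly ordered only so that \<open>D\<^sub>1\<^bsup>\<alpha>\<^sub>1\<^esup> \<dots> D\<^sub>d\<^bsup>\<alpha>\<^sub>d\<^esup>\<close> is a definite composition.
\<close>

definition D_multi ::
    "('d::{finite,linorder} \<Rightarrow> nat) \<Rightarrow> ('d pt \<Rightarrow> complex) \<Rightarrow> 'd pt \<Rightarrow> complex" where
  "D_multi \<alpha> = foldr (\<lambda>j. Dj j ^^ \<alpha> j) (sorted_list_of_set UNIV)"

definition mi_abs :: "('d::finite \<Rightarrow> nat) \<Rightarrow> nat" where
  "mi_abs \<alpha> = (\<Sum>j\<in>UNIV. \<alpha> j)"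

definition mi_fact :: "('d::finite \<Rightarrow> nat) \<Rightarrow> real" where
  "mi_fact \<alpha> = (\<Prod>j\<in>UNIV. fact (\<alpha> j))"


section \<open>The spaces of ultradifferentiable functions with support in a compact set\<close>

definition DK_enorm ::
    "real \<Rightarrow> real \<Rightarrow> ('d::{finite,linorder}) pt set \<Rightarrow> ('d pt \<Rightarrow> complex) \<Rightarrow> ennreal" where
  "DK_enorm s k K \<phi> =
     (SUP \<alpha>. SUP x\<in>K. ennreal (cmod (D_multi \<alpha> \<phi> x) / (k ^ mi_abs \<alpha> * mi_fact \<alpha> powr s)))"

definition DK_norm ::
    "real \<Rightarrow> real \<Rightarrow> ('d::{finite,linorder}) pt set \<Rightarrow> ('d pt \<Rightarrow> complex) \<Rightarrow> real" where
  "DK_norm s k K \<phi> = enn2real (DK_enorm s k K \<phi>)"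

definition DK ::
    "real \<Rightarrow> real \<Rightarrow> ('d::{finite,linorder}) pt set \<Rightarrow> ('d pt \<Rightarrow> complex) topology" where
  "DK s k K =
     norm_topology {\<phi>. smooth_on UNIV \<phi> \<and> supp \<phi> \<subseteq> K \<and> DK_enorm s k K \<phi> < \<infinity>} (DK_norm s k K)"

definition DK_Beurling ::
    "real \<Rightarrow> ('d::{finite,linorder}) pt set \<Rightarrow> ('d pt \<Rightarrow> complex) topology" where
  "DK_Beurling s K = proj_lim {0<..} (\<lambda>k. DK s k K)"

text \<open>
  The inductive limit as a vector space; its topology plays no role, since the space only
  enters through its closures in other spaces.
\<close>

definition D_Beurling ::
    "real \<Rightarrow> ('d::{finite,linorder}) pt set \<Rightarrow> ('d pt \<Rightarrow> complex) set" where
  "D_Beurling s U = (\<Union>K\<in>{K. compact K \<and> K \<subseteq> U}. topspace (DK_Beurling s K))"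


section \<open>The spaces of \<open>L\<^sup>p\<close> type on an open set\<close>

definition enn_powr :: "ennreal \<Rightarrow> real \<Rightarrow> ennreal" where
  "enn_powr x r = (if x = \<infinity> then \<infinity> else ennreal (enn2real x powr r))"

definition Lp_enorm ::
    "ennreal \<Rightarrow> ('d::finite) pt set \<Rightarrow> ('d pt \<Rightarrow> complex) \<Rightarrow> ennreal" where
  "Lp_enorm p U f =
     (if p = \<infinity> then esssup (lebesgue_on U) (\<lambda>x. ennreal (cmod (f x)))
      else enn_powr (\<integral>\<^sup>+x. ennreal (cmod (f x) powr enn2real p) \<partial>lebesgue_on U) (1 / enn2real p))"

definition DL_enorm ::
    "real \<Rightarrow> ennreal \<Rightarrow> real \<Rightarrow> ('d::{finite,linorder}) pt set \<Rightarrow> ('d pt \<Rightarrow> complex) \<Rightarrow> ennreal" where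
  "DL_enorm s p h U \<phi> =
     (if p = \<infinity>
      then SUP \<alpha>. ennreal (h ^ mi_abs \<alpha> / mi_fact \<alpha> powr s) * Lp_enorm \<infinity> U (D_multi \<alpha> \<phi>)
      else let q = enn2real p in
        enn_powr
          (\<Sum>\<^sub>\<infinity>\<alpha>\<in>UNIV. ennreal (h powr (q * mi_abs \<alpha>) / mi_fact \<alpha> powr (q * s))
                        * enn_powr (Lp_enorm p U (D_multi \<alpha> \<phi>)) q)
          (1 / q))"

definition DL_norm ::
    "real \<Rightarrow> ennreal \<Rightarrow> real \<Rightarrow> ('d::{finite,linorder}) pt set \<Rightarrow> ('d pt \<Rightarrow> complex) \<Rightarrow> real" where
  "DL_norm s p h U \<phi> = enn2real (DL_enorm s p h U \<phi>)"

text \<open>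
  A function on the open set \<open>U\<close> is represented by the total function that agrees with it on \<open>U\<close> and
  is \<open>0\<close> elsewhere. This says nothing about its behaviour at the boundary: for open \<open>U\<close>, smoothness
  on \<open>U\<close> and the norm only depend on the values on \<open>U\<close>.
\<close>

definition DL ::
    "real \<Rightarrow> ennreal \<Rightarrow> real \<Rightarrow> ('d::{finite,linorder}) pt set \<Rightarrow> ('d pt \<Rightarrow> complex) topology" where
  "DL s p h U =
     norm_topology {\<phi>. smooth_on U \<phi> \<and> (\<forall>x. x \<notin> U \<longrightarrow> \<phi> x = 0) \<and> DL_enorm s p h U \<phi> < \<infinity>}
       (DL_norm s p h U)"

definition DL_Beurling ::
    "real \<Rightarrow> ennreal \<Rightarrow> real \<Rightarrow> ('d::{finite,linorder}) pt set \<Rightarrow> ('d pt \<Rightarrow> complex) topology" where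
  "DL_Beurling s p h U = subtopology (DL s p h U) (DL s p h U closure_of D_Beurling s U)"

definition B_dot ::
    "real \<Rightarrow> ('d::{finite,linorder}) pt set \<Rightarrow> ('d pt \<Rightarrow> complex) topology" where
  "B_dot s U =
     (let T = proj_lim {0<..} (\<lambda>h. DL s \<infinity> h U) in subtopology T (T closure_of D_Beurling s U))"

definition zero_ext :: "('d::finite) pt set \<Rightarrow> ('d pt \<Rightarrow> complex) \<Rightarrow> 'd pt \<Rightarrow> complex" where
  "zero_ext U \<phi> = (\<lambda>x. if x \<in> U then \<phi> x else 0)"

end

(*
  For f smooth on R^d with all derivatives vanishing outside U, the norms of D^s_{L^infty,h}(U) and
  D^{s,1/h}_{closure U} coincide, and this class of functions W is closed under uniform convergence of
  all derivatives. The bound |psi(x)| <= || D_1 ... D_d psi ||_{L^1} turns L^p convergence of all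
  derivatives of test functions into such uniform convergence; so every closure of D^(s)(U) in
  question lies in W, which gives i) and ii).

  Compactness of the linking maps: Arzela-Ascoli and a diagonal argument give uniform convergence of
  each derivative along a subsequence, and the factor (h / h_1)^|alpha| controls the derivatives of
  high order.

  Nuclearity: the same L^1 bound, after spending a constant factor of h, dominates the norm with
  parameter h by an integral over (alpha, x) of the functionals f |-> h^|alpha| D^alpha f(x) / alpha!^s
  with respect to a finite measure (a Pietsch domination). The L^2 forms of these functionals then
  yield orthogonal expansions inside the space itself, whose coefficients are absolutely summable by
  Bessel's inequality.
*)

theory Submission
  imports
    Defs
    "HOL-Probability.Product_PMF"
    "HOL-Complex_Analysis.Great_Picard"
    "HOL-Library.Diagonal_Subsequence"
    "HOL-Real_Asymp.Real_Asymp"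
begin

section \<open>Smooth functions\<close>

text \<open>Passing from L^1 norms of derivatives back to suprema raises every \<alpha>_j by one and
  so changes \<alpha>!^s by the factor prod (\<alpha>_j + 1)^s, which is O(2^|\<alpha>|). The
  probability weight on multi-indices costs another 2^|\<alpha>|. Hence each use of the domination
  moves the parameter from h to 4 h. Nuclearity uses it twice and trades one more factor 4 between f
  and the basis vectors, which explains h, 4 h, 16 h, 64 h.

  Since U is bounded, L^p convergence of all derivatives implies L^1 convergence of all derivatives,
  so \<open>L1_limit_in_W\<close> serves every exponent. It finds the limit twice, as a smooth
  function on R^d and as the given function on U, and compares the two by continuity.

  Norm topologies, projective limits and their subspaces are all rewritten as \<open>sn_top\<close>
  of a family of seminorms. As an element is stored as its own extension by zero, the
  identifications become equalities of topologies.

  The orthogonal expansion comes from Gram-Schmidt applied to a countable dense sequence, which the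
  compactness estimate provides.\<close>

lemma has_derivative_imp_Dj:
  assumes "(f has_derivative f') (at x)"
  shows "((\<lambda>t. f (x + t *\<^sub>R axis j 1)) has_vector_derivative \<i> * Dj j f x) (at 0)"
    and "Dj j f x = inverse \<i> * f' (axis j 1)"
proof -
  have 1: "((\<lambda>t. x + t *\<^sub>R axis j 1) has_derivative (\<lambda>t. t *\<^sub>R axis j 1)) (at (0::real))"
    by (auto intro!: derivative_eq_intros)
  have "((\<lambda>t. f (x + t *\<^sub>R axis j 1)) has_derivative (\<lambda>t. f' (t *\<^sub>R axis j 1))) (at (0::real))"
    by (rule has_derivative_compose[OF 1]) (use assms in simp)
  moreover have "f' (t *\<^sub>R axis j 1) = t *\<^sub>R f' (axis j 1)" for t
    using assms by (simp add: has_derivative_def linear_simps bounded_linear.linear linear_cmul)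
  ultimately have 2: "((\<lambda>t. f (x + t *\<^sub>R axis j 1)) has_vector_derivative f' (axis j 1)) (at 0)"
    by (simp add: has_vector_derivative_def)
  then show 3: "Dj j f x = inverse \<i> * f' (axis j 1)"
    by (simp add: Dj_def vector_derivative_at)
  show "((\<lambda>t. f (x + t *\<^sub>R axis j 1)) has_vector_derivative \<i> * Dj j f x) (at 0)"
    using 2 by (simp add: 3)
qed

text \<open>A derivative in direction j only sees a short segment through x, and openness of
  \<open>U\<close> keeps that segment inside \<open>U\<close>.\<close>

lemma Dj_cong:
  assumes "open U" "x \<in> U" "\<And>y. y \<in> U \<Longrightarrow> f y = g y"
  shows "Dj j f x = Dj j g x"
proof -
  have "((\<lambda>t. x + t *\<^sub>R axis j 1) \<longlongrightarrow> x + 0 *\<^sub>R axis j 1) (nhds (0::real))"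
    by (intro tendsto_intros filterlim_ident)
  then have "\<forall>\<^sub>F t in nhds (0::real). x + t *\<^sub>R axis j 1 \<in> U"
    using assms(1,2) by (auto simp: tendsto_def)
  then have "\<forall>\<^sub>F t in nhds (0::real). f (x + t *\<^sub>R axis j 1) = g (x + t *\<^sub>R axis j 1)"
    by (rule eventually_mono) (use assms(3) in auto)
  then show ?thesis
    unfolding Dj_def by (intro arg_cong2[of _ _ _ _ "(*)"] refl vector_derivative_cong_eq) (auto elim: eventually_mono)
qed

lemma Ck_on_cong:
  assumes "open U" "\<And>y. y \<in> U \<Longrightarrow> f y = g y" "Ck_on k U f"
  shows "Ck_on k U g"
  using assms(2,3)
proof (induction k arbitrary: f g)
  case 0
  then show ?case by (simp cong: continuous_on_cong)
next
  case (Suc k)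
  have "Ck_on k U (Dj j g)" for j
  proof (rule Suc.IH[of "Dj j f"])
    show "Dj j f y = Dj j g y" if "y \<in> U" for y
      by (rule Dj_cong[OF assms(1) that Suc.prems(1)])
  qed (use Suc.prems(2) in simp)
  moreover have "g differentiable_on U"
    unfolding differentiable_on_def
  proof
    fix x assume "x \<in> U"
    with Suc.prems(2) obtain f' where "(f has_derivative f') (at x within U)"
      by (auto simp: differentiable_on_def differentiable_def)
    then have "(g has_derivative f') (at x within U)"
      by (rule has_derivative_transform[rotated 2]) (use \<open>x \<in> U\<close> Suc.prems(1) in auto)
    then show "g differentiable at x within U" by (auto simp: differentiable_def)
  qed
  ultimately show ?case by simp
qed

text \<open>Turns smoothness into a property stable under every \<open>Dj\<close>, so that later
  inductions can run over words of derivatives instead of the order k.\<close>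

lemma smooth_on_iff: "smooth_on U f \<longleftrightarrow> f differentiable_on U \<and> (\<forall>j. smooth_on U (Dj j f))"
proof
  assume *: "smooth_on U f"
  have "Ck_on (Suc k) U f" for k
    using * by (simp add: smooth_on_def del: Ck_on.simps)
  then show "f differentiable_on U \<and> (\<forall>j. smooth_on U (Dj j f))"
    by (auto simp: smooth_on_def)
next
  assume *: "f differentiable_on U \<and> (\<forall>j. smooth_on U (Dj j f))"
  have "Ck_on k U f" for k
    using * by (cases k) (auto simp: smooth_on_def intro: differentiable_imp_continuous_on)
  then show "smooth_on U f" by (simp add: smooth_on_def)
qed

lemma smooth_on_Dj: "smooth_on U f \<Longrightarrow> smooth_on U (Dj j f)"
  using smooth_on_iff by blast

lemma smooth_on_continuous: "smooth_on U f \<Longrightarrow> continuous_on U f"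
  using smooth_on_iff differentiable_imp_continuous_on by blast

lemma smooth_on_differentiable_at:
  assumes "open U" "smooth_on U f" "x \<in> U"
  shows "f differentiable (at x)"
  using assms smooth_on_iff differentiable_on_eq_differentiable_at by blast

lemma Ck_on_subset: "Ck_on k U f \<Longrightarrow> V \<subseteq> U \<Longrightarrow> Ck_on k V f"
  by (induction k arbitrary: f) (auto intro: continuous_on_subset differentiable_on_subset)

lemma smooth_on_subset: "smooth_on U f \<Longrightarrow> V \<subseteq> U \<Longrightarrow> smooth_on V f"
  unfolding smooth_on_def by (meson Ck_on_subset)

section \<open>Iterated derivatives along words of indices\<close>

definition Dw :: "'d::finite list \<Rightarrow> ('d pt \<Rightarrow> complex) \<Rightarrow> 'd pt \<Rightarrow> complex" where
  "Dw w f = foldr Dj w f"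

lemma Dw_Nil [simp]: "Dw [] f = f"
  and Dw_Cons [simp]: "Dw (j # w) f = Dj j (Dw w f)"
  and Dw_append: "Dw (v @ w) f = Dw v (Dw w f)"
  by (auto simp: Dw_def)

lemma smooth_on_Dw: "smooth_on U f \<Longrightarrow> smooth_on U (Dw w f)"
  by (induction w) (auto intro: smooth_on_Dj)

lemma Dw_cong:
  assumes "open U" "\<And>y. y \<in> U \<Longrightarrow> f y = g y" "x \<in> U"
  shows "Dw w f x = Dw w g x"
  using assms(3)
proof (induction w arbitrary: x)
  case (Cons j w)
  show ?case
    unfolding Dw_Cons by (rule Dj_cong[OF assms(1) Cons.prems Cons.IH])
qed (use assms in simp)

lemma Dj_lincomb:
  assumes "f differentiable at x" "g differentiable at x"
  shows "Dj j (\<lambda>x. a * f x + b * g x) x = a * Dj j f x + b * Dj j g x"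
proof -
  obtain f' g' where d: "(f has_derivative f') (at x)" "(g has_derivative g') (at x)"
    using assms by (auto simp: differentiable_def)
  have "((\<lambda>x. a * f x + b * g x) has_derivative (\<lambda>h. a * f' h + b * g' h)) (at x)"
    using d by (auto intro!: derivative_eq_intros)
  then show ?thesis
    using d by (simp add: has_derivative_imp_Dj(2) algebra_simps)
qed

lemma Ck_on_lincomb:
  assumes "open U" "smooth_on U f" "smooth_on U g"
  shows "Ck_on k U (\<lambda>x. a * f x + b * g x)"
  using assms(2,3)
proof (induction k arbitrary: f g)
  case 0
  then show ?case by (simp add: continuous_on_add continuous_on_mult smooth_on_continuous)
next
  case (Suc k)
  have "Ck_on k U (Dj j (\<lambda>x. a * f x + b * g x))" for j
  proof (rule Ck_on_cong[OF assms(1)])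
    show "Ck_on k U (\<lambda>x. a * Dj j f x + b * Dj j g x)"
      using Suc smooth_on_Dj by blast
    show "a * Dj j f x + b * Dj j g x = Dj j (\<lambda>x. a * f x + b * g x) x" if "x \<in> U" for x
      by (intro Dj_lincomb[symmetric] smooth_on_differentiable_at[OF assms(1)] Suc.prems that)
  qed
  moreover have "(\<lambda>x. a * f x + b * g x) differentiable_on U"
    using Suc.prems smooth_on_iff by (auto intro!: derivative_intros)
  ultimately show ?case by simp
qed

lemma smooth_on_lincomb:
  assumes "open U" "smooth_on U f" "smooth_on U g"
  shows "smooth_on U (\<lambda>x. a * f x + b * g x)"
  using Ck_on_lincomb[OF assms] by (simp add: smooth_on_def)

lemma Dw_lincomb:
  assumes "open U" "smooth_on U f" "smooth_on U g" "x \<in> U"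
  shows "Dw w (\<lambda>x. a * f x + b * g x) x = a * Dw w f x + b * Dw w g x"
  using assms(4)
proof (induction w arbitrary: x)
  case (Cons j w)
  have "Dw (j # w) (\<lambda>x. a * f x + b * g x) x = Dj j (\<lambda>x. a * Dw w f x + b * Dw w g x) x"
    unfolding Dw_Cons by (rule Dj_cong[OF assms(1) Cons.prems Cons.IH])
  also have "\<dots> = a * Dw (j # w) f x + b * Dw (j # w) g x"
    unfolding Dw_Cons
    by (intro Dj_lincomb smooth_on_differentiable_at[OF assms(1)] smooth_on_Dw assms(2,3) Cons.prems)
  finally show ?case .
qed simp

lemma smooth_on_diff: "open U \<Longrightarrow> smooth_on U f \<Longrightarrow> smooth_on U g \<Longrightarrow> smooth_on U (f - g)"
  using smooth_on_lincomb[of U f g 1 "-1"] by (simp add: fun_diff_def)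

lemma smooth_on_add: "open U \<Longrightarrow> smooth_on U f \<Longrightarrow> smooth_on U g \<Longrightarrow> smooth_on U (f + g)"
  using smooth_on_lincomb[of U f g 1 1] by (simp add: plus_fun_def)

lemma smooth_on_cscale: "open U \<Longrightarrow> smooth_on U f \<Longrightarrow> smooth_on U (cscale c f)"
  using smooth_on_lincomb[of U f f c 0] by (simp add: cscale_def)

lemma Dw_diff:
  "open U \<Longrightarrow> smooth_on U f \<Longrightarrow> smooth_on U g \<Longrightarrow> x \<in> U \<Longrightarrow> Dw w (f - g) x = Dw w f x - Dw w g x"
  using Dw_lincomb[of U f g x w 1 "-1"] by (simp add: fun_diff_def)

lemma Dw_add:
  "open U \<Longrightarrow> smooth_on U f \<Longrightarrow> smooth_on U g \<Longrightarrow> x \<in> U \<Longrightarrow> Dw w (f + g) x = Dw w f x + Dw w g x"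
  using Dw_lincomb[of U f g x w 1 1] by (simp add: plus_fun_def)

lemma Dw_cscale:
  "open U \<Longrightarrow> smooth_on U f \<Longrightarrow> x \<in> U \<Longrightarrow> Dw w (cscale c f) x = c * Dw w f x"
  using Dw_lincomb[of U f f x w c 0] by (simp add: cscale_def)

lemma smooth_on_zero: "smooth_on U 0"
proof -
  have "Ck_on k U (\<lambda>_. 0)" for k
    by (induction k) (auto simp: Dj_def[abs_def])
  then show ?thesis by (simp add: smooth_on_def zero_fun_def)
qed

lemma Dw_zero [simp]: "Dw w 0 = 0"
proof (induction w)
  case (Cons j w)
  then show ?case by (auto simp: Dj_def fun_eq_iff)
qed simp

definition mword :: "('d::{finite,linorder} \<Rightarrow> nat) \<Rightarrow> 'd list" where
  "mword \<alpha> = concat (map (\<lambda>j. replicate (\<alpha> j) j) (sorted_list_of_set UNIV))"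

text \<open>Words grow by one letter at a time, whereas raising \<alpha> inserts a derivative in the
  middle of the ordered composition. So inductions use \<open>Dw\<close>, and multi-indices re-enter
  through this sorted word.\<close>

lemma D_multi_eq_Dw: "D_multi \<alpha> f = Dw (mword \<alpha>) f"
proof -
  have 1: "(Dj j ^^ n) g = Dw (replicate n j) g" for j n and g :: "'a pt \<Rightarrow> complex"
    by (induction n) auto
  have "foldr (\<lambda>j. Dj j ^^ \<alpha> j) xs f = Dw (concat (map (\<lambda>j. replicate (\<alpha> j) j) xs)) f" for xs
    by (induction xs) (auto simp: Dw_append 1)
  then show ?thesis by (simp add: D_multi_def mword_def)
qed

lemma count_mword: "count (mset (mword \<alpha>)) j = \<alpha> j"
proof -
  have "count (mset (concat (map (\<lambda>j. replicate (\<alpha> j) j) xs))) j = (if j \<in> set xs then \<alpha> j else 0)"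
    if "distinct xs" for xs
    using that by (induction xs) auto
  from this[of "sorted_list_of_set UNIV"] show ?thesis by (simp add: mword_def)
qed

section \<open>Symmetry of mixed partial derivatives\<close>

lemma vector_derivative_bound_interval:
  fixes g :: "real \<Rightarrow> 'b::real_normed_vector"
  assumes "a \<le> b"
    and "\<And>t. t \<in> {a..b} \<Longrightarrow> (g has_vector_derivative g' t) (at t within {a..b})"
    and "\<And>t. t \<in> {a..b} \<Longrightarrow> norm (g' t) \<le> B"
  shows "norm (g b - g a) \<le> B * (b - a)"
proof -
  have "norm (g b - g a) \<le> B * norm (b - a)"
  proof (rule differentiable_bound[of "{a..b}" g "\<lambda>t h. h *\<^sub>R g' t"])
    show "onorm (\<lambda>h. h *\<^sub>R g' t) \<le> B" if "t \<in> {a..b}" for t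
      using mult_left_mono[OF assms(3)[OF that] abs_ge_zero] by (intro onorm_le) (simp add: mult.commute)
  qed (use assms in \<open>auto simp: has_vector_derivative_def\<close>)
  then show ?thesis using assms(1) by simp
qed

text \<open>
  The second difference is symmetric in \<open>u\<close> and \<open>v\<close>, so this bound forces the two mixed derivatives
  to agree.
\<close>

lemma second_difference_bound:
  fixes f fv fvu :: "'a::real_normed_vector \<Rightarrow> complex"
  assumes v: "\<And>x. ((\<lambda>t. f (x + t *\<^sub>R v)) has_vector_derivative fv x) (at 0)"
    and u: "\<And>x. ((\<lambda>t. fv (x + t *\<^sub>R u)) has_vector_derivative fvu x) (at 0)"
    and cont: "isCont fvu x" and "\<epsilon> > 0"
  shows "\<forall>\<^sub>F h in at_right 0.
    cmod (f (x + h *\<^sub>R u + h *\<^sub>R v) - f (x + h *\<^sub>R u) - f (x + h *\<^sub>R v) + f x - h^2 *\<^sub>R fvu x) \<le> \<epsilon> * h^2"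
proof -
  \<comment> \<open>The hypotheses differentiate at parameter 0 only; translating the base point
    along the line gives the derivative at every t.\<close>
  have shift: "((\<lambda>t. g (y + t *\<^sub>R w)) has_vector_derivative gw (y + t *\<^sub>R w)) (at t within S)"
    if "\<And>x. ((\<lambda>t. g (x + t *\<^sub>R w)) has_vector_derivative gw x) (at 0)"
    for g gw :: "'a \<Rightarrow> complex" and w y t S
  proof -
    have 1: "((\<lambda>r. r - t) has_vector_derivative 1) (at t within S)"
      by (auto intro!: derivative_eq_intros)
    have 2: "((\<lambda>r. g ((y + t *\<^sub>R w) + r *\<^sub>R w)) has_vector_derivative gw (y + t *\<^sub>R w))
        (at (t - t) within (\<lambda>r. r - t) ` S)"
      using that[of "y + t *\<^sub>R w"] by (simp add: has_vector_derivative_at_within)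
    have "((\<lambda>r. g ((y + t *\<^sub>R w) + (r - t) *\<^sub>R w)) has_vector_derivative 1 *\<^sub>R gw (y + t *\<^sub>R w)) (at t within S)"
      using vector_diff_chain_within[OF 1 2] by (simp add: o_def)
    moreover have "(y + t *\<^sub>R w) + (r - t) *\<^sub>R w = y + r *\<^sub>R w" for r
      by (simp add: algebra_simps)
    ultimately show ?thesis by simp
  qed
  obtain \<delta> where \<delta>: "\<delta> > 0" "\<And>y. dist y x < \<delta> \<Longrightarrow> dist (fvu y) (fvu x) < \<epsilon>"
    using cont \<open>\<epsilon> > 0\<close> by (metis continuous_at_eps_delta)
  \<comment> \<open>For h below \<open>\<eta>\<close> the parallelogram spanned by h u and h v stays
    within \<delta> of x; the summand 1 covers u = v = 0.\<close>
  define \<eta> where "\<eta> = \<delta> / (norm u + norm v + 1)"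
  have nuv: "norm u + norm v + 1 > 0"
    by (smt (verit) norm_ge_zero)
  have "\<eta> > 0" using \<delta> nuv by (simp add: \<eta>_def)
  have "cmod (f (x + h *\<^sub>R u + h *\<^sub>R v) - f (x + h *\<^sub>R u) - f (x + h *\<^sub>R v) + f x - h^2 *\<^sub>R fvu x) \<le> \<epsilon> * h^2"
    if h: "0 < h" "h < \<eta>" for h
  proof -
    have near: "dist (fvu (x + t *\<^sub>R v + r *\<^sub>R u)) (fvu x) < \<epsilon>" if "t \<in> {0..h}" "r \<in> {0..h}" for t r
    proof (rule \<delta>(2))
      have "norm (t *\<^sub>R v + r *\<^sub>R u) \<le> h * norm v + h * norm u"
        using that by (intro norm_triangle_le add_mono) (auto intro!: mult_right_mono)
      also have "\<dots> \<le> h * (norm u + norm v + 1)" using h by (simp add: algebra_simps)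
      also have "\<dots> < \<eta> * (norm u + norm v + 1)" using h nuv by (simp add: mult_strict_right_mono)
      also have "\<dots> = \<delta>" using nuv by (simp add: \<eta>_def)
      finally show "dist (x + t *\<^sub>R v + r *\<^sub>R u) x < \<delta>"
        by (simp add: dist_norm algebra_simps)
    qed
    \<comment> \<open>Mean value estimate in direction u, started at each point of the side in
      direction v.\<close>
    have inner: "norm (fv (x + t *\<^sub>R v + h *\<^sub>R u) - fv (x + t *\<^sub>R v) - h *\<^sub>R fvu x) \<le> \<epsilon> * h"
      if t: "t \<in> {0..h}" for t
    proof -
      let ?g = "\<lambda>r. fv (x + t *\<^sub>R v + r *\<^sub>R u) - r *\<^sub>R fvu x"
      have "norm (?g h - ?g 0) \<le> \<epsilon> * (h - 0)"
      proof (rule vector_derivative_bound_interval[of 0 h ?g "\<lambda>r. fvu (x + t *\<^sub>R v + r *\<^sub>R u) - fvu x"])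
        fix r assume r: "r \<in> {0..h}"
        show "(?g has_vector_derivative fvu (x + t *\<^sub>R v + r *\<^sub>R u) - fvu x) (at r within {0..h})"
          by (intro has_vector_derivative_diff shift[OF u]) (auto intro!: derivative_eq_intros)
        show "norm (fvu (x + t *\<^sub>R v + r *\<^sub>R u) - fvu x) \<le> \<epsilon>"
          using near[OF t r] by (simp add: dist_norm)
      qed (use h in auto)
      then show ?thesis using h by (simp add: algebra_simps)
    qed
    \<comment> \<open>Mean value estimate in direction v: the derivative of this difference of two
      parallel sides is exactly what \<open>inner\<close> bounds.\<close>
    let ?g = "\<lambda>t. f (x + h *\<^sub>R u + t *\<^sub>R v) - f (x + t *\<^sub>R v) - (t * h) *\<^sub>R fvu x"
    have "norm (?g h - ?g 0) \<le> (\<epsilon> * h) * (h - 0)"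
    proof (rule vector_derivative_bound_interval[of 0 h ?g
            "\<lambda>t. fv (x + h *\<^sub>R u + t *\<^sub>R v) - fv (x + t *\<^sub>R v) - h *\<^sub>R fvu x"])
      fix t assume t: "t \<in> {0..h}"
      show "(?g has_vector_derivative fv (x + h *\<^sub>R u + t *\<^sub>R v) - fv (x + t *\<^sub>R v) - h *\<^sub>R fvu x) (at t within {0..h})"
        by (intro has_vector_derivative_diff shift[OF v]) (auto intro!: derivative_eq_intros)
      show "norm (fv (x + h *\<^sub>R u + t *\<^sub>R v) - fv (x + t *\<^sub>R v) - h *\<^sub>R fvu x) \<le> \<epsilon> * h"
        using inner[OF t] by (simp add: algebra_simps)
    qed (use h in auto)
    then show ?thesis using h by (simp add: algebra_simps power2_eq_square)
  qed
  then show ?thesis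
    unfolding eventually_at_right_field using \<open>\<eta> > 0\<close> by auto
qed

lemma Dj_commute:
  assumes f: "smooth_on UNIV f"
  shows "Dj i (Dj j f) = Dj j (Dj i f)"
proof
  fix x :: "'a pt"
  let ?u = "axis i 1 :: 'a pt" and ?v = "axis j 1 :: 'a pt"
  have der: "((\<lambda>t. g (x + t *\<^sub>R axis k 1)) has_vector_derivative \<i> * Dj k g x) (at 0)"
    if "smooth_on UNIV g" for g :: "'a pt \<Rightarrow> complex" and k x
    using smooth_on_differentiable_at[OF open_UNIV that, of x] has_derivative_imp_Dj(1)
    by (metis UNIV_I differentiable_def)
  \<comment> \<open>Each \<open>Dj\<close> carries a factor 1 / i; undoing two of them gives i^2 =
    -1, whence the sign.\<close>
  have der2: "((\<lambda>t. \<i> * Dj l f (x + t *\<^sub>R axis k 1)) has_vector_derivative - Dj k (Dj l f) x) (at 0)" for k l x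
    using has_vector_derivative_mult_right[OF der[OF smooth_on_Dj[OF f]], of \<i>] by simp
  have cont: "isCont (\<lambda>x. - Dj k (Dj l f) x) x" for k l
    using smooth_on_continuous[OF smooth_on_Dj[OF smooth_on_Dj[OF f]], of k l]
    by (auto simp: continuous_on_eq_continuous_at intro!: continuous_intros)
  have "cmod (Dj i (Dj j f) x - Dj j (Dj i f) x) \<le> 2 * \<epsilon>" if "\<epsilon> > 0" for \<epsilon>
  proof -
    let ?L = "\<lambda>h. f (x + h *\<^sub>R ?u + h *\<^sub>R ?v) - f (x + h *\<^sub>R ?u) - f (x + h *\<^sub>R ?v) + f x"
    have "\<forall>\<^sub>F h in at_right 0. cmod (?L h - h^2 *\<^sub>R (- Dj i (Dj j f) x)) \<le> \<epsilon> * h^2"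
      by (rule second_difference_bound[OF der[OF f] der2 cont that])
    moreover have "\<forall>\<^sub>F h in at_right 0. cmod (?L h - h^2 *\<^sub>R (- Dj j (Dj i f) x)) \<le> \<epsilon> * h^2"
    proof -
      have swap: "?L h = f (x + h *\<^sub>R ?v + h *\<^sub>R ?u) - f (x + h *\<^sub>R ?v) - f (x + h *\<^sub>R ?u) + f x" for h
        by (simp add: add.assoc add.commute[of "h *\<^sub>R ?v"])
      show ?thesis
        unfolding swap by (rule second_difference_bound[OF der[OF f] der2 cont that])
    qed
    moreover have "\<forall>\<^sub>F h in at_right (0::real). h > 0"
      by (simp add: eventually_at_right_less)
    ultimately have "\<forall>\<^sub>F h in at_right (0::real). cmod (Dj i (Dj j f) x - Dj j (Dj i f) x) \<le> 2 * \<epsilon>"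
    proof eventually_elim
      case (elim h)
      \<comment> \<open>The same second difference approximates h^2 times the negative of either
        mixed derivative, so division by h^2 leaves a gap of at most 2 \<epsilon>.\<close>
      have "h^2 * cmod (Dj i (Dj j f) x - Dj j (Dj i f) x) =
        cmod ((?L h - h^2 *\<^sub>R (- Dj i (Dj j f) x)) - (?L h - h^2 *\<^sub>R (- Dj j (Dj i f) x)))"
        by (simp add: norm_mult norm_minus_commute flip: scaleR_diff_right)
      also have "\<dots> \<le> \<epsilon> * h^2 + \<epsilon> * h^2"
        by (rule order_trans[OF norm_triangle_ineq4 add_mono[OF elim(1,2)]])
      finally have "h^2 * cmod (Dj i (Dj j f) x - Dj j (Dj i f) x) \<le> h^2 * (2 * \<epsilon>)"
        by (simp add: algebra_simps)
      then show ?case using elim by simp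
    qed
    then show ?thesis
      using eventually_happens trivial_limit_at_right_real by blast
  qed
  note bound = this
  have "cmod (Dj i (Dj j f) x - Dj j (Dj i f) x) \<le> 0"
  proof (rule field_le_epsilon)
    fix e :: real assume "e > 0"
    then show "cmod (Dj i (Dj j f) x - Dj j (Dj i f) x) \<le> 0 + e" using bound[of "e / 2"] by simp
  qed
  then show "Dj i (Dj j f) x = Dj j (Dj i f) x" by simp
qed

lemma Dj_Dw_commute: "smooth_on UNIV f \<Longrightarrow> Dj i (Dw w f) = Dw w (Dj i f)"
proof (induction w)
  case (Cons j w)
  then show ?case using Dj_commute[OF smooth_on_Dw, of f i j w] by simp
qed simp

text \<open>The first letter of v occurs somewhere in w; it commutes past the letters before it, and
  the remaining words are again permutations of each other.\<close>

lemma Dw_perm: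
  assumes "smooth_on UNIV f" "mset v = mset w"
  shows "Dw v f = Dw w f"
  using assms(2)
proof (induction v arbitrary: w)
  case (Cons j v)
  then have "j \<in> set w" by (metis list.set_intros(1) set_mset_mset)
  then obtain a b where w: "w = a @ j # b" by (metis split_list)
  then have "mset v = mset (a @ b)" using Cons.prems by simp
  then have "Dw v f = Dw a (Dw b f)" using Cons.IH by (metis Dw_append)
  then show ?case
    using Dj_Dw_commute[OF smooth_on_Dw[OF assms(1)], of j a] by (simp add: w Dw_append)
qed simp

lemma Dw_eq_D_multi:
  assumes "smooth_on UNIV f"
  shows "Dw w f = D_multi (count (mset w)) f"
  unfolding D_multi_eq_Dw by (rule Dw_perm[OF assms]) (simp add: multiset_eq_iff count_mword)

lemma D_multi_Dw_append:
  assumes "smooth_on UNIV f"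
  shows "Dw w (D_multi \<alpha> f) = D_multi (\<lambda>j. count (mset w) j + \<alpha> j) f"
proof -
  have "Dw w (D_multi \<alpha> f) = Dw (w @ mword \<alpha>) f" by (simp add: D_multi_eq_Dw Dw_append)
  also have "\<dots> = D_multi (\<lambda>j. count (mset w) j + \<alpha> j) f"
    unfolding Dw_eq_D_multi[OF assms] by (rule arg_cong[of _ _ "\<lambda>\<beta>. D_multi \<beta> f"]) (auto simp: count_mword)
  finally show ?thesis .
qed

section \<open>Uniform limits of smooth functions\<close>

lemma smooth_on_has_derivative:
  assumes "smooth_on UNIV f"
  shows "(f has_derivative (\<lambda>h. \<Sum>j\<in>UNIV. of_real (h $ j) * (\<i> * Dj j f x))) (at x)"
proof -
  obtain f' where f': "(f has_derivative f') (at x)"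
    using smooth_on_differentiable_at[OF open_UNIV assms] by (auto simp: differentiable_def)
  then interpret f': bounded_linear f' by (rule has_derivative_bounded_linear)
  have "f' h = (\<Sum>j\<in>UNIV. of_real (h $ j) * (\<i> * Dj j f x))" for h
  proof -
    have "f' h = f' (\<Sum>j\<in>UNIV. (h $ j) *\<^sub>R axis j 1)"
      using basis_expansion[of h] by (simp add: scalar_mult_eq_scaleR)
    also have "\<dots> = (\<Sum>j\<in>UNIV. of_real (h $ j) * (\<i> * Dj j f x))"
      by (simp add: f'.sum f'.scaleR has_derivative_imp_Dj(2)[OF f']) (simp add: scaleR_conv_of_real)
    finally show ?thesis .
  qed
  then have "f' = (\<lambda>h. \<Sum>j\<in>UNIV. of_real (h $ j) * (\<i> * Dj j f x))" by blast
  with f' show ?thesis by simp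
qed

text \<open>The uniform limits \<open>G w\<close> of the derivatives along each word w fit together:
  termwise differentiation shows that \<open>G w\<close> has the partial derivatives
  \<open>G (j # w)\<close>, so \<open>G []\<close> is smooth and its derivatives are the
  \<open>G w\<close>.\<close>

lemma smooth_limit:
  fixes f :: "nat \<Rightarrow> 'd::{finite,linorder} pt \<Rightarrow> complex"
  assumes f: "\<And>n. smooth_on UNIV (f n)"
    and cau: "\<And>\<alpha>. uniformly_Cauchy_on UNIV (\<lambda>n. D_multi \<alpha> (f n))"
  obtains g where "smooth_on UNIV g"
    "\<And>\<alpha>. uniform_limit UNIV (\<lambda>n. D_multi \<alpha> (f n)) (D_multi \<alpha> g) sequentially"
proof -
  have "uniformly_Cauchy_on UNIV (\<lambda>n. Dw w (f n))" for w
    using cau by (simp add: Dw_eq_D_multi[OF f])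
  then have "\<exists>g. uniform_limit UNIV (\<lambda>n. Dw w (f n)) g sequentially" for w
    using Cauchy_uniformly_convergent uniformly_convergent_on_def by blast
  then obtain G where G: "\<And>w. uniform_limit UNIV (\<lambda>n. Dw w (f n)) (G w) sequentially"
    by metis
  have lim: "(\<lambda>n. Dw w (f n) x) \<longlonglongrightarrow> G w x" for w x
    using tendsto_uniform_limitI[OF G] by simp
  have der: "(G w has_derivative (\<lambda>h. \<Sum>j\<in>UNIV. of_real (h $ j) * (\<i> * G (j # w) x))) (at x)" for w x
  proof -
    let ?D = "\<lambda>F x h. \<Sum>j\<in>UNIV. of_real (h $ j) * (\<i> * F (j # w) x)"
    have "\<exists>g. \<forall>x\<in>UNIV. (\<lambda>n. Dw w (f n) x) \<longlonglongrightarrow> g x \<and> (g has_derivative ?D G x) (at x within UNIV)"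
    proof (rule has_derivative_sequence[where f' = "\<lambda>n. ?D (\<lambda>w. Dw w (f n))"])
      show "(Dw w (f n) has_derivative ?D (\<lambda>w. Dw w (f n)) x) (at x within UNIV)" for n x
        using smooth_on_has_derivative[OF smooth_on_Dw[OF f]] by simp
      show "\<forall>\<^sub>F n in sequentially. \<forall>x\<in>UNIV. \<forall>h. norm (?D (\<lambda>w. Dw w (f n)) x h - ?D G x h) \<le> e * norm h"
        if "e > 0" for e
      proof -
        \<comment> \<open>The differential is a sum of \<open>CARD('d)\<close> coordinate terms,
          each off by at most \<open>norm h * e'\<close>.\<close>
        define e' where "e' = e / CARD('d)"
        have "e' > 0" using that by (simp add: e'_def)
        then have "\<forall>\<^sub>F n in sequentially. \<forall>x\<in>UNIV. dist (Dw (j # w) (f n) x) (G (j # w) x) < e'" for j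
          using uniform_limitD[OF G] by blast
        then have "\<forall>\<^sub>F n in sequentially. \<forall>j. \<forall>x. dist (Dw (j # w) (f n) x) (G (j # w) x) < e'"
          by (simp add: eventually_all_finite)
        then show ?thesis
        proof eventually_elim
          case (elim n)
          have "norm (?D (\<lambda>w. Dw w (f n)) x h - ?D G x h) \<le> e * norm h" for x h
          proof -
            have "norm (?D (\<lambda>w. Dw w (f n)) x h - ?D G x h)
                = norm (\<Sum>j\<in>UNIV. of_real (h $ j) * (\<i> * (Dw (j # w) (f n) x - G (j # w) x)))"
              by (simp add: sum_subtractf algebra_simps)
            also have "\<dots> \<le> (\<Sum>j\<in>(UNIV::'d set). norm h * e')"
            proof (rule order_trans[OF norm_sum sum_mono])
              fix j
              show "norm (of_real (h $ j) * (\<i> * (Dw (j # w) (f n) x - G (j # w) x))) \<le> norm h * e'"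
                unfolding norm_mult using elim component_le_norm_cart[of h j]
                by (intro mult_mono) (auto simp: dist_norm less_imp_le)
            qed
            also have "\<dots> = e * norm h" by (simp add: e'_def)
            finally show ?thesis .
          qed
          then show ?case by simp
        qed
      qed
      show "(\<lambda>n. Dw w (f n) 0) \<longlonglongrightarrow> G w 0" by (rule lim)
    qed auto
    then obtain g where g: "\<And>x. (\<lambda>n. Dw w (f n) x) \<longlonglongrightarrow> g x" "\<And>x. (g has_derivative ?D G x) (at x)"
      by auto
    have "g = G w" using LIMSEQ_unique[OF g(1) lim] by blast
    with g(2) show ?thesis by simp
  qed
  have Dj_G: "Dj j (G w) = G (j # w)" for j w
  proof
    fix x
    have "(\<Sum>i\<in>UNIV. complex_of_real (axis j 1 $ i) * (\<i> * G (i # w) x)) = \<i> * G (j # w) x"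
      by (subst sum.remove[of _ j]) (auto simp: axis_def)
    then show "Dj j (G w) x = G (j # w) x"
      by (simp add: has_derivative_imp_Dj(2)[OF der])
  qed
  have "Dw w (G []) = G w" for w by (induction w) (auto simp: Dj_G)
  moreover have "Ck_on k UNIV (G w)" for k w
  proof (induction k arbitrary: w)
    case 0
    show ?case using der[THEN has_derivative_continuous] by (simp add: continuous_on_eq_continuous_at)
  next
    case (Suc k)
    then show ?case using der by (auto simp: Dj_G differentiable_on_def differentiable_def)
  qed
  ultimately show ?thesis
    using that[of "G []"] G by (simp add: smooth_on_def D_multi_eq_Dw)
qed

section \<open>A Sobolev inequality\<close>

text \<open>Integrate \<open>g'\<close> up to t from a point left of -R, where g vanishes.\<close>

lemma compactly_supported_le_nn_integral_deriv:
  fixes g :: "real \<Rightarrow> complex"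
  assumes der: "\<And>t. (g has_vector_derivative g' t) (at t)"
    and cont: "continuous_on UNIV g'"
    and van: "\<And>t. t < - R \<Longrightarrow> g t = 0"
  shows "ennreal (cmod (g t)) \<le> (\<integral>\<^sup>+t. ennreal (cmod (g' t)) \<partial>lborel)"
proof -
  \<comment> \<open>Strictly left of -R, and not right of t, so that the interval runs in the right
    direction.\<close>
  define a where "a = min t (- R - 1)"
  have a: "a \<le> t" "g a = 0" using van by (auto simp: a_def)
  have cont': "continuous_on {a..t} g'" using cont continuous_on_subset by blast
  have "(g' has_integral g t - g a) {a..t}"
    by (rule fundamental_theorem_of_calculus[OF a(1)]) (use der has_vector_derivative_at_within in blast)
  then have 1: "integral {a..t} g' = g t" using a by (simp add: integral_unique)
  have int: "(\<lambda>t. cmod (g' t)) integrable_on {a..t}"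
    by (intro integrable_continuous_real continuous_intros cont')
  have "cmod (g t) \<le> integral {a..t} (\<lambda>t. cmod (g' t))"
    unfolding 1[symmetric]
    by (rule integral_norm_bound_integral) (use integrable_continuous_real[OF cont'] int in auto)
  then have "ennreal (cmod (g t)) \<le> ennreal (integral {a..t} (\<lambda>t. cmod (g' t)))"
    by (rule ennreal_leI)
  also have "\<dots> = (\<integral>\<^sup>+x. ennreal (indicator {a..t} x * cmod (g' x)) \<partial>lborel)"
  proof (rule nn_integral_has_integral_lborel[symmetric])
    show "(\<lambda>x. indicator {a..t} x * cmod (g' x)) \<in> borel_measurable borel"
      using cont by (intro borel_measurable_times borel_measurable_indicator borel_measurable_continuous_onI continuous_on_norm) auto
    show "((\<lambda>x. indicator {a..t} x * cmod (g' x)) has_integral integral {a..t} (\<lambda>t. cmod (g' t))) UNIV"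
    proof -
      have "(\<lambda>x. indicator {a..t} x * cmod (g' x)) = (\<lambda>x. if x \<in> {a..t} then cmod (g' x) else 0)"
        by (auto simp: fun_eq_iff indicator_def)
      then show ?thesis using int by (simp only: has_integral_restrict_UNIV integrable_integral)
    qed
  qed (auto simp: indicator_def)
  also have "\<dots> \<le> (\<integral>\<^sup>+t. ennreal (cmod (g' t)) \<partial>lborel)"
    by (intro nn_integral_mono ennreal_leI) (auto simp: indicator_def)
  finally show ?thesis .
qed

text \<open>Interpolates between the point x (S empty) and the integration variable y (S the whole
  basis), one coordinate at a time.\<close>

definition subst_coords :: "'a::euclidean_space set \<Rightarrow> 'a \<Rightarrow> ('a \<Rightarrow> real) \<Rightarrow> 'a" where
  "subst_coords S x y = (\<Sum>b\<in>Basis. (if b \<in> S then y b else x \<bullet> b) *\<^sub>R b)"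

text \<open>Each further letter of w applies the one-dimensional bound on a line parallel to one
  axis: that coordinate of x becomes an integration variable, and the integrand gains the matching
  derivative. Distinct letters mean distinct axes, so the iterated integrals assemble to a product
  measure.\<close>

lemma sobolev_partial:
  fixes f :: "'d::{finite,linorder} pt \<Rightarrow> complex"
  assumes f: "smooth_on UNIV f" and van: "\<And>x. norm x > R \<Longrightarrow> f x = 0"
    and "distinct w"
  shows "ennreal (cmod (f x)) \<le>
    (\<integral>\<^sup>+y. ennreal (cmod (Dw w f (subst_coords ((\<lambda>j. axis j 1) ` set w) x y)))
      \<partial>Pi\<^sub>M ((\<lambda>j. axis j 1) ` set w) (\<lambda>_. lborel))"
  using \<open>distinct w\<close>
proof (induction w)
  case Nil
  show ?case by (simp add: subst_coords_def euclidean_representation PiM_empty nn_integral_count_space_finite)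
next
  case (Cons j w)
  interpret product_sigma_finite "\<lambda>_::'d pt. lborel :: real measure" ..
  define S where "S = (\<lambda>j. axis j 1 :: 'd pt) ` set w"
  define b where "b = (axis j 1 :: 'd pt)"
  define g where "g = Dw w f"
  have S: "finite S" "S \<subseteq> Basis" "b \<notin> S" "b \<in> Basis"
    using Cons.prems by (auto simp: S_def b_def axis_eq_axis Basis_vec_def)
  have g: "smooth_on UNIV g" by (simp add: g_def f smooth_on_Dw)
  have g0: "g x = 0" if "norm x > R" for x
  proof -
    have "open {x::'d pt. norm x > R}" by (intro open_Collect_less continuous_intros)
    then have "Dw w f x = Dw w 0 x" by (rule Dw_cong) (use van that in auto)
    then show ?thesis by (simp add: g_def)
  qed
  \<comment> \<open>The line is parametrised by its b-coordinate t, so z itself sits at t =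
    \<open>z \<bullet> b\<close>.\<close>
  have one: "ennreal (cmod (g z)) \<le> (\<integral>\<^sup>+t. ennreal (cmod (Dj j g (z + (t - z \<bullet> b) *\<^sub>R b))) \<partial>lborel)" for z
  proof -
    have "ennreal (cmod (g (z + ((z \<bullet> b) - z \<bullet> b) *\<^sub>R b)))
        \<le> (\<integral>\<^sup>+t. ennreal (cmod (\<i> * Dj j g (z + (t - z \<bullet> b) *\<^sub>R b))) \<partial>lborel)"
    proof (rule compactly_supported_le_nn_integral_deriv
          [where R = "\<bar>R\<bar>" and g = "\<lambda>t. g (z + (t - z \<bullet> b) *\<^sub>R b)"])
      fix t
      have 1: "((\<lambda>r. r - t) has_vector_derivative 1) (at t)" by (auto intro!: derivative_eq_intros)
      have "((\<lambda>r. g ((z + (t - z \<bullet> b) *\<^sub>R b) + r *\<^sub>R b)) has_vector_derivative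
          \<i> * Dj j g (z + (t - z \<bullet> b) *\<^sub>R b)) (at (t - t))"
        using has_derivative_imp_Dj(1)[OF smooth_on_has_derivative[OF g]] by (simp add: b_def)
      from vector_diff_chain_at[OF 1 this]
      have "((\<lambda>r. g ((z + (t - z \<bullet> b) *\<^sub>R b) + (r - t) *\<^sub>R b)) has_vector_derivative
          \<i> * Dj j g (z + (t - z \<bullet> b) *\<^sub>R b)) (at t)" by (simp add: o_def)
      moreover have "(z + (t - z \<bullet> b) *\<^sub>R b) + (r - t) *\<^sub>R b = z + (r - z \<bullet> b) *\<^sub>R b" for r
        by (simp add: algebra_simps)
      ultimately show "((\<lambda>t. g (z + (t - z \<bullet> b) *\<^sub>R b)) has_vector_derivative
          \<i> * Dj j g (z + (t - z \<bullet> b) *\<^sub>R b)) (at t)" by simp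
    next
      show "continuous_on UNIV (\<lambda>t. \<i> * Dj j g (z + (t - z \<bullet> b) *\<^sub>R b))"
        by (intro continuous_intros continuous_on_compose2[OF smooth_on_continuous[OF smooth_on_Dj[OF g]]]) auto
    next
      fix t :: real assume "t < - \<bar>R\<bar>"
      have "(z + (t - z \<bullet> b) *\<^sub>R b) \<bullet> b = t"
        using S by (simp add: algebra_simps inner_add_left)
      then have "\<bar>t\<bar> \<le> norm (z + (t - z \<bullet> b) *\<^sub>R b)"
        using Basis_le_norm[OF S(4), of "z + (t - z \<bullet> b) *\<^sub>R b"] by simp
      then show "g (z + (t - z \<bullet> b) *\<^sub>R b) = 0" using \<open>t < - \<bar>R\<bar>\<close> by (intro g0) auto
    qed
    then show ?thesis by (simp add: norm_mult)
  qed
  have cont: "continuous_on UNIV (Dj j g)" by (rule smooth_on_continuous[OF smooth_on_Dj[OF g]])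
  have meas: "(\<lambda>y. ennreal (cmod (Dj j g (subst_coords (insert b S) x y))))
      \<in> borel_measurable (Pi\<^sub>M (insert b S) (\<lambda>_. lborel))"
  proof -
    have "(\<lambda>y. if c \<in> insert b S then y c else x \<bullet> c) \<in> borel_measurable (Pi\<^sub>M (insert b S) (\<lambda>_. lborel))" for c
    proof (cases "c \<in> insert b S")
      case True
      have "(\<lambda>y. y c) \<in> Pi\<^sub>M (insert b S) (\<lambda>_. lborel) \<rightarrow>\<^sub>M (lborel :: real measure)"
        by (rule measurable_component_singleton[OF True])
      with True show ?thesis by (simp add: measurable_cong_sets[OF refl sets_lborel])
    qed simp
    then have "subst_coords (insert b S) x \<in> borel_measurable (Pi\<^sub>M (insert b S) (\<lambda>_. lborel))"
      unfolding subst_coords_def[abs_def] by (intro borel_measurable_sum borel_measurable_scaleR) auto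
    moreover have "(\<lambda>z. ennreal (cmod (Dj j g z))) \<in> borel_measurable borel"
      using cont by (intro measurable_compose[OF _ measurable_ennreal] borel_measurable_continuous_onI continuous_on_norm)
    ultimately show ?thesis by (rule measurable_compose)
  qed
  have sub: "subst_coords S x y + (t - subst_coords S x y \<bullet> b) *\<^sub>R b = subst_coords (insert b S) x (y(b := t))" for y t
  proof (rule euclidean_eqI)
    fix c :: "'d pt" assume c: "c \<in> Basis"
    show "(subst_coords S x y + (t - subst_coords S x y \<bullet> b) *\<^sub>R b) \<bullet> c = subst_coords (insert b S) x (y(b := t)) \<bullet> c"
      using c S by (cases "c = b") (auto simp: subst_coords_def inner_add_left inner_Basis)
  qed
  have "ennreal (cmod (f x)) \<le> (\<integral>\<^sup>+y. ennreal (cmod (g (subst_coords S x y))) \<partial>Pi\<^sub>M S (\<lambda>_. lborel))"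
    using Cons by (simp add: S_def g_def)
  also have "\<dots> \<le> (\<integral>\<^sup>+y. \<integral>\<^sup>+t. ennreal (cmod (Dj j g (subst_coords (insert b S) x (y(b := t))))) \<partial>lborel
      \<partial>Pi\<^sub>M S (\<lambda>_. lborel))"
    using one by (intro nn_integral_mono) (simp add: sub[symmetric])
  also have "\<dots> = (\<integral>\<^sup>+y. ennreal (cmod (Dj j g (subst_coords (insert b S) x y))) \<partial>Pi\<^sub>M (insert b S) (\<lambda>_. lborel))"
    by (rule product_nn_integral_insert[symmetric, OF S(1,3) meas])
  finally show ?case by (simp add: S_def b_def g_def)
qed

text \<open>Listing every direction once replaces all coordinates of x and raises each \<alpha>_j by
  exactly one.\<close>

lemma sobolev_L1:
  fixes f :: "'d::{finite,linorder} pt \<Rightarrow> complex"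
  assumes f: "smooth_on UNIV f" and van: "\<And>x. norm x > R \<Longrightarrow> f x = 0"
  shows "ennreal (cmod (D_multi \<alpha> f x)) \<le> (\<integral>\<^sup>+y. ennreal (cmod (D_multi (\<lambda>j. Suc (\<alpha> j)) f y)) \<partial>lborel)"
proof -
  define w where "w = sorted_list_of_set (UNIV :: 'd set)"
  define F where "F = D_multi (\<lambda>j. Suc (\<alpha> j)) f"
  have w: "distinct w" "set w = UNIV" by (auto simp: w_def)
  have F: "Dw w (D_multi \<alpha> f) = F"
    using w by (simp add: D_multi_Dw_append[OF f] F_def distinct_count_atmost_1)
  have B: "(\<lambda>j. axis j 1 :: 'd pt) ` set w = Basis" by (auto simp: w Basis_vec_def)
  have van': "D_multi \<alpha> f x = 0" if "norm x > R" for x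
  proof -
    have "open {x::'d pt. norm x > R}" by (intro open_Collect_less continuous_intros)
    then have "Dw (mword \<alpha>) f x = Dw (mword \<alpha>) 0 x" by (rule Dw_cong) (use van that in auto)
    then show ?thesis by (simp add: D_multi_eq_Dw)
  qed
  have smooth: "smooth_on UNIV (D_multi \<alpha> f)" by (simp add: D_multi_eq_Dw smooth_on_Dw f)
  have "continuous_on UNIV F" by (simp add: F_def D_multi_eq_Dw smooth_on_Dw f smooth_on_continuous)
  then have meas: "(\<lambda>z. ennreal (cmod (F z))) \<in> borel_measurable borel"
    by (intro measurable_compose[OF _ measurable_ennreal] borel_measurable_continuous_onI continuous_on_norm)
  have "ennreal (cmod (D_multi \<alpha> f x)) \<le>
      (\<integral>\<^sup>+y. ennreal (cmod (F (subst_coords Basis x y))) \<partial>Pi\<^sub>M Basis (\<lambda>_. lborel))"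
    using sobolev_partial[OF smooth van' w(1), where x = x] by (simp add: B F)
  also have "\<dots> = (\<integral>\<^sup>+y. ennreal (cmod (F (\<Sum>b\<in>Basis. y b *\<^sub>R b))) \<partial>Pi\<^sub>M Basis (\<lambda>_. lborel))"
    by (simp add: subst_coords_def)
  also have "\<dots> = (\<integral>\<^sup>+y. ennreal (cmod (F y)) \<partial>lborel)"
    by (subst lborel_eq, subst nn_integral_distr) (simp_all add: meas)
  finally show ?thesis by (simp add: F_def)
qed

section \<open>Topologies given by families of seminorms\<close>

text \<open>Everything is phrased with differences of members, so that the conditions pass to
  arbitrary subsets. A singleton \<open>I\<close> encodes a norm, \<open>I = {0<..}\<close> a
  projective limit; monotonicity in the index makes the family directed.\<close>

definition seminorm_family :: "'v::ab_group_add set \<Rightarrow> real set \<Rightarrow> (real \<Rightarrow> 'v \<Rightarrow> real) \<Rightarrow> bool" where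
  "seminorm_family X I n \<longleftrightarrow> I \<noteq> {} \<and> (\<forall>i\<in>I. n i 0 = 0) \<and>
     (\<forall>i\<in>I. \<forall>x\<in>X. \<forall>y\<in>X. \<forall>z\<in>X. n i (x - z) \<le> n i (x - y) + n i (y - z)) \<and>
     (\<forall>i\<in>I. \<forall>j\<in>I. i \<le> j \<longrightarrow> (\<forall>x\<in>X. \<forall>y\<in>X. n i (x - y) \<le> n j (x - y)))"

definition sn_open :: "'v::ab_group_add set \<Rightarrow> real set \<Rightarrow> (real \<Rightarrow> 'v \<Rightarrow> real) \<Rightarrow> 'v set \<Rightarrow> bool" where
  "sn_open X I n G \<longleftrightarrow> G \<subseteq> X \<and> (\<forall>x\<in>G. \<exists>i\<in>I. \<exists>\<epsilon>>0. \<forall>y\<in>X. n i (y - x) < \<epsilon> \<longrightarrow> y \<in> G)"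

text \<open>A common normal form: \<open>norm_topology\<close>, \<open>proj_lim\<close> and
  \<open>subtopology\<close> are all reduced to it below, which makes them comparable by
  rewriting.\<close>

definition sn_top :: "'v::ab_group_add set \<Rightarrow> real set \<Rightarrow> (real \<Rightarrow> 'v \<Rightarrow> real) \<Rightarrow> 'v topology" where
  "sn_top X I n = topology (sn_open X I n)"

lemma seminorm_family_subset:
  "seminorm_family X I n \<Longrightarrow> Y \<subseteq> X \<Longrightarrow> seminorm_family Y I n"
  unfolding seminorm_family_def by (meson subsetD)

lemma openin_sn_top:
  assumes "seminorm_family X I n"
  shows "openin (sn_top X I n) = sn_open X I n"
proof -
  have "istopology (sn_open X I n)"
    unfolding istopology_def
  proof (intro conjI allI impI)
    fix S T assume S: "sn_open X I n S" and T: "sn_open X I n T"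
    show "sn_open X I n (S \<inter> T)"
      unfolding sn_open_def
    proof (intro conjI ballI)
      fix x assume x: "x \<in> S \<inter> T"
      obtain i \<epsilon> where i: "i \<in> I" "\<epsilon> > 0" "\<And>y. y \<in> X \<Longrightarrow> n i (y - x) < \<epsilon> \<Longrightarrow> y \<in> S"
        using S x unfolding sn_open_def by blast
      obtain j \<delta> where j: "j \<in> I" "\<delta> > 0" "\<And>y. y \<in> X \<Longrightarrow> n j (y - x) < \<delta> \<Longrightarrow> y \<in> T"
        using T x unfolding sn_open_def by blast
      have "x \<in> X" using S x unfolding sn_open_def by blast
      \<comment> \<open>The index set is linearly ordered, so the seminorm with the larger index
        controls both conditions.\<close>
      moreover have ij: "max i j \<in> I" using i j by (simp add: max_def)
      ultimately have "n i (y - x) \<le> n (max i j) (y - x)" "n j (y - x) \<le> n (max i j) (y - x)" if "y \<in> X" for y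
        using assms i(1) j(1) that unfolding seminorm_family_def by (meson max.cobounded1 max.cobounded2)+
      then have "\<forall>y\<in>X. n (max i j) (y - x) < min \<epsilon> \<delta> \<longrightarrow> y \<in> S \<inter> T"
        using i(3) j(3) by fastforce
      moreover note ij
      ultimately show "\<exists>i\<in>I. \<exists>\<epsilon>>0. \<forall>y\<in>X. n i (y - x) < \<epsilon> \<longrightarrow> y \<in> S \<inter> T"
        using i(2) j(2) by (metis min_less_iff_conj)
    qed (use S in \<open>auto simp: sn_open_def\<close>)
  next
    fix K assume K: "\<forall>S\<in>K. sn_open X I n S"
    show "sn_open X I n (\<Union>K)"
      using K unfolding sn_open_def by (meson Union_iff Union_least)
  qed
  then show ?thesis by (simp add: sn_top_def)
qed

lemma topspace_sn_top:
  assumes "seminorm_family X I n"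
  shows "topspace (sn_top X I n) = X"
proof -
  obtain i where "i \<in> I" using assms by (auto simp: seminorm_family_def)
  then have "sn_open X I n X" unfolding sn_open_def using zero_less_one by blast
  then show ?thesis
    unfolding topspace_def openin_sn_top[OF assms]
    by (intro equalityI Union_least Union_upper) (auto simp: sn_open_def)
qed

lemma sn_open_ball:
  assumes "seminorm_family X I n" "x \<in> X" "i \<in> I"
  shows "sn_open X I n {y \<in> X. n i (y - x) < \<epsilon>}"
  unfolding sn_open_def
proof (intro conjI ballI)
  fix y assume y: "y \<in> {y \<in> X. n i (y - x) < \<epsilon>}"
  have "\<forall>z\<in>X. n i (z - y) < \<epsilon> - n i (y - x) \<longrightarrow> z \<in> {y \<in> X. n i (y - x) < \<epsilon>}"
    using assms y unfolding seminorm_family_def by (smt (verit) mem_Collect_eq)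
  then show "\<exists>k\<in>I. \<exists>\<epsilon>'>0. \<forall>z\<in>X. n k (z - y) < \<epsilon>' \<longrightarrow> z \<in> {y \<in> X. n i (y - x) < \<epsilon>}"
    using y assms(3) by (intro bexI[of _ i] exI[of _ "\<epsilon> - n i (y - x)"]) auto
qed auto

lemma topology_generated_by_eqI:
  assumes "\<And>G. G \<in> S \<Longrightarrow> openin T G"
    and "\<And>G x. openin T G \<Longrightarrow> x \<in> G \<Longrightarrow> \<exists>B\<in>S. x \<in> B \<and> B \<subseteq> G"
  shows "topology_generated_by S = T"
proof -
  have 1: "openin T G" if "generate_topology_on S G" for G
    by (rule generate_topology_on.induct[OF that]) (auto intro: assms(1))
  have "openin (topology_generated_by S) G" if G: "openin T G" for G
  proof -
    have "G = \<Union>{B \<in> S. B \<subseteq> G}" using assms(2)[OF G] by blast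
    moreover have "openin (topology_generated_by S) (\<Union>{B \<in> S. B \<subseteq> G})"
      by (intro openin_Union) (auto intro: topology_generated_by_Basis)
    ultimately show ?thesis by simp
  qed
  with 1 show ?thesis unfolding topology_eq openin_topology_generated_by_iff by blast
qed
lemma norm_topology_eq_sn_top:
  assumes "seminorm_family V {i} n"
  shows "norm_topology V (n i) = sn_top V {i} n"
  unfolding norm_topology_def
proof (rule topology_generated_by_eqI)
  show "openin (sn_top V {i} n) G" if "G \<in> {{y \<in> V. n i (y - x) < \<epsilon>} |x \<epsilon>. x \<in> V \<and> 0 < \<epsilon>}" for G
    using that sn_open_ball[OF assms] by (auto simp: openin_sn_top[OF assms])
next
  fix G x assume G: "openin (sn_top V {i} n) G" and x: "x \<in> G"
  have G': "sn_open V {i} n G" using G by (simp add: openin_sn_top[OF assms])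
  then have "x \<in> V" using x unfolding sn_open_def by blast
  moreover obtain \<epsilon> where "\<epsilon> > 0" "\<forall>y\<in>V. n i (y - x) < \<epsilon> \<longrightarrow> y \<in> G"
    using G' x unfolding sn_open_def by blast
  moreover have "n i (x - x) = 0" using assms by (simp add: seminorm_family_def)
  ultimately show "\<exists>B\<in>{{y \<in> V. n i (y - x) < \<epsilon>} |x \<epsilon>. x \<in> V \<and> 0 < \<epsilon>}. x \<in> B \<and> B \<subseteq> G"
    by (intro bexI[of _ "{y \<in> V. n i (y - x) < \<epsilon>}"]) auto
qed

text \<open>Around each of its points an open set of \<open>sn_top\<close> contains a ball of a
  single seminorm, and such a ball is the trace of a ball of a single space of the family.\<close>

lemma proj_lim_eq_sn_top:
  assumes X: "seminorm_family (\<Inter>i\<in>I. V i) I n"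
    and V: "\<And>i. i \<in> I \<Longrightarrow> seminorm_family (V i) {i} n"
  shows "proj_lim I (\<lambda>i. sn_top (V i) {i} n) = sn_top (\<Inter>i\<in>I. V i) I n"
  unfolding proj_lim_def
proof (rule topology_generated_by_eqI)
  let ?X = "\<Inter>i\<in>I. V i"
  have top: "(\<Inter>i\<in>I. topspace (sn_top (V i) {i} n)) = ?X"
    using topspace_sn_top[OF V] by auto
  {
    fix G assume "G \<in> {(\<Inter>i\<in>I. topspace (sn_top (V i) {i} n)) \<inter> W |i W. i \<in> I \<and> openin (sn_top (V i) {i} n) W}"
    then obtain i W where i: "i \<in> I" "sn_open (V i) {i} n W" and G: "G = ?X \<inter> W"
      unfolding top using openin_sn_top[OF V] by auto
    have "sn_open ?X I n G"
      unfolding sn_open_def G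
    proof (intro conjI ballI)
      fix x assume "x \<in> ?X \<inter> W"
      then obtain \<epsilon> where "\<epsilon> > 0" "\<forall>y\<in>V i. n i (y - x) < \<epsilon> \<longrightarrow> y \<in> W"
        using i by (auto simp: sn_open_def)
      then show "\<exists>i\<in>I. \<exists>\<epsilon>>0. \<forall>y\<in>?X. n i (y - x) < \<epsilon> \<longrightarrow> y \<in> ?X \<inter> W"
        using i(1) by (intro bexI[of _ i] exI[of _ \<epsilon>]) auto
    qed auto
    then show "openin (sn_top ?X I n) G" by (simp add: openin_sn_top[OF X])
  next
    fix G x assume G: "openin (sn_top ?X I n) G" and x: "x \<in> G"
    then obtain i \<epsilon> where i: "i \<in> I" and e: "\<epsilon> > 0" "\<forall>y\<in>?X. n i (y - x) < \<epsilon> \<longrightarrow> y \<in> G" and xX: "x \<in> ?X"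
      unfolding openin_sn_top[OF X] sn_open_def by blast
    have "x \<in> V i" using xX i by blast
    let ?B = "?X \<inter> {y \<in> V i. n i (y - x) < \<epsilon>}"
    have "openin (sn_top (V i) {i} n) {y \<in> V i. n i (y - x) < \<epsilon>}"
      using sn_open_ball[OF V[OF i] \<open>x \<in> V i\<close>, of i \<epsilon>] by (simp add: openin_sn_top[OF V[OF i]])
    then have "?B \<in> {(\<Inter>i\<in>I. topspace (sn_top (V i) {i} n)) \<inter> W |i W. i \<in> I \<and> openin (sn_top (V i) {i} n) W}"
      unfolding top using i by blast
    moreover have "n i (x - x) = 0" using V[OF i] by (simp add: seminorm_family_def)
    then have "x \<in> ?B" using xX i e by auto
    moreover have "?B \<subseteq> G" using e by auto
    ultimately show "\<exists>B\<in>{(\<Inter>i\<in>I. topspace (sn_top (V i) {i} n)) \<inter> W |i W. i \<in> I \<and> openin (sn_top (V i) {i} n) W}.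
        x \<in> B \<and> B \<subseteq> G" by (intro bexI[of _ ?B] conjI)
  }
qed

lemma subtopology_sn_top:
  assumes X: "seminorm_family X I n" and C: "C \<subseteq> X"
  shows "subtopology (sn_top X I n) C = sn_top C I n"
proof -
  have CC: "seminorm_family C I n" by (rule seminorm_family_subset[OF X C])
  show ?thesis
    unfolding topology_eq openin_subtopology openin_sn_top[OF X] openin_sn_top[OF CC]
  proof (intro allI iffI)
    fix G assume "\<exists>T. sn_open X I n T \<and> G = T \<inter> C"
    then obtain T where T: "sn_open X I n T" "G = T \<inter> C" by blast
    show "sn_open C I n G"
      unfolding sn_open_def
    proof (intro conjI ballI)
      fix x assume "x \<in> G"
      then obtain i \<epsilon> where "i \<in> I" "\<epsilon> > 0" "\<forall>y\<in>X. n i (y - x) < \<epsilon> \<longrightarrow> y \<in> T"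
        using T unfolding sn_open_def by blast
      then show "\<exists>i\<in>I. \<exists>\<epsilon>>0. \<forall>y\<in>C. n i (y - x) < \<epsilon> \<longrightarrow> y \<in> G"
        using T C by (intro bexI[of _ i] exI[of _ \<epsilon>]) auto
    qed (use T in auto)
  next
    fix G assume G: "sn_open C I n G"
    \<comment> \<open>Collecting every ambient open set whose trace lies in G avoids choosing a
      radius at each point.\<close>
    define K where "K = {B. sn_open X I n B \<and> B \<inter> C \<subseteq> G}"
    have "openin (sn_top X I n) (\<Union>K)" by (intro openin_Union) (auto simp: K_def openin_sn_top[OF X])
    moreover have "G = \<Union>K \<inter> C"
    proof
      show "G \<subseteq> \<Union>K \<inter> C"
      proof
        fix x assume x: "x \<in> G"
        then obtain i \<epsilon> where i: "i \<in> I" "\<epsilon> > 0" "\<forall>y\<in>C. n i (y - x) < \<epsilon> \<longrightarrow> y \<in> G" and xC: "x \<in> C"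
          using G unfolding sn_open_def by blast
        have xX: "x \<in> X" using xC C by blast
        have "sn_open X I n {y \<in> X. n i (y - x) < \<epsilon>}" by (rule sn_open_ball[OF X xX i(1)])
        moreover have "n i (x - x) = 0" using X i(1) by (simp add: seminorm_family_def)
        ultimately show "x \<in> \<Union>K \<inter> C"
          using i xX xC by (auto simp: K_def intro!: exI[of _ "{y \<in> X. n i (y - x) < \<epsilon>}"])
      qed
    qed (auto simp: K_def)
    ultimately show "\<exists>T. sn_open X I n T \<and> G = T \<inter> C" unfolding openin_sn_top[OF X] by blast
  qed
qed

lemma in_closure_of_sn_top:
  assumes X: "seminorm_family X I n"
  shows "x \<in> sn_top X I n closure_of S \<longleftrightarrow>
    x \<in> X \<and> (\<forall>i\<in>I. \<forall>\<epsilon>>0. \<exists>y\<in>S. y \<in> X \<and> n i (y - x) < \<epsilon>)"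
proof
  assume *: "x \<in> sn_top X I n closure_of S"
  then have x: "x \<in> X" by (simp add: in_closure_of topspace_sn_top[OF X])
  show "x \<in> X \<and> (\<forall>i\<in>I. \<forall>\<epsilon>>0. \<exists>y\<in>S. y \<in> X \<and> n i (y - x) < \<epsilon>)"
  proof (intro conjI x ballI allI impI)
    fix i and \<epsilon> :: real assume i: "i \<in> I" "\<epsilon> > 0"
    let ?B = "{y \<in> X. n i (y - x) < \<epsilon>}"
    have "openin (sn_top X I n) ?B"
      using sn_open_ball[OF X x i(1)] by (simp add: openin_sn_top[OF X])
    moreover have "n i (x - x) = 0" using X i(1) by (simp add: seminorm_family_def)
    then have "x \<in> ?B" using x i by simp
    moreover have "\<forall>G. x \<in> G \<and> openin (sn_top X I n) G \<longrightarrow> (\<exists>y. y \<in> S \<and> y \<in> G)"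
      using * by (simp add: in_closure_of)
    ultimately have "\<exists>y. y \<in> S \<and> y \<in> ?B" by (elim allE[of _ ?B]) simp
    then show "\<exists>y\<in>S. y \<in> X \<and> n i (y - x) < \<epsilon>" by auto
  qed
next
  assume *: "x \<in> X \<and> (\<forall>i\<in>I. \<forall>\<epsilon>>0. \<exists>y\<in>S. y \<in> X \<and> n i (y - x) < \<epsilon>)"
  show "x \<in> sn_top X I n closure_of S"
    unfolding in_closure_of topspace_sn_top[OF X] openin_sn_top[OF X] sn_open_def
    using * by blast
qed

lemma sn_top_cong:
  assumes "\<And>i x y. i \<in> I \<Longrightarrow> x \<in> X \<Longrightarrow> y \<in> X \<Longrightarrow> n i (y - x) = m i (y - x)"
  shows "sn_top X I n = sn_top X I m"
proof -
  have "sn_open X I n G = sn_open X I m G" for G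
    unfolding sn_open_def using assms by (metis subsetD)
  then have "sn_open X I n = sn_open X I m" by blast
  then show ?thesis by (simp add: sn_top_def)
qed

text \<open>Linear counterpart of \<open>seminorm_family\<close>, which serves the normed spaces
  (singleton \<open>I\<close>) and the projective limits alike. Nonnegativity and vanishing at 0
  follow from these axioms.\<close>

locale sn_space =
  fixes X :: "('x \<Rightarrow> complex) set" and I :: "real set" and n :: "real \<Rightarrow> ('x \<Rightarrow> complex) \<Rightarrow> real"
  assumes subspace: "cfun.subspace X"
    and nonempty: "I \<noteq> {}"
    and triangle: "\<And>i f g. i \<in> I \<Longrightarrow> f \<in> X \<Longrightarrow> g \<in> X \<Longrightarrow> n i (f + g) \<le> n i f + n i g"
    and scale: "\<And>i c f. i \<in> I \<Longrightarrow> f \<in> X \<Longrightarrow> n i (cscale c f) = cmod c * n i f"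
    and mono: "\<And>i j f. i \<in> I \<Longrightarrow> j \<in> I \<Longrightarrow> f \<in> X \<Longrightarrow> i \<le> j \<Longrightarrow> n i f \<le> n j f"
begin

lemma add_mem: "f \<in> X \<Longrightarrow> g \<in> X \<Longrightarrow> f + g \<in> X"
  and diff_mem: "f \<in> X \<Longrightarrow> g \<in> X \<Longrightarrow> f - g \<in> X"
  and scale_mem: "f \<in> X \<Longrightarrow> cscale c f \<in> X"
  and zero_mem: "0 \<in> X"
  and sum_mem: "(\<And>a. a \<in> A \<Longrightarrow> F a \<in> X) \<Longrightarrow> sum F A \<in> X"
  using subspace by (auto intro: cfun.subspace_add cfun.subspace_diff cfun.subspace_scale
      cfun.subspace_0 cfun.subspace_sum)

lemma n_zero: "i \<in> I \<Longrightarrow> n i 0 = 0"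
  using scale[of i 0 0] zero_mem by (simp add: cscale_def zero_fun_def)

lemma n_minus: "i \<in> I \<Longrightarrow> f \<in> X \<Longrightarrow> n i (- f) = n i f"
  using scale[of i f "-1"] by (simp add: cscale_def fun_Compl_def)

lemma n_nonneg: "i \<in> I \<Longrightarrow> f \<in> X \<Longrightarrow> 0 \<le> n i f"
  using triangle[of i f "- f"] n_minus[of i f] n_zero[of i] cfun.subspace_neg[OF subspace, of f] by simp

lemma n_diff_commute: "i \<in> I \<Longrightarrow> f \<in> X \<Longrightarrow> g \<in> X \<Longrightarrow> n i (f - g) = n i (g - f)"
  using n_minus[of i "f - g"] diff_mem by simp

lemma triangle_diff: "i \<in> I \<Longrightarrow> f \<in> X \<Longrightarrow> g \<in> X \<Longrightarrow> h \<in> X \<Longrightarrow> n i (f - h) \<le> n i (f - g) + n i (g - h)"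
  using triangle[of i "f - g" "g - h"] diff_mem by simp

lemma family: "seminorm_family X I n"
  unfolding seminorm_family_def by (simp add: nonempty n_zero triangle_diff mono diff_mem)

abbreviation "T \<equiv> sn_top X I n"

lemmas openin_T = openin_sn_top[OF family]
lemmas topspace_T = topspace_sn_top[OF family]

lemma zero_nhd_iff: "zero_nhd T W \<longleftrightarrow> W \<subseteq> X \<and> (\<exists>i\<in>I. \<exists>\<epsilon>>0. \<forall>f\<in>X. n i f < \<epsilon> \<longrightarrow> f \<in> W)"
proof
  assume "zero_nhd T W"
  then obtain G where G: "sn_open X I n G" "0 \<in> G" "G \<subseteq> W" "W \<subseteq> X"
    by (auto simp: zero_nhd_def openin_T topspace_T)
  then obtain i \<epsilon> where "i \<in> I" "\<epsilon> > 0" "\<forall>y\<in>X. n i (y - 0) < \<epsilon> \<longrightarrow> y \<in> G"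
    unfolding sn_open_def by blast
  then show "W \<subseteq> X \<and> (\<exists>i\<in>I. \<exists>\<epsilon>>0. \<forall>f\<in>X. n i f < \<epsilon> \<longrightarrow> f \<in> W)"
    using G by (metis diff_zero subsetD)
next
  assume "W \<subseteq> X \<and> (\<exists>i\<in>I. \<exists>\<epsilon>>0. \<forall>f\<in>X. n i f < \<epsilon> \<longrightarrow> f \<in> W)"
  then obtain i \<epsilon> where i: "W \<subseteq> X" "i \<in> I" "\<epsilon> > 0" "\<forall>f\<in>X. n i f < \<epsilon> \<longrightarrow> f \<in> W" by blast
  have "sn_open X I n {f \<in> X. n i (f - 0) < \<epsilon>}" by (rule sn_open_ball[OF family zero_mem i(2)])
  then show "zero_nhd T W"
    using i zero_mem n_zero[OF i(2)] unfolding zero_nhd_def openin_T topspace_T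
    by (intro conjI exI[of _ "{f \<in> X. n i (f - 0) < \<epsilon>}"]) auto
qed

lemma tvs: "tvs T"
  unfolding tvs_def topspace_T
proof (intro conjI subspace)
  show "continuous_map (prod_topology T T) T (\<lambda>(f, g). f + g)"
    unfolding continuous_map_def
  proof (intro conjI allI impI)
    show "(\<lambda>(f, g). f + g) \<in> topspace (prod_topology T T) \<rightarrow> topspace T"
      by (auto simp: topspace_T add_mem)
    fix G assume "openin T G"
    then have G: "sn_open X I n G" by (simp add: openin_T)
    show "openin (prod_topology T T) {x \<in> topspace (prod_topology T T). (case x of (f, g) \<Rightarrow> f + g) \<in> G}"
      unfolding openin_prod_topology_alt
    proof (intro allI impI)
      fix f g assume "(f, g) \<in> {x \<in> topspace (prod_topology T T). (case x of (f, g) \<Rightarrow> f + g) \<in> G}"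
      then have fg: "f \<in> X" "g \<in> X" "f + g \<in> G" by (auto simp: topspace_T)
      then obtain i \<epsilon> where i: "i \<in> I" "\<epsilon> > 0" "\<forall>y\<in>X. n i (y - (f + g)) < \<epsilon> \<longrightarrow> y \<in> G"
        using G unfolding sn_open_def by blast
      define B where "B = (\<lambda>f. {y \<in> X. n i (y - f) < \<epsilon> / 2})"
      have "u + v \<in> G" if "u \<in> B f" "v \<in> B g" for u v
      proof -
        have uv: "u \<in> X" "v \<in> X" "n i (u - f) < \<epsilon> / 2" "n i (v - g) < \<epsilon> / 2"
          using that by (auto simp: B_def)
        have "n i ((u + v) - (f + g)) \<le> n i (u - f) + n i (v - g)"
          using triangle[OF i(1) diff_mem[of u f] diff_mem[of v g]] uv fg by (simp add: add_diff_add)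
        then show ?thesis using uv i add_mem by auto
      qed
      moreover have "openin T (B f)" "openin T (B g)"
        unfolding openin_T B_def using sn_open_ball[OF family _ i(1), of _ "\<epsilon> / 2"] fg by auto
      moreover have "f \<in> B f" "g \<in> B g" using fg i n_zero by (auto simp: B_def)
      moreover have "B f \<subseteq> X" "B g \<subseteq> X" by (auto simp: B_def)
      ultimately show "\<exists>U V. openin T U \<and> openin T V \<and> f \<in> U \<and> g \<in> V \<and>
          U \<times> V \<subseteq> {x \<in> topspace (prod_topology T T). (case x of (f, g) \<Rightarrow> f + g) \<in> G}"
        by (intro exI[of _ "B f"] exI[of _ "B g"]) (auto simp: topspace_T)
    qed
  qed
  show "continuous_map (prod_topology euclidean T) T (\<lambda>(c, f). cscale c f)"
    unfolding continuous_map_def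
  proof (intro conjI allI impI)
    show "(\<lambda>(c, f). cscale c f) \<in> topspace (prod_topology euclidean T) \<rightarrow> topspace T"
      by (auto simp: topspace_T scale_mem)
    fix G assume "openin T G"
    then have G: "sn_open X I n G" by (simp add: openin_T)
    show "openin (prod_topology euclidean T)
      {x \<in> topspace (prod_topology euclidean T). (case x of (c, f) \<Rightarrow> cscale c f) \<in> G}"
      unfolding openin_prod_topology_alt
    proof (intro allI impI)
      fix c f assume "(c, f) \<in> {x \<in> topspace (prod_topology euclidean T). (case x of (c, f) \<Rightarrow> cscale c f) \<in> G}"
      then have f: "f \<in> X" "cscale c f \<in> G" by (auto simp: topspace_T)
      then obtain i \<epsilon> where i: "i \<in> I" "\<epsilon> > 0" "\<forall>y\<in>X. n i (y - cscale c f) < \<epsilon> \<longrightarrow> y \<in> G"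
        using G unfolding sn_open_def by blast
      have nf: "0 \<le> n i f" using n_nonneg i f by blast
      \<comment> \<open>Chosen for a u - c f = a (u - f) + (a - c) f: the bound 1 gives |a| \<le>
        |c| + 1, and each summand is then at most \<epsilon> / 2. The added 1 keeps either
        denominator positive.\<close>
      define \<delta> where "\<delta> = min 1 (\<epsilon> / (2 * (n i f + 1)))"
      define \<eta> where "\<eta> = \<epsilon> / (2 * (cmod c + 1))"
      have pos: "\<delta> > 0" "\<eta> > 0" using i nf by (auto simp: \<delta>_def \<eta>_def intro!: divide_pos_pos add_nonneg_pos)
      define B where "B = {y \<in> X. n i (y - f) < \<eta>}"
      have "cscale a u \<in> G" if "a \<in> ball c \<delta>" "u \<in> B" for a u
      proof -
        have u: "u \<in> X" "n i (u - f) < \<eta>" using that by (auto simp: B_def)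
        have a: "cmod (a - c) < \<delta>" using that by (simp add: dist_norm norm_minus_commute)
        have "cmod a \<le> cmod c + cmod (a - c)" using norm_triangle_ineq[of c "a - c"] by simp
        also have "cmod (a - c) \<le> 1" using a by (simp add: \<delta>_def)
        finally have a1: "cmod a \<le> cmod c + 1" by simp
        have "cscale a u - cscale c f = cscale a (u - f) + cscale (a - c) f"
          by (auto simp: cscale_def fun_eq_iff algebra_simps)
        then have "n i (cscale a u - cscale c f) \<le> cmod a * n i (u - f) + cmod (a - c) * n i f"
          using triangle[OF i(1) scale_mem[of "u - f" a] scale_mem[OF f(1), of "a - c"]] scale[OF i(1)] u f diff_mem
          by simp
        also have "\<dots> < \<epsilon> / 2 + \<epsilon> / 2"
        proof (rule add_less_le_mono)
          have "cmod a * n i (u - f) \<le> (cmod c + 1) * n i (u - f)"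
            using a1 n_nonneg[OF i(1) diff_mem[OF u(1) f(1)]] by (rule mult_right_mono)
          also have "\<dots> < (cmod c + 1) * \<eta>"
            using u(2) by (intro mult_strict_left_mono) (auto intro: add_nonneg_pos)
          also have "\<dots> = \<epsilon> / 2"
            using add_nonneg_pos[OF norm_ge_zero[of c] zero_less_one] by (simp add: \<eta>_def field_simps)
          finally show "cmod a * n i (u - f) < \<epsilon> / 2" .
          have "cmod (a - c) * n i f \<le> (\<epsilon> / (2 * (n i f + 1))) * (n i f + 1)"
            using a nf i by (intro mult_mono) (auto simp: \<delta>_def)
          also have "\<dots> = \<epsilon> / 2" using nf by (simp add: field_simps)
          finally show "cmod (a - c) * n i f \<le> \<epsilon> / 2" .
        qed
        finally show ?thesis using i u scale_mem by auto
      qed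
      moreover have "openin T B"
        unfolding openin_T B_def by (rule sn_open_ball[OF family f(1) i(1)])
      moreover have "f \<in> B" using f i n_zero pos by (auto simp: B_def)
      moreover have "B \<subseteq> X" by (auto simp: B_def)
      ultimately show "\<exists>U V. openin euclidean U \<and> openin T V \<and> c \<in> U \<and> f \<in> V \<and>
          U \<times> V \<subseteq> {x \<in> topspace (prod_topology euclidean T). (case x of (c, f) \<Rightarrow> cscale c f) \<in> G}"
        using pos by (intro exI[of _ "ball c \<delta>"] exI[of _ B]) (auto simp: topspace_T)
    qed
  qed
qed

lemma locally_convex: "locally_convex T"
  unfolding locally_convex_def
proof (intro conjI allI impI tvs)
  fix W assume W: "zero_nhd T W"
  then obtain i \<epsilon> where i: "i \<in> I" "\<epsilon> > 0" "\<forall>f\<in>X. n i f < \<epsilon> \<longrightarrow> f \<in> W" by (auto simp: zero_nhd_iff)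
  let ?V = "{f \<in> X. n i f < \<epsilon>}"
  have "absolutely_convex ?V"
    unfolding absolutely_convex_def
  proof (intro ballI allI impI)
    fix f g a b assume f: "f \<in> ?V" and g: "g \<in> ?V" and ab: "cmod a + cmod b \<le> 1"
    have "n i (cscale a f + cscale b g) \<le> cmod a * n i f + cmod b * n i g"
      using triangle[OF i(1) scale_mem scale_mem, of f g a b] f g scale[OF i(1)] by simp
    also have "\<dots> \<le> (cmod a + cmod b) * max (n i f) (n i g)"
      by (simp add: distrib_right add_mono mult_left_mono)
    also have "\<dots> \<le> max (n i f) (n i g)"
      using ab n_nonneg[OF i(1), of f] f by (intro mult_left_le_one_le) auto
    finally show "cscale a f + cscale b g \<in> ?V" using f g add_mem scale_mem by auto
  qed
  moreover have "zero_nhd T ?V" using i by (auto simp: zero_nhd_iff)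
  ultimately show "\<exists>V. zero_nhd T V \<and> absolutely_convex V \<and> V \<subseteq> W" using i by blast
qed

lemma limitin_T:
  assumes "l \<in> X" "range \<sigma> \<subseteq> X" "\<And>i. i \<in> I \<Longrightarrow> (\<lambda>k. n i (\<sigma> k - l)) \<longlonglongrightarrow> 0"
  shows "limitin T \<sigma> l sequentially"
  unfolding limitin_def topspace_T openin_T
proof (intro conjI allI impI assms(1))
  fix G assume "sn_open X I n G \<and> l \<in> G"
  then obtain i \<epsilon> where i: "i \<in> I" "\<epsilon> > 0" "\<forall>f\<in>X. n i (f - l) < \<epsilon> \<longrightarrow> f \<in> G" by (auto simp: sn_open_def)
  have "\<forall>\<^sub>F k in sequentially. n i (\<sigma> k - l) < \<epsilon>" by (rule order_tendstoD(2)[OF assms(3)[OF i(1)] i(2)])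
  then show "\<forall>\<^sub>F k in sequentially. \<sigma> k \<in> G"
    by (rule eventually_mono) (use i(3) assms(2) in blast)
qed

text \<open>The unit ball of p contains a ball of one seminorm \<open>n i\<close>; homogeneity turns
  this inclusion into an inequality.\<close>

lemma continuous_seminorm_le:
  assumes p: "continuous_seminorm T p"
  obtains i C where "i \<in> I" "C > 0" "\<And>f. f \<in> X \<Longrightarrow> p f \<le> C * n i f"
proof -
  have ps: "p (cscale c f) = cmod c * p f" if "f \<in> X" for c f
    using p that by (auto simp: continuous_seminorm_def topspace_T)
  have "p (cscale 0 0) = 0" using ps[OF zero_mem, of 0] by simp
  then have p0: "p 0 = 0" by (simp add: cscale_def zero_fun_def)
  have "openin T {f \<in> topspace T. p f \<in> {..<1}}"
    using p by (intro openin_continuous_map_preimage[of T euclideanreal]) (auto simp: continuous_seminorm_def)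
  then have "zero_nhd T {f \<in> X. p f < 1}"
    using p0 zero_mem unfolding zero_nhd_def topspace_T by (intro conjI exI[of _ "{f \<in> X. p f < 1}"]) auto
  then obtain i \<delta> where i: "i \<in> I" "\<delta> > 0" "\<forall>f\<in>X. n i f < \<delta> \<longrightarrow> p f < 1"
    by (auto simp: zero_nhd_iff)
  have "p f \<le> 2 / \<delta> * n i f" if f: "f \<in> X" for f
  proof (rule field_le_epsilon)
    fix e :: real assume e: "e > 0"
    \<comment> \<open>Rescaling f by its own seminorm breaks down when \<open>n i f = 0\<close>; the
      shift \<open>\<eta>\<close> repairs this and costs exactly e in the end.\<close>
    define \<eta> where "\<eta> = e * \<delta> / 2"
    define t where "t = \<delta> / (2 * (n i f + \<eta>))"
    have nf: "0 \<le> n i f" using n_nonneg i f by blast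
    have \<eta>: "\<eta> > 0" using e i by (simp add: \<eta>_def)
    have t: "t > 0" using nf \<eta> i by (simp add: t_def)
    have "n i (cscale (of_real t) f) = t * n i f" using scale[OF i(1) f] t by simp
    also have "\<dots> \<le> t * (n i f + \<eta>)" using t \<eta> by simp
    also have "\<dots> = \<delta> / 2" using nf \<eta> by (simp add: t_def field_simps)
    also have "\<dots> < \<delta>" using i by simp
    finally have "p (cscale (of_real t) f) < 1" using i scale_mem[OF f] by blast
    then have "t * p f < 1" using ps[OF f] t by simp
    then have "p f < 1 / t" using t by (simp add: field_simps)
    also have "1 / t = 2 / \<delta> * n i f + e" using nf \<eta> i by (simp add: t_def \<eta>_def field_simps)
    finally show "p f \<le> 2 / \<delta> * n i f + e" by simp
  qed
  then show ?thesis using that[of i "2 / \<delta>"] i by simp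
qed

end

section \<open>Metrizability of increasing families of norms\<close>

locale sn_chain = sn_space X "{0<..}" n for X :: "('x \<Rightarrow> complex) set" and n +
  assumes separating: "\<And>h f. h > 0 \<Longrightarrow> f \<in> X \<Longrightarrow> n h f = 0 \<Longrightarrow> f = 0"
begin

text \<open>
  As for the Ky Fan and Prokhorov metrics, letting the parameter \<open>1 / \<epsilon>\<close> grow as the bound \<open>\<epsilon>\<close>
  shrinks makes this length subadditive, by monotonicity of \<open>n\<close>.
\<close>

definition gauge_len :: "('x \<Rightarrow> complex) \<Rightarrow> real" where
  "gauge_len u = Inf {\<epsilon>. \<epsilon> > 0 \<and> n (1 / \<epsilon>) u \<le> \<epsilon>}"

lemma gauge_len_le: "\<epsilon> > 0 \<Longrightarrow> n (1 / \<epsilon>) u \<le> \<epsilon> \<Longrightarrow> gauge_len u \<le> \<epsilon>"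
  unfolding gauge_len_def by (intro cInf_lower) (auto intro!: bdd_belowI[of _ 0])

lemma gauge_len_set_nonempty: "u \<in> X \<Longrightarrow> {\<epsilon>. \<epsilon> > 0 \<and> n (1 / \<epsilon>) u \<le> \<epsilon>} \<noteq> {}"
proof -
  assume u: "u \<in> X"
  \<comment> \<open>For \<epsilon> \<ge> 1 the parameter 1 / \<epsilon> is at most 1, so the
    seminorm is at most \<open>n 1 u\<close>; hence this \<epsilon> is admissible.\<close>
  have "n (1 / max 1 (n 1 u)) u \<le> n 1 u" by (rule mono) (use u in auto)
  then have "max 1 (n 1 u) \<in> {\<epsilon>. \<epsilon> > 0 \<and> n (1 / \<epsilon>) u \<le> \<epsilon>}" by (simp add: le_max_iff_disj)
  then show ?thesis by blast
qed

lemma gauge_len_less: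
  assumes u: "u \<in> X" and "gauge_len u < \<epsilon>"
  shows "\<epsilon> > 0 \<and> n (1 / \<epsilon>) u < \<epsilon>"
proof -
  obtain a where a: "a > 0" "n (1 / a) u \<le> a" "a < \<epsilon>"
    using cInf_lessD[OF gauge_len_set_nonempty[OF u], of \<epsilon>] assms(2) unfolding gauge_len_def by auto
  have "n (1 / \<epsilon>) u \<le> n (1 / a) u" using a u by (intro mono) (auto simp: frac_le)
  then show ?thesis using a by linarith
qed

lemma gauge_len_nonneg: "u \<in> X \<Longrightarrow> 0 \<le> gauge_len u"
  unfolding gauge_len_def by (intro cInf_greatest gauge_len_set_nonempty) auto

lemma gauge_len_add:
  assumes u: "u \<in> X" and v: "v \<in> X"
  shows "gauge_len (u + v) \<le> gauge_len u + gauge_len v"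
proof (rule field_le_epsilon)
  fix e :: real assume e: "e > 0"
  define a where "a = gauge_len u + e / 2"
  define b where "b = gauge_len v + e / 2"
  have a: "a > 0" "n (1 / a) u < a" using gauge_len_less[OF u, of a] e by (auto simp: a_def)
  have b: "b > 0" "n (1 / b) v < b" using gauge_len_less[OF v, of b] e by (auto simp: b_def)
  have "n (1 / (a + b)) (u + v) \<le> n (1 / (a + b)) u + n (1 / (a + b)) v"
    using a b u v by (intro triangle) auto
  also have "\<dots> \<le> n (1 / a) u + n (1 / b) v"
    using a b u v by (intro add_mono mono) (auto simp: frac_le)
  also have "\<dots> \<le> a + b" using a b by simp
  finally have "gauge_len (u + v) \<le> a + b" using a b by (intro gauge_len_le) auto
  then show "gauge_len (u + v) \<le> gauge_len u + gauge_len v + e" by (simp add: a_def b_def)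
qed

lemma gauge_len_eq_0: "u \<in> X \<Longrightarrow> gauge_len u = 0 \<longleftrightarrow> u = 0"
proof
  assume u: "u \<in> X" and 0: "gauge_len u = 0"
  have "n 1 u \<le> 0"
  proof (rule field_le_epsilon)
    fix e :: real assume e: "e > 0"
    \<comment> \<open>r \<le> 1 gives 1 / r \<ge> 1, so that \<open>n (1 / r)\<close> dominates
      \<open>n 1\<close>.\<close>
    define r where "r = min e 1"
    have r: "r > 0" "n (1 / r) u < r" using gauge_len_less[OF u, of r] e 0 by (auto simp: r_def)
    have "n 1 u \<le> n (1 / r) u" using u r by (intro mono) (auto simp: r_def)
    then show "n 1 u \<le> 0 + e" using r by (simp add: r_def)
  qed
  then show "u = 0" using separating[of 1 u] n_nonneg[of 1 u] u by simp
next
  assume u: "u \<in> X" and "u = 0"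
  then have "gauge_len u \<le> 0 + e" if "e > 0" for e
    using that n_zero by (auto intro!: gauge_len_le)
  then have "gauge_len u \<le> 0" by (rule field_le_epsilon)
  then show "gauge_len u = 0" using gauge_len_nonneg[OF u] by simp
qed

lemma metrizable: "metrizable_space T"
proof -
  \<comment> \<open>\<open>Metric_space\<close> asks for nonnegativity and symmetry at all
    arguments, hence the value 0 off \<open>X\<close>.\<close>
  define d where "d = (\<lambda>f g. if f \<in> X \<and> g \<in> X then gauge_len (f - g) else 0)"
  interpret M: Metric_space X d
  proof
    fix f g
    show "0 \<le> d f g" using gauge_len_nonneg diff_mem by (simp add: d_def)
    have "gauge_len (f - g) = gauge_len (g - f)" if "f \<in> X" "g \<in> X"
      unfolding gauge_len_def using n_diff_commute[OF _ that]
      by (intro arg_cong[of _ _ Inf] Collect_cong) auto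
    then show "d f g = d g f" by (auto simp: d_def)
    show "(d f g = 0) = (f = g)" if "f \<in> X" "g \<in> X"
      using gauge_len_eq_0[OF diff_mem[OF that]] that by (simp add: d_def)
    fix h show "d f h \<le> d f g + d g h" if "f \<in> X" "g \<in> X" "h \<in> X"
      using gauge_len_add[OF diff_mem diff_mem, of f g g h] that by (simp add: d_def)
  qed
  have "openin M.mtopology G \<longleftrightarrow> openin T G" for G
    unfolding M.openin_mtopology openin_T sn_open_def
  proof (intro conj_cong refl ball_cong iffI, unfold Ball_def, safe)
    fix x assume G: "G \<subseteq> X" and x: "x \<in> G"
    { assume "\<forall>x. x \<in> G \<longrightarrow> (\<exists>r>0. M.mball x r \<subseteq> G)"
      then obtain r where r: "r > 0" "M.mball x r \<subseteq> G" using x by blast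
      have "y \<in> G" if y: "y \<in> X" "n (2 / r) (y - x) < r / 2" for y
      proof -
        have xX: "x \<in> X" using G x by blast
        have "gauge_len (x - y) \<le> r / 2"
          using y r n_diff_commute[of "2 / r" x y] xX by (intro gauge_len_le) auto
        then have "d x y < r" using y xX r by (simp add: d_def)
        then have "y \<in> M.mball x r" using y xX by (simp add: M.in_mball)
        then show ?thesis using r by blast
      qed
      \<comment> \<open>With \<epsilon> = r / 2 the definition of \<open>gauge_len\<close>
        prescribes the parameter 2 / r; halving r makes the final inequality strict.\<close>
      then show "\<exists>i\<in>{0<..}. \<exists>\<epsilon>>0. \<forall>xa. xa \<in> X \<longrightarrow> n i (xa - x) < \<epsilon> \<longrightarrow> xa \<in> G"
        using r by (intro bexI[of _ "2 / r"] exI[of _ "r / 2"]) auto }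
    { assume "\<forall>x. x \<in> G \<longrightarrow> (\<exists>i\<in>{0<..}. \<exists>\<epsilon>>0. \<forall>xa. xa \<in> X \<longrightarrow> n i (xa - x) < \<epsilon> \<longrightarrow> xa \<in> G)"
      then obtain h \<epsilon> where h: "h > 0" "\<epsilon> > 0" "\<And>y. y \<in> X \<Longrightarrow> n h (y - x) < \<epsilon> \<Longrightarrow> y \<in> G"
        using x by (metis greaterThan_iff)
      \<comment> \<open>A gauge length below r bounds \<open>n (1 / r)\<close> by r; the two entries
        of the minimum give r \<le> \<epsilon> and h \<le> 1 / r.\<close>
      define r where "r = min \<epsilon> (1 / h)"
      have r: "r > 0" using h by (simp add: r_def)
      have "y \<in> G" if "y \<in> M.mball x r" for y
      proof -
        have y: "y \<in> X" "x \<in> X" "gauge_len (x - y) < r" using that unfolding M.in_mball by (auto simp: d_def)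
        have xy: "x - y \<in> X" using y diff_mem by blast
        have "n (1 / r) (x - y) < r" using gauge_len_less[OF xy y(3)] by blast
        moreover have "h \<le> 1 / r" using h r by (simp add: r_def field_simps min_def split: if_splits)
        then have "n h (x - y) \<le> n (1 / r) (x - y)" using h r xy by (intro mono) auto
        ultimately have "n h (y - x) < \<epsilon>" using n_diff_commute[of h x y] h y by (simp add: r_def)
        then show ?thesis using h y by blast
      qed
      then show "\<exists>r>0. M.mball x r \<subseteq> G" using r by blast }
  qed
  then have "T = M.mtopology" by (simp add: topology_eq)
  then show ?thesis using M.metrizable_space_mtopology by simp
qed

end

section \<open>The norms\<close>

text \<open>The set where the bound fails is open and of measure zero, hence empty. This turns
  essential suprema of continuous functions into pointwise bounds.\<close>

lemma AE_lebesgue_on_open_continuous: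
  fixes g :: "'a::euclidean_space \<Rightarrow> complex"
  assumes "open U" "continuous_on U g" "AE x in lebesgue_on U. cmod (g x) \<le> c" "x \<in> U"
  shows "cmod (g x) \<le> c"
proof (rule ccontr)
  assume *: "\<not> cmod (g x) \<le> c"
  have "open (U \<inter> (\<lambda>x. cmod (g x)) -` {c<..})"
    by (intro continuous_open_preimage continuous_on_norm assms open_greaterThan)
  moreover have "AE x in lebesgue. x \<notin> U \<inter> (\<lambda>x. cmod (g x)) -` {c<..}"
    using assms(1,3) by (subst (asm) AE_restrict_space_iff) (auto simp: not_less)
  then have "negligible (U \<inter> (\<lambda>x. cmod (g x)) -` {c<..})"
    unfolding negligible_iff_null_sets
    using calculation AE_iff_null_sets[of "U \<inter> (\<lambda>x. cmod (g x)) -` {c<..}" lebesgue] by simp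
  ultimately have "U \<inter> (\<lambda>x. cmod (g x)) -` {c<..} = {}"
    using open_not_negligible by blast
  then show False using * assms(4) by auto
qed

lemma nn_integral_lebesgue_on_eq_lborel:
  assumes "open U" "\<And>x. x \<notin> U \<Longrightarrow> f x = 0"
  shows "(\<integral>\<^sup>+x. f x \<partial>lebesgue_on U) = (\<integral>\<^sup>+x. f x \<partial>lborel)"
proof -
  have "(\<integral>\<^sup>+x. f x \<partial>lebesgue_on U) = (\<integral>\<^sup>+x. f x * indicator U x \<partial>lebesgue)"
    using assms(1) by (subst nn_integral_restrict_space) auto
  also have "\<dots> = (\<integral>\<^sup>+x. f x \<partial>lebesgue)"
    using assms(2) by (intro nn_integral_cong) (auto simp: indicator_def)
  finally show ?thesis by (simp add: nn_integral_completion)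
qed

lemma borel_measurable_lebesgue_on_continuous:
  fixes g :: "'a::euclidean_space \<Rightarrow> complex"
  assumes "open U" "continuous_on U g"
  shows "g \<in> borel_measurable (lebesgue_on U)"
  using assms by (intro continuous_imp_measurable_on_sets_lebesgue) auto

text \<open>Covers norms of the form sup_j |A_j f|, entered as an upper bound and as the least one.
  \<open>Y\<close> is the larger space on which the A_j are linear, and \<open>X\<close> consists of
  its members with finite supremum.\<close>

lemma sn_space_SupI:
  fixes A :: "'j \<Rightarrow> ('x \<Rightarrow> complex) \<Rightarrow> complex"
  assumes Y: "cfun.subspace Y"
    and add: "\<And>j f g. j \<in> J \<Longrightarrow> f \<in> Y \<Longrightarrow> g \<in> Y \<Longrightarrow> A j (f + g) = A j f + A j g"
    and scale: "\<And>j c f. j \<in> J \<Longrightarrow> f \<in> Y \<Longrightarrow> A j (cscale c f) = c * A j f"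
    and X: "\<And>f. f \<in> X \<longleftrightarrow> f \<in> Y \<and> (\<exists>c\<ge>0. \<forall>j\<in>J. cmod (A j f) \<le> c)"
    and up: "\<And>f j. f \<in> X \<Longrightarrow> j \<in> J \<Longrightarrow> cmod (A j f) \<le> n i f"
    and nonneg: "\<And>f. f \<in> X \<Longrightarrow> 0 \<le> n i f"
    and least: "\<And>f c. f \<in> X \<Longrightarrow> c \<ge> 0 \<Longrightarrow> (\<And>j. j \<in> J \<Longrightarrow> cmod (A j f) \<le> c) \<Longrightarrow> n i f \<le> c"
  shows "sn_space X {i} n"
proof
  have XY: "f \<in> Y" if "f \<in> X" for f using X that by blast
  have bnd_add: "cmod (A j (f + g)) \<le> n i f + n i g" if "f \<in> X" "g \<in> X" "j \<in> J" for f g j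
  proof -
    have "cmod (A j (f + g)) \<le> cmod (A j f) + cmod (A j g)"
      using add[OF that(3) XY XY, OF that(1,2)] by (simp add: norm_triangle_ineq)
    also have "\<dots> \<le> n i f + n i g" using up that by (intro add_mono) auto
    finally show ?thesis .
  qed
  have bnd_scale: "cmod (A j (cscale c f)) \<le> cmod c * n i f" if "f \<in> X" "j \<in> J" for c f j
    using scale[OF that(2) XY[OF that(1)]] up[OF that] by (simp add: norm_mult mult_left_mono)
  have X_add: "f + g \<in> X" if "f \<in> X" "g \<in> X" for f g
    unfolding X using bnd_add[OF that] nonneg[OF that(1)] nonneg[OF that(2)] cfun.subspace_add[OF Y XY XY, OF that]
    by (intro conjI exI[of _ "n i f + n i g"]) auto
  have X_scale: "cscale c f \<in> X" if "f \<in> X" for c f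
    unfolding X using bnd_scale[OF that] nonneg[OF that] cfun.subspace_scale[OF Y XY, OF that]
    by (intro conjI exI[of _ "cmod c * n i f"]) auto
  have X_0: "0 \<in> X"
    unfolding X
  proof (intro conjI exI[of _ 0] ballI)
    show "0 \<in> Y" by (rule cfun.subspace_0[OF Y])
    then show "cmod (A j 0) \<le> 0" if "j \<in> J" for j
      using scale[OF that, of 0 0] by (simp add: cscale_def zero_fun_def)
  qed simp
  show "cfun.subspace X" using X_0 X_add X_scale by (rule cfun.subspaceI)
  show "{i} \<noteq> {}" by simp
  have scale_le: "n i (cscale c f) \<le> cmod c * n i f" if "f \<in> X" for c f
    by (rule least) (use X_scale that nonneg[OF that] bnd_scale in auto)
  {
    fix k f g assume "k \<in> {i}" "f \<in> X" "g \<in> X"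
    then show "n k (f + g) \<le> n k f + n k g"
      using nonneg bnd_add X_add by (auto intro!: least)
  next
    fix k c f assume k: "k \<in> {i}" and f: "f \<in> X"
    have "n i (cscale c f) = cmod c * n i f"
    proof (cases "c = 0")
      case True
      then show ?thesis using scale_le[OF f, of 0] nonneg[OF X_scale[OF f, of 0]] by simp
    next
      case False
      \<comment> \<open>Applying \<open>scale_le\<close> to 1 / c and \<open>cscale c f\<close>
        gives the reverse inequality.\<close>
      have "cscale (inverse c) (cscale c f) = f" using False by (simp add: cscale_def fun_eq_iff)
      then have "n i f \<le> inverse (cmod c) * n i (cscale c f)"
        using scale_le[OF X_scale[OF f, of c], of "inverse c"] by (simp add: norm_inverse)
      then have "cmod c * n i f \<le> n i (cscale c f)" using False by (simp add: field_simps)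
      then show ?thesis using scale_le[OF f, of c] by simp
    qed
    then show "n k (cscale c f) = cmod c * n k f" using k by simp
  }
qed auto

text \<open>The norms are \<open>enn2real\<close> of suprema in \<open>ennreal\<close>; knowing
  which real bounds c are valid determines both finiteness and the real value.\<close>

lemma ennreal_sup_char:
  assumes "\<And>c. c \<ge> 0 \<Longrightarrow> E \<le> ennreal c \<longleftrightarrow> P c"
  shows "E < \<infinity> \<longleftrightarrow> (\<exists>c\<ge>0. P c)"
    and "E < \<infinity> \<Longrightarrow> P (enn2real E)"
    and "c \<ge> 0 \<Longrightarrow> P c \<Longrightarrow> enn2real E \<le> c"
proof -
  show 1: "E < \<infinity> \<Longrightarrow> P (enn2real E)"
    using assms[of "enn2real E"] by (simp add: ennreal_enn2real)
  show "E < \<infinity> \<longleftrightarrow> (\<exists>c\<ge>0. P c)"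
  proof
    show "E < \<infinity> \<Longrightarrow> \<exists>c\<ge>0. P c" using 1 by (metis enn2real_nonneg)
    show "\<exists>c\<ge>0. P c \<Longrightarrow> E < \<infinity>" using assms by (metis ennreal_less_top infinity_ennreal_def order_le_less_trans)
  qed
  show "c \<ge> 0 \<Longrightarrow> P c \<Longrightarrow> enn2real E \<le> c"
    using assms[of c] enn2real_leI by blast
qed

lemma D_multi_zero_index [simp]: "D_multi (\<lambda>_. 0) f = f"
proof -
  have "mset (mword (\<lambda>_::'a. 0::nat)) = {#}" by (simp add: multiset_eq_iff count_mword)
  then show ?thesis by (simp add: D_multi_eq_Dw)
qed

lemma mi_fact_pos: "mi_fact \<alpha> > 0"
  unfolding mi_fact_def by (intro prod_pos) auto

section \<open>Weighted derivative norms on a bounded open set\<close>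

locale ultra =
  fixes s :: real and U :: "(real^'d::{finite,linorder}) set"
  assumes s: "s > 1" and open_U: "open U" and bounded_U: "bounded U"
begin

definition wt :: "real \<Rightarrow> ('d \<Rightarrow> nat) \<Rightarrow> real" where
  "wt h \<alpha> = h ^ mi_abs \<alpha> / mi_fact \<alpha> powr s"

text \<open>Weighted point evaluations of derivatives. Both norms are suprema of |A h j f|, over all
  \<alpha> and over x in \<open>U\<close> or in its closure; the proof of nuclearity integrates the
  same functionals over j.\<close>

definition A :: "real \<Rightarrow> ('d \<Rightarrow> nat) \<times> 'd pt \<Rightarrow> ('d pt \<Rightarrow> complex) \<Rightarrow> complex" where
  "A h j f = of_real (wt h (fst j)) * D_multi (fst j) f (snd j)"

text \<open>
  \<open>V h\<close> and \<open>VK h\<close> are the underlying sets of the spaces of type \<open>L\<^sup>\<infinity>\<close> on \<open>U\<close> and of the functions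
  supported in the closure of \<open>U\<close>. In \<open>W\<close> the derivatives are required to vanish on the frontier
  of \<open>U\<close> too, which may have positive measure.
\<close>

definition V :: "real \<Rightarrow> ('d pt \<Rightarrow> complex) set" where
  "V h = {\<phi>. smooth_on U \<phi> \<and> (\<forall>x. x \<notin> U \<longrightarrow> \<phi> x = 0) \<and> DL_enorm s \<infinity> h U \<phi> < \<infinity>}"

definition VK :: "real \<Rightarrow> ('d pt \<Rightarrow> complex) set" where
  "VK h = {\<phi>. smooth_on UNIV \<phi> \<and> supp \<phi> \<subseteq> closure U \<and> DK_enorm s (1 / h) (closure U) \<phi> < \<infinity>}"

definition N :: "real \<Rightarrow> ('d pt \<Rightarrow> complex) \<Rightarrow> real" where
  "N h = DL_norm s \<infinity> h U"

text \<open>Indexed by h = 1 / k, so that these norms increase with the parameter, as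
  \<open>sn_space\<close> demands, and match \<open>N h\<close>.\<close>

definition NK :: "real \<Rightarrow> ('d pt \<Rightarrow> complex) \<Rightarrow> real" where
  "NK h = DK_norm s (1 / h) (closure U)"

definition W :: "('d pt \<Rightarrow> complex) set" where
  "W = {\<phi>. smooth_on UNIV \<phi> \<and> (\<forall>\<alpha> x. x \<notin> U \<longrightarrow> D_multi \<alpha> \<phi> x = 0)}"

abbreviation Dd :: "('d pt \<Rightarrow> complex) set" where
  "Dd \<equiv> D_Beurling s U"

lemma wt_pos: "h > 0 \<Longrightarrow> wt h \<alpha> > 0"
  using mi_fact_pos[of \<alpha>] by (simp add: wt_def)

lemma norm_A: "h > 0 \<Longrightarrow> cmod (A h (\<alpha>, x) f) = wt h \<alpha> * cmod (D_multi \<alpha> f x)"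
  using wt_pos[of h \<alpha>] by (simp add: A_def norm_mult)

lemma A_add: "open S \<Longrightarrow> smooth_on S f \<Longrightarrow> smooth_on S g \<Longrightarrow> x \<in> S \<Longrightarrow> A h (\<alpha>, x) (f + g) = A h (\<alpha>, x) f + A h (\<alpha>, x) g"
  by (simp add: A_def D_multi_eq_Dw Dw_add algebra_simps)

lemma A_diff: "open S \<Longrightarrow> smooth_on S f \<Longrightarrow> smooth_on S g \<Longrightarrow> x \<in> S \<Longrightarrow> A h (\<alpha>, x) (f - g) = A h (\<alpha>, x) f - A h (\<alpha>, x) g"
  by (simp add: A_def D_multi_eq_Dw Dw_diff algebra_simps)

lemma A_scale: "open S \<Longrightarrow> smooth_on S f \<Longrightarrow> x \<in> S \<Longrightarrow> A h (\<alpha>, x) (cscale c f) = c * A h (\<alpha>, x) f"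
  by (simp add: A_def D_multi_eq_Dw Dw_cscale algebra_simps)

lemma esssup_eq_bound:
  assumes "continuous_on U g" "c \<ge> 0"
  shows "esssup (lebesgue_on U) (\<lambda>x. ennreal (cmod (g x))) \<le> ennreal c \<longleftrightarrow> (\<forall>x\<in>U. cmod (g x) \<le> c)"
proof
  assume *: "esssup (lebesgue_on U) (\<lambda>x. ennreal (cmod (g x))) \<le> ennreal c"
  have "AE x in lebesgue_on U. ennreal (cmod (g x)) \<le> ennreal c"
    using esssup_AE[of "\<lambda>x. ennreal (cmod (g x))" "lebesgue_on U"] by eventually_elim (use * in order)
  then have "AE x in lebesgue_on U. cmod (g x) \<le> c"
    by eventually_elim (use assms in simp)
  then show "\<forall>x\<in>U. cmod (g x) \<le> c" using AE_lebesgue_on_open_continuous[OF open_U assms(1)] by blast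
next
  assume *: "\<forall>x\<in>U. cmod (g x) \<le> c"
  show "esssup (lebesgue_on U) (\<lambda>x. ennreal (cmod (g x))) \<le> ennreal c"
  proof (rule esssup_I)
    show "(\<lambda>x. ennreal (cmod (g x))) \<in> borel_measurable (lebesgue_on U)"
      using borel_measurable_lebesgue_on_continuous[OF open_U assms(1)] by measurable
    show "AE x in lebesgue_on U. ennreal (cmod (g x)) \<le> ennreal c"
      using * by (intro AE_I2 ennreal_leI) auto
  qed
qed

lemma DL_enorm_le_iff:
  assumes "h > 0" "smooth_on U \<phi>" "c \<ge> 0"
  shows "DL_enorm s \<infinity> h U \<phi> \<le> ennreal c \<longleftrightarrow> (\<forall>j\<in>UNIV \<times> U. cmod (A h j \<phi>) \<le> c)"
proof -
  have "ennreal (wt h \<alpha>) * Lp_enorm \<infinity> U (D_multi \<alpha> \<phi>) \<le> ennreal c \<longleftrightarrow>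
    (\<forall>x\<in>U. cmod (A h (\<alpha>, x) \<phi>) \<le> c)" for \<alpha>
  proof -
    have w: "wt h \<alpha> > 0" by (rule wt_pos[OF assms(1)])
    have cont: "continuous_on U (D_multi \<alpha> \<phi>)"
      by (simp add: D_multi_eq_Dw smooth_on_Dw assms smooth_on_continuous)
    have "ennreal (wt h \<alpha>) * Lp_enorm \<infinity> U (D_multi \<alpha> \<phi>) \<le> ennreal c \<longleftrightarrow>
        Lp_enorm \<infinity> U (D_multi \<alpha> \<phi>) \<le> ennreal (c / wt h \<alpha>)"
    proof -
      have c: "ennreal c = ennreal (wt h \<alpha>) * ennreal (c / wt h \<alpha>)"
        using w assms(3) by (simp flip: ennreal_mult)
      show ?thesis
        unfolding c using w by (subst ennreal_mult_le_mult_iff) auto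
    qed
    also have "\<dots> \<longleftrightarrow> (\<forall>x\<in>U. cmod (D_multi \<alpha> \<phi> x) \<le> c / wt h \<alpha>)"
      using esssup_eq_bound[OF cont, of "c / wt h \<alpha>"] w assms(3) by (simp add: Lp_enorm_def)
    also have "\<dots> \<longleftrightarrow> (\<forall>x\<in>U. cmod (A h (\<alpha>, x) \<phi>) \<le> c)"
      using w by (simp add: norm_A[OF assms(1)] field_simps)
    finally show ?thesis .
  qed
  then show ?thesis unfolding DL_enorm_def by (simp add: SUP_le_iff wt_def)
qed

lemma DK_enorm_le_iff:
  assumes "h > 0" "c \<ge> 0"
  shows "DK_enorm s (1 / h) K \<phi> \<le> ennreal c \<longleftrightarrow> (\<forall>j\<in>UNIV \<times> K. cmod (A h j \<phi>) \<le> c)"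
proof -
  have "cmod (D_multi \<alpha> \<phi> x) / ((1 / h) ^ mi_abs \<alpha> * mi_fact \<alpha> powr s) = cmod (A h (\<alpha>, x) \<phi>)" for \<alpha> x
    using assms(1) by (simp add: norm_A wt_def field_simps)
  then show ?thesis using assms(2) by (simp add: DK_enorm_def SUP_le_iff)
qed

lemma N_char:
  assumes "h > 0" "smooth_on U f"
  shows "DL_enorm s \<infinity> h U f < \<infinity> \<longleftrightarrow> (\<exists>c\<ge>0. \<forall>j\<in>UNIV \<times> U. cmod (A h j f) \<le> c)"
    and "DL_enorm s \<infinity> h U f < \<infinity> \<Longrightarrow> \<forall>j\<in>UNIV \<times> U. cmod (A h j f) \<le> N h f"
    and "c \<ge> 0 \<Longrightarrow> \<forall>j\<in>UNIV \<times> U. cmod (A h j f) \<le> c \<Longrightarrow> N h f \<le> c"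
proof -
  have *: "0 \<le> c \<Longrightarrow> DL_enorm s \<infinity> h U f \<le> ennreal c \<longleftrightarrow> (\<forall>j\<in>UNIV \<times> U. cmod (A h j f) \<le> c)" for c
    by (rule DL_enorm_le_iff[OF assms])
  note char = ennreal_sup_char[where P = "\<lambda>c. \<forall>j\<in>UNIV \<times> U. cmod (A h j f) \<le> c", OF *]
  show "DL_enorm s \<infinity> h U f < \<infinity> \<longleftrightarrow> (\<exists>c\<ge>0. \<forall>j\<in>UNIV \<times> U. cmod (A h j f) \<le> c)" by (rule char)
  show "DL_enorm s \<infinity> h U f < \<infinity> \<Longrightarrow> \<forall>j\<in>UNIV \<times> U. cmod (A h j f) \<le> N h f"
    unfolding N_def DL_norm_def by (rule char)
  show "c \<ge> 0 \<Longrightarrow> \<forall>j\<in>UNIV \<times> U. cmod (A h j f) \<le> c \<Longrightarrow> N h f \<le> c"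
    unfolding N_def DL_norm_def by (rule char)
qed

lemma NK_char:
  assumes "h > 0"
  shows "DK_enorm s (1 / h) K f < \<infinity> \<longleftrightarrow> (\<exists>c\<ge>0. \<forall>j\<in>UNIV \<times> K. cmod (A h j f) \<le> c)"
    and "DK_enorm s (1 / h) K f < \<infinity> \<Longrightarrow> \<forall>j\<in>UNIV \<times> K. cmod (A h j f) \<le> DK_norm s (1 / h) K f"
    and "c \<ge> 0 \<Longrightarrow> \<forall>j\<in>UNIV \<times> K. cmod (A h j f) \<le> c \<Longrightarrow> DK_norm s (1 / h) K f \<le> c"
proof -
  have *: "0 \<le> c \<Longrightarrow> DK_enorm s (1 / h) K f \<le> ennreal c \<longleftrightarrow> (\<forall>j\<in>UNIV \<times> K. cmod (A h j f) \<le> c)" for c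
    by (rule DK_enorm_le_iff[OF assms])
  note char = ennreal_sup_char[where P = "\<lambda>c. \<forall>j\<in>UNIV \<times> K. cmod (A h j f) \<le> c", OF *]
  show "DK_enorm s (1 / h) K f < \<infinity> \<longleftrightarrow> (\<exists>c\<ge>0. \<forall>j\<in>UNIV \<times> K. cmod (A h j f) \<le> c)" by (rule char)
  show "DK_enorm s (1 / h) K f < \<infinity> \<Longrightarrow> \<forall>j\<in>UNIV \<times> K. cmod (A h j f) \<le> DK_norm s (1 / h) K f"
    unfolding DK_norm_def by (rule char)
  show "c \<ge> 0 \<Longrightarrow> \<forall>j\<in>UNIV \<times> K. cmod (A h j f) \<le> c \<Longrightarrow> DK_norm s (1 / h) K f \<le> c"
    unfolding DK_norm_def by (rule char)
qed

text \<open>The bound over the whole space is the intermediate form through which conditions over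
  \<open>U\<close>, over its closure and over a compact support are exchanged: outside these sets
  the functionals are zero.\<close>

lemma bound_extend:
  assumes "\<And>\<alpha> x. x \<notin> K \<Longrightarrow> A h (\<alpha>, x) f = 0"
  shows "(\<exists>c\<ge>0. \<forall>j\<in>UNIV \<times> K. cmod (A h j f) \<le> c) \<longleftrightarrow> (\<exists>c\<ge>0. \<forall>\<alpha> x. cmod (A h (\<alpha>, x) f) \<le> c)"
proof -
  have "(\<forall>j\<in>UNIV \<times> K. cmod (A h j f) \<le> c) \<longleftrightarrow> (\<forall>\<alpha> x. cmod (A h (\<alpha>, x) f) \<le> c)" if "c \<ge> 0" for c
  proof (intro iffI allI ballI)
    fix \<alpha> x assume "\<forall>j\<in>UNIV \<times> K. cmod (A h j f) \<le> c"
    then show "cmod (A h (\<alpha>, x) f) \<le> c" using assms[of x \<alpha>] that by (cases "x \<in> K") auto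
  qed auto
  then show ?thesis by blast
qed

lemma V_iff:
  assumes "h > 0"
  shows "f \<in> V h \<longleftrightarrow> (smooth_on U f \<and> (\<forall>x. x \<notin> U \<longrightarrow> f x = 0)) \<and> (\<exists>c\<ge>0. \<forall>j\<in>UNIV \<times> U. cmod (A h j f) \<le> c)"
proof (cases "smooth_on U f")
  case True
  show ?thesis unfolding V_def using N_char(1)[OF assms True] by simp
qed (simp add: V_def)

lemma VK_iff:
  assumes "h > 0"
  shows "f \<in> VK h \<longleftrightarrow> (smooth_on UNIV f \<and> (\<forall>x. x \<notin> closure U \<longrightarrow> f x = 0)) \<and>
    (\<exists>c\<ge>0. \<forall>j\<in>UNIV \<times> closure U. cmod (A h j f) \<le> c)"
proof -
  have "supp f \<subseteq> closure U \<longleftrightarrow> {x. f x \<noteq> 0} \<subseteq> closure U"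
    unfolding supp_def using closure_minimal[of "{x. f x \<noteq> 0}" "closure U"] closure_subset[of "{x. f x \<noteq> 0}"]
    by (meson closed_closure subset_trans)
  then have "supp f \<subseteq> closure U \<longleftrightarrow> (\<forall>x. x \<notin> closure U \<longrightarrow> f x = 0)" by blast
  then show ?thesis unfolding VK_def using NK_char(1)[OF assms, of "closure U" f] by simp
qed

lemma N_upper: "h > 0 \<Longrightarrow> f \<in> V h \<Longrightarrow> x \<in> U \<Longrightarrow> cmod (A h (\<alpha>, x) f) \<le> N h f"
  using N_char(2)[of h f] by (auto simp: V_def)

lemma N_nonneg: "0 \<le> N h f" by (simp add: N_def DL_norm_def)

lemma NK_nonneg: "0 \<le> NK h f" by (simp add: NK_def DK_norm_def)

lemma N_least: "h > 0 \<Longrightarrow> f \<in> V h \<Longrightarrow> c \<ge> 0 \<Longrightarrow> (\<And>\<alpha> x. x \<in> U \<Longrightarrow> cmod (A h (\<alpha>, x) f) \<le> c) \<Longrightarrow> N h f \<le> c"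
  using N_char(3)[of h f c] by (auto simp: V_def)

lemma NK_upper: "h > 0 \<Longrightarrow> f \<in> VK h \<Longrightarrow> x \<in> closure U \<Longrightarrow> cmod (A h (\<alpha>, x) f) \<le> NK h f"
  using NK_char(2)[of h "closure U" f] by (auto simp: VK_def NK_def)

lemma sn_space_V:
  assumes "h > 0"
  shows "sn_space (V h) {h} N"
proof (rule sn_space_SupI[where J = "UNIV \<times> U" and A = "A h" and
      Y = "{\<phi>. smooth_on U \<phi> \<and> (\<forall>x. x \<notin> U \<longrightarrow> \<phi> x = 0)}"])
  show "cfun.subspace {\<phi>. smooth_on U \<phi> \<and> (\<forall>x. x \<notin> U \<longrightarrow> \<phi> x = 0)}"
    using open_U by (intro cfun.subspaceI) (auto intro: smooth_on_zero smooth_on_add smooth_on_cscale simp: cscale_def[symmetric], auto simp: cscale_def)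
  show "f \<in> V h \<longleftrightarrow> f \<in> {\<phi>. smooth_on U \<phi> \<and> (\<forall>x. x \<notin> U \<longrightarrow> \<phi> x = 0)} \<and> (\<exists>c\<ge>0. \<forall>j\<in>UNIV \<times> U. cmod (A h j f) \<le> c)" for f
    using V_iff[OF assms] by simp
qed (use assms open_U N_upper N_least N_nonneg in \<open>auto simp: A_add A_scale\<close>)

lemma sn_space_VK:
  assumes "h > 0"
  shows "sn_space (VK h) {h} NK"
proof (rule sn_space_SupI[where J = "UNIV \<times> closure U" and A = "A h" and
      Y = "{\<phi>. smooth_on UNIV \<phi> \<and> (\<forall>x. x \<notin> closure U \<longrightarrow> \<phi> x = 0)}"])
  show "cfun.subspace {\<phi>. smooth_on UNIV \<phi> \<and> (\<forall>x. x \<notin> closure U \<longrightarrow> \<phi> x = 0)}"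
    by (intro cfun.subspaceI) (auto intro: smooth_on_zero smooth_on_add smooth_on_cscale simp: cscale_def[symmetric], auto simp: cscale_def)
  show "f \<in> VK h \<longleftrightarrow> f \<in> {\<phi>. smooth_on UNIV \<phi> \<and> (\<forall>x. x \<notin> closure U \<longrightarrow> \<phi> x = 0)} \<and>
      (\<exists>c\<ge>0. \<forall>j\<in>UNIV \<times> closure U. cmod (A h j f) \<le> c)" for f
    using VK_iff[OF assms] by simp
  show "NK h f \<le> c" if "f \<in> VK h" "c \<ge> 0" "\<And>j. j \<in> UNIV \<times> closure U \<Longrightarrow> cmod (A h j f) \<le> c" for f c
    using NK_char(3)[OF assms, of c "closure U" f] that by (auto simp: NK_def)
  show "0 \<le> NK h f" for f by (rule NK_nonneg)
qed (use assms NK_upper in \<open>auto simp: A_add[OF open_UNIV] A_scale[OF open_UNIV]\<close>)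

lemma DL_eq: "h > 0 \<Longrightarrow> DL s \<infinity> h U = sn_top (V h) {h} N"
  unfolding DL_def V_def[symmetric] N_def[symmetric] by (rule norm_topology_eq_sn_top[OF sn_space.family[OF sn_space_V]])

lemma DK_eq: "h > 0 \<Longrightarrow> DK s (1 / h) (closure U) = sn_top (VK h) {h} NK"
  unfolding DK_def VK_def[symmetric] NK_def[symmetric] by (rule norm_topology_eq_sn_top[OF sn_space.family[OF sn_space_VK]])

lemma W_smooth: "f \<in> W \<Longrightarrow> smooth_on UNIV f"
  and W_outside: "f \<in> W \<Longrightarrow> x \<notin> U \<Longrightarrow> D_multi \<alpha> f x = 0"
  by (auto simp: W_def)

lemma W_vanish: "f \<in> W \<Longrightarrow> x \<notin> U \<Longrightarrow> f x = 0"
  using W_outside[of f x "\<lambda>_. 0"] by simp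

lemma subspace_W: "cfun.subspace W"
proof (rule cfun.subspaceI)
  show "0 \<in> W" by (simp add: W_def smooth_on_zero D_multi_eq_Dw)
  fix f g c assume f: "f \<in> W"
  then show "cscale c f \<in> W" by (simp add: W_def smooth_on_cscale D_multi_eq_Dw Dw_cscale[OF open_UNIV])
  assume g: "g \<in> W"
  show "f + g \<in> W" using f g by (simp add: W_def smooth_on_add D_multi_eq_Dw Dw_add[OF open_UNIV])
qed

lemma W_A_outside: "f \<in> W \<Longrightarrow> x \<notin> U \<Longrightarrow> A h (\<alpha>, x) f = 0"
  by (simp add: A_def W_outside)

lemma W_V_iff: "h > 0 \<Longrightarrow> f \<in> W \<Longrightarrow> f \<in> V h \<longleftrightarrow> (\<exists>c\<ge>0. \<forall>\<alpha> x. cmod (A h (\<alpha>, x) f) \<le> c)"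
  using bound_extend[of U h f] W_A_outside[of f _ h] W_smooth W_vanish smooth_on_subset[of UNIV f U] by (auto simp: V_iff)

lemma W_VK_iff: "h > 0 \<Longrightarrow> f \<in> W \<Longrightarrow> f \<in> VK h \<longleftrightarrow> f \<in> V h"
proof -
  assume h: "h > 0" and f: "f \<in> W"
  have "(\<exists>c\<ge>0. \<forall>j\<in>UNIV \<times> closure U. cmod (A h j f) \<le> c) \<longleftrightarrow> (\<exists>c\<ge>0. \<forall>\<alpha> x. cmod (A h (\<alpha>, x) f) \<le> c)"
    by (rule bound_extend, rule W_A_outside[OF f]) (use closure_subset in blast)
  then show ?thesis
    unfolding W_V_iff[OF h f] VK_iff[OF h] using W_smooth[OF f] W_vanish[OF f] closure_subset[of U] by blast
qed

lemma W_N_upper: "h > 0 \<Longrightarrow> f \<in> W \<Longrightarrow> f \<in> V h \<Longrightarrow> cmod (A h (\<alpha>, x) f) \<le> N h f"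
  by (cases "x \<in> U") (auto simp: N_upper W_A_outside N_nonneg)

lemma W_NK_eq_N: 
  assumes h: "h > 0" and f: "f \<in> W" "f \<in> V h"
  shows "NK h f = N h f"
proof (rule antisym)
  show "NK h f \<le> N h f"
    unfolding NK_def using NK_char(3)[OF h, where c = "N h f" and K = "closure U" and f = f] N_nonneg W_N_upper[OF h f] by auto
  show "N h f \<le> NK h f"
    using NK_upper[OF h, of f] W_VK_iff[OF h f(1)] f closure_subset[of U] NK_nonneg by (intro N_least[OF h]) auto
qed

lemma V_mono: "0 < h \<Longrightarrow> h \<le> h' \<Longrightarrow> f \<in> V h' \<Longrightarrow> f \<in> V h \<and> N h f \<le> N h' f"
proof -
  assume h: "0 < h" "h \<le> h'" and f: "f \<in> V h'"
  have h': "h' > 0" using h by simp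
  have bnd: "cmod (A h (\<alpha>, x) f) \<le> N h' f" if "x \<in> U" for \<alpha> x
  proof -
    have "wt h \<alpha> \<le> wt h' \<alpha>" unfolding wt_def using h by (intro divide_right_mono power_mono) auto
    then have "cmod (A h (\<alpha>, x) f) \<le> cmod (A h' (\<alpha>, x) f)"
      unfolding norm_A[OF h(1)] norm_A[OF h'] by (rule mult_right_mono) simp
    also have "\<dots> \<le> N h' f" by (rule N_upper[OF h' f that])
    finally show ?thesis .
  qed
  then have "f \<in> V h"
    using f N_nonneg unfolding V_iff[OF h(1)] V_iff[OF h'] by blast
  with bnd show ?thesis using N_least[OF h(1)] N_nonneg by blast
qed

lemma topspace_norm_topology:
  fixes n :: "'v::group_add \<Rightarrow> real"
  shows "n 0 = 0 \<Longrightarrow> topspace (norm_topology X n) = X"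
  unfolding norm_topology_def topology_generated_by_topspace
proof (intro equalityI subsetI)
  fix x assume "n 0 = 0" "x \<in> X"
  then show "x \<in> \<Union>{{y \<in> X. n (y - x) < \<epsilon>} |x \<epsilon>. x \<in> X \<and> 0 < \<epsilon>}"
    by (intro UnionI[of "{y \<in> X. n (y - x) < 1}"]) (auto intro!: exI[of _ x] exI[of _ 1])
qed blast

lemma topspace_DK: "topspace (DK s k K) = {\<phi>. smooth_on UNIV \<phi> \<and> supp \<phi> \<subseteq> K \<and> DK_enorm s k K \<phi> < \<infinity>}"
  unfolding DK_def
  by (rule topspace_norm_topology) (cases "K = {}"; simp add: DK_norm_def DK_enorm_def D_multi_eq_Dw bot_ennreal)

lemma D_multi_outside_supp:
  assumes "closed K" "supp f \<subseteq> K" "x \<notin> K"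
  shows "D_multi \<alpha> f x = 0"
proof -
  have "Dw (mword \<alpha>) f x = Dw (mword \<alpha>) 0 x"
  proof (rule Dw_cong[of "- K"])
    show "f y = 0 y" if "y \<in> - K" for y
      using that assms(2) closure_subset[of "{x. f x \<noteq> 0}"] by (auto simp: supp_def)
  qed (use assms in auto)
  then show ?thesis by (simp add: D_multi_eq_Dw)
qed

text \<open>If f is supported in a compact K inside \<open>U\<close>, all derivatives vanish off K;
  so f is in \<open>W\<close>, and the suprema over K and over \<open>U\<close> are finite together.
  The Beurling condition for all k then reads as membership in every \<open>V h\<close>.\<close>

lemma Dd_iff:
  "f \<in> Dd \<longleftrightarrow> f \<in> W \<and> (\<forall>h>0. f \<in> V h) \<and> (\<exists>K. compact K \<and> K \<subseteq> U \<and> supp f \<subseteq> K)"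
proof -
  have inner: "(\<forall>k>0. f \<in> topspace (DK s k K)) \<longleftrightarrow> f \<in> W \<and> (\<forall>h>0. f \<in> V h) \<and> supp f \<subseteq> K"
    if K: "compact K" "K \<subseteq> U" for K
  proof -
    have "(\<forall>k>0. f \<in> topspace (DK s k K)) \<longleftrightarrow> (\<forall>h>0. f \<in> topspace (DK s (1 / h) K))"
      by (metis divide_divide_eq_right mult_1 div_by_1 zero_less_divide_1_iff)
    also have "\<dots> \<longleftrightarrow> smooth_on UNIV f \<and> supp f \<subseteq> K \<and> (\<forall>h>0. DK_enorm s (1 / h) K f < \<infinity>)"
      unfolding topspace_DK using zero_less_one by blast
    also have "\<dots> \<longleftrightarrow> f \<in> W \<and> (\<forall>h>0. f \<in> V h) \<and> supp f \<subseteq> K"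
    proof -
      {
        assume f: "supp f \<subseteq> K" "smooth_on UNIV f"
        have out: "D_multi \<alpha> f x = 0" if "x \<notin> K" for \<alpha> x
          using D_multi_outside_supp[OF compact_imp_closed[OF K(1)] f(1) that] .
        then have fW: "f \<in> W" using f K by (auto simp: W_def)
        have out': "A h (\<alpha>, x) f = 0" if "x \<notin> K" for h \<alpha> x
          using out[OF that] by (simp add: A_def)
        have "DK_enorm s (1 / h) K f < \<infinity> \<longleftrightarrow> f \<in> V h" if h: "h > 0" for h
        proof -
          have "DK_enorm s (1 / h) K f < \<infinity> \<longleftrightarrow> (\<exists>c\<ge>0. \<forall>\<alpha> x. cmod (A h (\<alpha>, x) f) \<le> c)"
            unfolding NK_char(1)[OF h] by (rule bound_extend[OF out'])
          then show ?thesis by (simp add: W_V_iff[OF h fW])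
        qed
        then have "(\<forall>h>0. DK_enorm s (1 / h) K f < \<infinity>) \<longleftrightarrow> (\<forall>h>0. f \<in> V h)" by blast
        note fW this
      }
      then show ?thesis using W_smooth by blast
    qed
    finally show ?thesis .
  qed
  have "f \<in> Dd \<longleftrightarrow> (\<exists>K. compact K \<and> K \<subseteq> U \<and> (\<forall>k>0. f \<in> topspace (DK s k K)))"
  proof -
    have "topspace (DK_Beurling s K) = (\<Inter>k\<in>{0<..}. topspace (DK s k K))" for K :: "'d pt set"
    proof -
      \<comment> \<open>The intersection, cut with one of its own members, is itself a generator, so
        it is the whole space of the generated topology.\<close>
      have "(1::real) \<in> {0<..}" by simp
      then have "(\<Inter>k\<in>{0<..}. topspace (DK s k K)) \<inter> topspace (DK s 1 K) \<in>
        {(\<Inter>k\<in>{0<..}. topspace (DK s k K)) \<inter> W |k W. k \<in> {0<..} \<and> openin (DK s k K) W}"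
        by blast
      then show ?thesis
        unfolding DK_Beurling_def proj_lim_def topology_generated_by_topspace using \<open>1 \<in> {0<..}\<close> by blast
    qed
    then show ?thesis unfolding D_Beurling_def by auto
  qed
  also have "\<dots> \<longleftrightarrow> f \<in> W \<and> (\<forall>h>0. f \<in> V h) \<and> (\<exists>K. compact K \<and> K \<subseteq> U \<and> supp f \<subseteq> K)"
    using inner by blast
  finally show ?thesis .
qed

lemma Dd_W: "f \<in> Dd \<Longrightarrow> f \<in> W" and Dd_V: "f \<in> Dd \<Longrightarrow> h > 0 \<Longrightarrow> f \<in> V h"
  by (auto simp: Dd_iff)

lemma subspace_Dd: "cfun.subspace Dd"
proof (rule cfun.subspaceI)
  have V0: "0 \<in> V h" and Vs: "f \<in> V h \<Longrightarrow> cscale c f \<in> V h" and Va: "f \<in> V h \<Longrightarrow> g \<in> V h \<Longrightarrow> f + g \<in> V h"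
    if "h > 0" for h f g c
    using sn_space.zero_mem[OF sn_space_V[OF that]] sn_space.scale_mem[OF sn_space_V[OF that]]
      sn_space.add_mem[OF sn_space_V[OF that]] by auto
  show "0 \<in> Dd"
    unfolding Dd_iff using V0 cfun.subspace_0[OF subspace_W] by (auto simp: supp_def intro!: exI[of _ "{}"])
  fix f g c assume f: "f \<in> Dd"
  have sub: "supp (cscale c f) \<subseteq> supp f" unfolding supp_def by (rule closure_mono) (auto simp: cscale_def)
  obtain K where K: "compact K" "K \<subseteq> U" "supp f \<subseteq> K" using f unfolding Dd_iff by blast
  have "supp (cscale c f) \<subseteq> K" using sub K by (rule_tac subset_trans)
  then show "cscale c f \<in> Dd"
    using f K Vs cfun.subspace_scale[OF subspace_W, of f c] unfolding Dd_iff by auto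
  assume g: "g \<in> Dd"
  have "supp (f + g) \<subseteq> supp f \<union> supp g"
    unfolding supp_def closure_Un[symmetric] by (rule closure_mono) auto
  moreover obtain K L where "compact K" "K \<subseteq> U" "supp f \<subseteq> K" "compact L" "L \<subseteq> U" "supp g \<subseteq> L"
    using f g unfolding Dd_iff by blast
  ultimately have "compact (K \<union> L)" "K \<union> L \<subseteq> U" "supp (f + g) \<subseteq> K \<union> L" by auto
  then have "\<exists>K. compact K \<and> K \<subseteq> U \<and> supp (f + g) \<subseteq> K" by blast
  then show "f + g \<in> Dd" using f g Va cfun.subspace_add[OF subspace_W, of f g] unfolding Dd_iff by auto
qed

section \<open>Limits of test functions\<close>

lemma finite_measure_U: "emeasure (lebesgue_on U) (space (lebesgue_on U)) < \<infinity>"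
proof -
  have "U \<in> lmeasurable"
    using bounded_U open_U by (simp add: bounded_set_imp_lmeasurable)
  then have "emeasure lebesgue U < \<infinity>" unfolding fmeasurable_def by blast
  then show ?thesis using open_U by (subst emeasure_restrict_space) auto
qed

text \<open>Functions of \<open>W\<close> vanish with all derivatives off the bounded set
  \<open>U\<close>, so the bound on R^d applies and its integral reduces to
  \<open>U\<close>.\<close>

lemma W_sobolev:
  assumes f: "f \<in> W"
  shows "ennreal (cmod (D_multi \<alpha> f x)) \<le> (\<integral>\<^sup>+y. ennreal (cmod (D_multi (\<lambda>j. Suc (\<alpha> j)) f y)) \<partial>lebesgue_on U)"
proof -
  obtain R where R: "\<And>x. x \<in> U \<Longrightarrow> norm x \<le> R" using bounded_U by (auto simp: bounded_iff)
  have "f x = 0" if "norm x > R" for x using W_vanish[OF f] R that by force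
  from sobolev_L1[OF W_smooth[OF f] this]
  show ?thesis
    by (subst nn_integral_lebesgue_on_eq_lborel[OF open_U]) (auto simp: W_outside[OF f])
qed

text \<open>The Sobolev bound makes the \<psi>_n uniformly Cauchy on R^d in every derivative, so
  they converge to some g in \<open>W\<close>. On \<open>U\<close> they also converge to \<phi> in
  L^1, whence g = \<phi> almost everywhere there, and everywhere by continuity.\<close>

lemma L1_limit_in_W:
  assumes sm: "smooth_on U \<phi>" and van: "\<And>x. x \<notin> U \<Longrightarrow> \<phi> x = 0"
    and \<psi>: "\<And>n. \<psi> n \<in> W"
    and lim: "\<And>\<alpha>. (\<lambda>n. \<integral>\<^sup>+x. ennreal (cmod (D_multi \<alpha> (\<psi> n - \<phi>) x)) \<partial>lebesgue_on U) \<longlonglongrightarrow> 0"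
  shows "\<phi> \<in> W"
proof -
  have smU: "smooth_on U (\<psi> n)" for n using smooth_on_subset[OF W_smooth[OF \<psi>]] by simp
  have meas: "(\<lambda>x. ennreal (cmod (D_multi \<alpha> f x))) \<in> borel_measurable (lebesgue_on U)" if "smooth_on U f" for \<alpha> f
    using borel_measurable_lebesgue_on_continuous[OF open_U smooth_on_continuous[OF smooth_on_Dw[OF that]]]
    unfolding D_multi_eq_Dw by measurable
  have unif: "uniformly_Cauchy_on UNIV (\<lambda>n. D_multi \<alpha> (\<psi> n))" for \<alpha>
  proof (rule uniformly_Cauchy_onI)
    fix e :: real assume e: "e > 0"
    define \<beta> where "\<beta> = (\<lambda>j. Suc (\<alpha> j))"
    define I where "I = (\<lambda>n. \<integral>\<^sup>+x. ennreal (cmod (D_multi \<beta> (\<psi> n - \<phi>) x)) \<partial>lebesgue_on U)"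
    have "\<forall>\<^sub>F n in sequentially. I n < ennreal (e / 2)"
      using order_tendstoD(2)[OF lim[of \<beta>], of "ennreal (e / 2)"] e by (simp add: I_def)
    then obtain M where M: "\<And>n. n \<ge> M \<Longrightarrow> I n < ennreal (e / 2)" by (auto simp: eventually_sequentially)
    have "dist (D_multi \<alpha> (\<psi> m) x) (D_multi \<alpha> (\<psi> n) x) < e" if mn: "m \<ge> M" "n \<ge> M" for m n x
    proof -
      have "ennreal (cmod (D_multi \<alpha> (\<psi> m - \<psi> n) x)) \<le>
          (\<integral>\<^sup>+y. ennreal (cmod (D_multi \<beta> (\<psi> m - \<psi> n) y)) \<partial>lebesgue_on U)"
        unfolding \<beta>_def by (rule W_sobolev[OF cfun.subspace_diff[OF subspace_W \<psi> \<psi>]])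
      also have "\<dots> \<le> (\<integral>\<^sup>+y. ennreal (cmod (D_multi \<beta> (\<psi> m - \<phi>) y)) + ennreal (cmod (D_multi \<beta> (\<psi> n - \<phi>) y)) \<partial>lebesgue_on U)"
      proof (rule nn_integral_mono)
        fix y assume "y \<in> space (lebesgue_on U)"
        then have y: "y \<in> U" by simp
        have "D_multi \<beta> (\<psi> m - \<psi> n) y = D_multi \<beta> (\<psi> m - \<phi>) y - D_multi \<beta> (\<psi> n - \<phi>) y"
          using y by (simp add: D_multi_eq_Dw Dw_diff[OF open_U] smU sm)
        then show "ennreal (cmod (D_multi \<beta> (\<psi> m - \<psi> n) y)) \<le>
            ennreal (cmod (D_multi \<beta> (\<psi> m - \<phi>) y)) + ennreal (cmod (D_multi \<beta> (\<psi> n - \<phi>) y))"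
          by (simp add: norm_triangle_ineq4 ennreal_leI flip: ennreal_plus)
      qed
      also have "\<dots> = I m + I n"
        unfolding I_def by (intro nn_integral_add meas smooth_on_diff open_U smU sm)
      also have "\<dots> < ennreal (e / 2) + ennreal (e / 2)"
        using M mn by (intro add_strict_mono) auto
      also have "\<dots> = ennreal e" using e by (simp flip: ennreal_plus)
      finally have "cmod (D_multi \<alpha> (\<psi> m - \<psi> n) x) < e" using e by (simp add: ennreal_less_iff)
      moreover have "D_multi \<alpha> (\<psi> m - \<psi> n) x = D_multi \<alpha> (\<psi> m) x - D_multi \<alpha> (\<psi> n) x"
        by (simp add: D_multi_eq_Dw Dw_diff[OF open_UNIV] W_smooth[OF \<psi>])
      ultimately show ?thesis by (simp add: dist_norm)
    qed
    then show "\<exists>M. \<forall>x\<in>UNIV. \<forall>m\<ge>M. \<forall>n\<ge>M. dist (D_multi \<alpha> (\<psi> m) x) (D_multi \<alpha> (\<psi> n) x) < e" by blast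
  qed
  obtain g where g: "smooth_on UNIV g"
    and gl: "\<And>\<alpha>. uniform_limit UNIV (\<lambda>n. D_multi \<alpha> (\<psi> n)) (D_multi \<alpha> g) sequentially"
    using smooth_limit[OF W_smooth[OF \<psi>] unif] by blast
  have gW: "g \<in> W"
    unfolding W_def
  proof (intro CollectI conjI g allI impI)
    fix \<alpha> x assume "x \<notin> U"
    then have "(\<lambda>n. D_multi \<alpha> (\<psi> n) x) \<longlonglongrightarrow> 0" by (simp add: W_outside[OF \<psi>])
    moreover have "(\<lambda>n. D_multi \<alpha> (\<psi> n) x) \<longlonglongrightarrow> D_multi \<alpha> g x" using tendsto_uniform_limitI[OF gl] by simp
    ultimately show "D_multi \<alpha> g x = 0" using LIMSEQ_unique by blast
  qed
  have gU: "smooth_on U g" using smooth_on_subset[OF g] by simp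
  have smd: "smooth_on U (g - \<phi>)" by (intro smooth_on_diff open_U gU sm)
  have zero: "(\<integral>\<^sup>+x. ennreal (cmod ((g - \<phi>) x)) \<partial>lebesgue_on U) \<le> 0"
  proof (rule ennreal_le_epsilon)
    fix e :: real assume e: "e > 0"
    define m where "m = measure (lebesgue_on U) (space (lebesgue_on U))"
    have m: "emeasure (lebesgue_on U) (space (lebesgue_on U)) = ennreal m" "m \<ge> 0"
      using finite_measure_U by (auto simp: m_def emeasure_eq_ennreal_measure)
    \<comment> \<open>Makes \<delta> times the measure of \<open>U\<close> at most e / 2; m + 1 in
      place of m allows \<open>U\<close> to be empty.\<close>
    define \<delta> where "\<delta> = e / (2 * (m + 1))"
    have \<delta>: "\<delta> > 0" using e m by (simp add: \<delta>_def)
    have "\<delta> * m \<le> \<delta> * (m + 1)" using \<delta> by simp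
    also have "\<dots> = e / 2" using m by (simp add: \<delta>_def field_simps)
    finally have \<delta>m: "\<delta> * m \<le> e / 2" .
    have "\<forall>\<^sub>F n in sequentially. (\<integral>\<^sup>+x. ennreal (cmod (D_multi (\<lambda>_. 0) (\<psi> n - \<phi>) x)) \<partial>lebesgue_on U) < ennreal (e / 2)"
      by (rule order_tendstoD(2)[OF lim]) (use e in auto)
    moreover have "\<forall>\<^sub>F n in sequentially. \<forall>x\<in>UNIV. dist (D_multi (\<lambda>_. 0) (\<psi> n) x) (D_multi (\<lambda>_. 0) g x) < \<delta>"
      by (rule uniform_limitD[OF gl \<delta>])
    ultimately have "\<forall>\<^sub>F n in sequentially. (\<integral>\<^sup>+x. ennreal (cmod ((g - \<phi>) x)) \<partial>lebesgue_on U) \<le> ennreal e"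
    proof eventually_elim
      case (elim n)
      have "(\<integral>\<^sup>+x. ennreal (cmod ((g - \<phi>) x)) \<partial>lebesgue_on U)
          \<le> (\<integral>\<^sup>+x. ennreal \<delta> + ennreal (cmod (D_multi (\<lambda>_. 0) (\<psi> n - \<phi>) x)) \<partial>lebesgue_on U)"
      proof (rule nn_integral_mono)
        fix x
        have "cmod ((g - \<phi>) x) \<le> cmod (g x - \<psi> n x) + cmod ((\<psi> n - \<phi>) x)"
          using norm_triangle_ineq[of "g x - \<psi> n x" "\<psi> n x - \<phi> x"] by simp
        also have "cmod (g x - \<psi> n x) \<le> \<delta>"
          using elim(2) by (simp add: dist_norm norm_minus_commute less_imp_le)
        finally show "ennreal (cmod ((g - \<phi>) x)) \<le> ennreal \<delta> + ennreal (cmod (D_multi (\<lambda>_. 0) (\<psi> n - \<phi>) x))"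
          using \<delta> by (simp add: ennreal_leI flip: ennreal_plus)
      qed
      also have "\<dots> = ennreal \<delta> * ennreal m + (\<integral>\<^sup>+x. ennreal (cmod (D_multi (\<lambda>_. 0) (\<psi> n - \<phi>) x)) \<partial>lebesgue_on U)"
        using meas[OF smooth_on_diff[OF open_U smU sm], of "\<lambda>_. 0" n] m(1)
        by (subst nn_integral_add) (simp_all add: nn_integral_const)
      also have "\<dots> \<le> ennreal (e / 2) + ennreal (e / 2)"
        using elim(1) \<delta>m \<delta> m by (intro add_mono) (auto simp: ennreal_leI less_imp_le simp flip: ennreal_mult)
      finally show ?case using e by (simp flip: ennreal_plus)
    qed
    then show "(\<integral>\<^sup>+x. ennreal (cmod ((g - \<phi>) x)) \<partial>lebesgue_on U) \<le> 0 + ennreal e"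
      using eventually_happens'[OF sequentially_bot] by force
  qed
  have "AE x in lebesgue_on U. ennreal (cmod ((g - \<phi>) x)) = 0"
    using zero meas[OF smd, of "\<lambda>_. 0"] by (subst nn_integral_0_iff_AE[symmetric]) auto
  then have "AE x in lebesgue_on U. cmod ((g - \<phi>) x) \<le> 0" by eventually_elim simp
  then have "cmod ((g - \<phi>) x) \<le> 0" if "x \<in> U" for x
    using AE_lebesgue_on_open_continuous[OF open_U smooth_on_continuous[OF smd] _ that] by blast
  then have "g x = \<phi> x" for x
    using W_vanish[OF gW] van by (cases "x \<in> U") auto
  then show ?thesis using gW by (metis ext)
qed

end

lemma sn_space_subset:
  assumes "sn_space X I n" "Y \<subseteq> X" "cfun.subspace Y"
  shows "sn_space Y I n"
  using assms unfolding sn_space_def by (meson subsetD)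

lemma sn_space_Inter:
  assumes V: "\<And>i. i \<in> I \<Longrightarrow> sn_space (V i) {i} n" and I: "I \<noteq> {}"
    and mono: "\<And>i j f. i \<in> I \<Longrightarrow> j \<in> I \<Longrightarrow> i \<le> j \<Longrightarrow> f \<in> V j \<Longrightarrow> n i f \<le> n j f"
  shows "sn_space (\<Inter>i\<in>I. V i) I n"
proof
  have sub: "cfun.subspace (V i)" if "i \<in> I" for i using V[OF that] by (simp add: sn_space_def)
  show "cfun.subspace (\<Inter>i\<in>I. V i)"
    by (rule cfun.subspaceI) (use sub in \<open>auto intro: cfun.subspace_0 cfun.subspace_add cfun.subspace_scale\<close>)
  show "I \<noteq> {}" by fact
  fix i f assume i: "i \<in> I" and f: "f \<in> (\<Inter>i\<in>I. V i)"
  show "n i (f + g) \<le> n i f + n i g" if "g \<in> (\<Inter>i\<in>I. V i)" for g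
    using sn_space.triangle[OF V[OF i], of i f g] i f that by auto
  show "n i (cscale c f) = cmod c * n i f" for c
    using sn_space.scale[OF V[OF i], of i f c] i f by auto
  show "n i f \<le> n j f" if "j \<in> I" "i \<le> j" for j
    using mono[OF i that(1,2)] f that by auto
qed

lemma proj_lim_cong:
  assumes "\<And>i. i \<in> I \<Longrightarrow> S i = T i"
  shows "proj_lim I S = proj_lim I T"
proof -
  have "(\<Inter>i\<in>I. topspace (S i)) = (\<Inter>i\<in>I. topspace (T i))" using assms by auto
  then have "{(\<Inter>i\<in>I. topspace (S i)) \<inter> W |i W. i \<in> I \<and> openin (S i) W} =
      {(\<Inter>i\<in>I. topspace (T i)) \<inter> W |i W. i \<in> I \<and> openin (T i) W}"
    using assms by (auto; metis)
  then show ?thesis by (simp add: proj_lim_def)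
qed

lemma proj_lim_reindex:
  assumes "\<pi> ` I = J"
  shows "proj_lim J T = proj_lim I (\<lambda>i. T (\<pi> i))"
proof -
  have "(\<Inter>j\<in>J. topspace (T j)) = (\<Inter>i\<in>I. topspace (T (\<pi> i)))" using assms by auto
  then have "{(\<Inter>j\<in>J. topspace (T j)) \<inter> W |j W. j \<in> J \<and> openin (T j) W} =
      {(\<Inter>i\<in>I. topspace (T (\<pi> i))) \<inter> W |i W. i \<in> I \<and> openin (T (\<pi> i)) W}"
    using assms by auto
  then show ?thesis by (simp add: proj_lim_def)
qed

text \<open>Extension by zero is the identity on the functions at hand, since they are stored as
  total functions vanishing off \<open>U\<close>. An embedding then amounts to X carrying the
  subspace topology.\<close>

lemma identifies_with_closed_subspaceI:
  assumes X: "X = subtopology Y (topspace X)" and cl: "closedin Y (topspace X)"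
    and J: "\<And>f. f \<in> topspace X \<Longrightarrow> J f = f"
    and sub: "cfun.subspace (topspace X)"
  shows "identifies_with_closed_subspace X Y J"
proof -
  have im: "J ` topspace X = topspace X" using J by auto
  have "linear_between (topspace X) (topspace Y) J"
    unfolding linear_between_def
    using J im closedin_subset[OF cl] cfun.subspace_add[OF sub] cfun.subspace_scale[OF sub] by auto
  moreover have "homeomorphic_map X X J"
    using homeomorphic_map_eq[OF homeomorphic_map_id[THEN iffD2, OF refl], of X J] J by simp
  then have "embedding_map X Y J"
    unfolding embedding_map_def im using X by simp
  ultimately show ?thesis
    unfolding identifies_with_closed_subspace_def using cl im by simp
qed

section \<open>Closures of the test functions and their identification\<close>

context ultra
begin

text \<open>
  \<open>X h\<close> and \<open>B\<close> are the underlying sets of \<^term>\<open>DL_Beurling s \<infinity> h U\<close> and \<^term>\<open>B_dot s U\<close>.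
\<close>

definition X :: "real \<Rightarrow> ('d pt \<Rightarrow> complex) set" where
  "X h = {f \<in> V h. \<forall>\<epsilon>>0. \<exists>g\<in>Dd. N h (g - f) < \<epsilon>}"

definition B :: "('d pt \<Rightarrow> complex) set" where
  "B = (\<Inter>h\<in>{0<..}. X h)"

lemma X_V: "f \<in> X h \<Longrightarrow> f \<in> V h" by (simp add: X_def)

lemma B_X: "f \<in> B \<Longrightarrow> h > 0 \<Longrightarrow> f \<in> X h" by (simp add: B_def)

lemma closure_Dd:
  assumes "h > 0"
  shows "DL s \<infinity> h U closure_of Dd = X h"
  unfolding DL_eq[OF assms]
  using in_closure_of_sn_top[OF sn_space.family[OF sn_space_V[OF assms]], of _ Dd] Dd_V[OF _ assms]
  by (auto simp: X_def)

lemma X_closed: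
  assumes h: "h > 0" and f: "f \<in> V h" and lim: "\<And>\<epsilon>. \<epsilon> > 0 \<Longrightarrow> \<exists>g\<in>X h. N h (g - f) < \<epsilon>"
  shows "f \<in> X h"
  unfolding X_def
proof (intro CollectI conjI f allI impI)
  interpret sn_space "V h" "{h}" N by (rule sn_space_V[OF h])
  fix \<epsilon> :: real assume "\<epsilon> > 0"
  then obtain g where g: "g \<in> X h" "N h (g - f) < \<epsilon> / 2" using lim[of "\<epsilon> / 2"] by auto
  then obtain d where d: "d \<in> Dd" "N h (d - g) < \<epsilon> / 2"
    using half_gt_zero[OF \<open>\<epsilon> > 0\<close>] unfolding X_def by blast
  have "N h (d - f) \<le> N h (d - g) + N h (g - f)"
    using d g f h Dd_V X_V by (intro triangle_diff) auto
  then show "\<exists>g\<in>Dd. N h (g - f) < \<epsilon>" using d g by (intro bexI[of _ d]) auto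
qed

lemma Dd_X: "h > 0 \<Longrightarrow> f \<in> Dd \<Longrightarrow> f \<in> X h"
  unfolding X_def using sn_space.n_zero[OF sn_space_V, of h h] Dd_V by (auto intro!: bexI[of _ f])

lemma subspace_X:
  assumes h: "h > 0"
  shows "cfun.subspace (X h)"
proof (rule cfun.subspaceI)
  interpret sn_space "V h" "{h}" N by (rule sn_space_V[OF h])
  show "0 \<in> X h" using Dd_X[OF h cfun.subspace_0[OF subspace_Dd]] .
  fix f g c assume f: "f \<in> X h"
  show "cscale c f \<in> X h"
    unfolding X_def
  proof (intro CollectI conjI allI impI)
    show "cscale c f \<in> V h" using scale_mem X_V f by blast
    fix \<epsilon> :: real assume e: "\<epsilon> > 0"
    have c: "cmod c + 1 > 0" by (simp add: add_nonneg_pos)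
    obtain d where d: "d \<in> Dd" "N h (d - f) < \<epsilon> / (cmod c + 1)"
      using f divide_pos_pos[OF e c] unfolding X_def by blast
    have "N h (cscale c d - cscale c f) = cmod c * N h (d - f)"
      using scale[of h "d - f" c] diff_mem[OF Dd_V[OF d(1) h] X_V[OF f]] by (simp add: cfun.scale_right_diff_distrib)
    also have "\<dots> \<le> (cmod c + 1) * N h (d - f)" by (simp add: mult_right_mono N_nonneg)
    also have "\<dots> < \<epsilon>" using d(2) c by (simp add: field_simps)
    finally show "\<exists>g\<in>Dd. N h (g - cscale c f) < \<epsilon>"
      using cfun.subspace_scale[OF subspace_Dd d(1)] by blast
  qed
  assume g: "g \<in> X h"
  show "f + g \<in> X h"
    unfolding X_def
  proof (intro CollectI conjI allI impI)
    show "f + g \<in> V h" using add_mem X_V f g by blast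
    fix \<epsilon> :: real assume e: "\<epsilon> > 0"
    then have e2: "\<epsilon> / 2 > 0" by simp
    obtain d where d: "d \<in> Dd" "N h (d - f) < \<epsilon> / 2" using f e2 unfolding X_def by blast
    obtain d' where d': "d' \<in> Dd" "N h (d' - g) < \<epsilon> / 2" using g e2 unfolding X_def by blast
    have "N h ((d + d') - (f + g)) \<le> N h (d - f) + N h (d' - g)"
      using triangle[of h "d - f" "d' - g"] diff_mem[OF Dd_V[OF d(1) h] X_V[OF f]]
        diff_mem[OF Dd_V[OF d'(1) h] X_V[OF g]] by (simp add: add_diff_add)
    also have "\<dots> < \<epsilon>" using d d' by simp
    finally show "\<exists>d\<in>Dd. N h (d - (f + g)) < \<epsilon>"
      using cfun.subspace_add[OF subspace_Dd d(1) d'(1)] by blast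
  qed
qed

lemma sn_space_X: "h > 0 \<Longrightarrow> sn_space (X h) {h} N"
  by (rule sn_space_subset[OF sn_space_V _ subspace_X]) (auto simp: X_def)

lemma DL_Beurling_eq: "h > 0 \<Longrightarrow> DL_Beurling s \<infinity> h U = sn_top (X h) {h} N"
  unfolding DL_Beurling_def closure_Dd
  unfolding DL_eq by (rule subtopology_sn_top[OF sn_space.family[OF sn_space_V]]) (auto simp: X_def)

lemma topspace_DL_Beurling: "h > 0 \<Longrightarrow> topspace (DL_Beurling s \<infinity> h U) = X h"
  unfolding DL_Beurling_eq by (rule topspace_sn_top[OF sn_space.family[OF sn_space_X]])

text \<open>On \<open>U\<close>, of finite measure m, smallness in \<open>N h\<close> bounds each
  derivative uniformly and therefore in L^1, with the factor
  \<open>m / wt h \<alpha>\<close>.\<close>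

lemma X_W:
  assumes h: "h > 0" and f: "f \<in> X h"
  shows "f \<in> W"
proof -
  have fV: "f \<in> V h" using f X_V by blast
  have "\<exists>g\<in>Dd. N h (g - f) < inverse (Suc n)" for n
    using f unfolding X_def by simp
  then obtain \<psi> where \<psi>: "\<And>n. \<psi> n \<in> Dd" "\<And>n. N h (\<psi> n - f) < inverse (Suc n)" by metis
  show ?thesis
  proof (rule L1_limit_in_W)
    show "f x = 0" if "x \<notin> U" for x using fV that by (auto simp: V_def)
    show "smooth_on U f" using fV by (auto simp: V_def)
    show "\<psi> n \<in> W" for n by (rule Dd_W[OF \<psi>(1)])
    fix \<alpha>
    define m where "m = measure (lebesgue_on U) (space (lebesgue_on U))"
    have m: "emeasure (lebesgue_on U) (space (lebesgue_on U)) = ennreal m" "m \<ge> 0"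
      using finite_measure_U by (auto simp: m_def emeasure_eq_ennreal_measure)
    have "(\<lambda>n. ennreal (m / wt h \<alpha> * inverse (Suc n))) \<longlonglongrightarrow> ennreal (m / wt h \<alpha> * 0)"
      by (intro tendsto_ennrealI tendsto_intros LIMSEQ_inverse_real_of_nat)
    then have lim: "(\<lambda>n. ennreal (m / wt h \<alpha> * inverse (Suc n))) \<longlonglongrightarrow> 0" by simp
    show "(\<lambda>n. \<integral>\<^sup>+x. ennreal (cmod (D_multi \<alpha> (\<psi> n - f) x)) \<partial>lebesgue_on U) \<longlonglongrightarrow> 0"
    proof (rule tendsto_sandwich[OF _ _ tendsto_const lim]; intro always_eventually allI)
      fix n
      have wt: "wt h \<alpha> > 0" using wt_pos[OF h] .
      have "(\<integral>\<^sup>+x. ennreal (cmod (D_multi \<alpha> (\<psi> n - f) x)) \<partial>lebesgue_on U)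
          \<le> (\<integral>\<^sup>+x. ennreal (inverse (Suc n) / wt h \<alpha>) \<partial>lebesgue_on U)"
      proof (rule nn_integral_mono)
        fix x assume "x \<in> space (lebesgue_on U)"
        then have x: "x \<in> U" by simp
        have "\<psi> n - f \<in> V h"
          by (rule sn_space.diff_mem[OF sn_space_V[OF h] Dd_V[OF \<psi>(1) h] fV])
        then have "wt h \<alpha> * cmod (D_multi \<alpha> (\<psi> n - f) x) \<le> N h (\<psi> n - f)"
          using N_upper[OF h _ x, of "\<psi> n - f" \<alpha>] norm_A[OF h] by simp
        also have "\<dots> \<le> inverse (Suc n)" using \<psi>(2)[of n] by simp
        finally have "cmod (D_multi \<alpha> (\<psi> n - f) x) \<le> inverse (Suc n) / wt h \<alpha>"
          using wt by (subst pos_le_divide_eq) (simp_all add: mult.commute)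
        then show "ennreal (cmod (D_multi \<alpha> (\<psi> n - f) x)) \<le> ennreal (inverse (Suc n) / wt h \<alpha>)"
          by (rule ennreal_leI)
      qed
      also have "\<dots> = ennreal (inverse (Suc n) / wt h \<alpha>) * ennreal m" by (simp add: m(1)[symmetric])
      also have "\<dots> = ennreal (m / wt h \<alpha> * inverse (Suc n))"
        using wt m by (simp add: ennreal_mult[symmetric] field_simps)
      finally show "(\<integral>\<^sup>+x. ennreal (cmod (D_multi \<alpha> (\<psi> n - f) x)) \<partial>lebesgue_on U)
          \<le> ennreal (m / wt h \<alpha> * inverse (Suc n))" .
    qed simp
  qed
qed

lemma X_mono: "0 < h \<Longrightarrow> h \<le> h' \<Longrightarrow> f \<in> X h' \<Longrightarrow> f \<in> X h"
proof -
  assume h: "0 < h" "h \<le> h'" and f: "f \<in> X h'"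
  have "\<exists>g\<in>Dd. N h (g - f) < \<epsilon>" if e: "\<epsilon> > 0" for \<epsilon>
  proof -
    obtain g where g: "g \<in> Dd" "N h' (g - f) < \<epsilon>" using f e unfolding X_def by blast
    have "g - f \<in> V h'"
      using sn_space.diff_mem[OF sn_space_V[of h'] Dd_V[OF g(1)] X_V[OF f]] h by simp
    then have "N h (g - f) \<le> N h' (g - f)" using V_mono[OF h] by blast
    then show ?thesis using g by (intro bexI[of _ g]) auto
  qed
  then show "f \<in> X h" using V_mono[OF h X_V[OF f]] by (simp add: X_def)
qed

lemma sn_space_B: "sn_space B {0<..} N"
  unfolding B_def by (rule sn_space_Inter[OF sn_space_X]) (use V_mono X_V in auto)

lemma eq_0_if_N_eq_0: "h > 0 \<Longrightarrow> f \<in> V h \<Longrightarrow> N h f = 0 \<Longrightarrow> f = 0"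
proof
  fix x assume h: "h > 0" and f: "f \<in> V h" and 0: "N h f = 0"
  show "f x = 0 x"
  proof (cases "x \<in> U")
    case True
    then show ?thesis
      using N_upper[OF h f True, of "\<lambda>_. 0"] norm_A[OF h, of "\<lambda>_. 0" x f] wt_pos[OF h, of "\<lambda>_. 0"] 0
      by (simp add: mult_le_0_iff)
  next
    case False
    then show ?thesis using f by (simp add: V_def)
  qed
qed

lemma sn_chain_B: "sn_chain B N"
proof -
  interpret sn_space B "{0<..}" N by (rule sn_space_B)
  show ?thesis
  proof
    fix h f assume "h > 0" "f \<in> B" "N h f = 0"
    then show "f = 0" using eq_0_if_N_eq_0 B_X X_V by blast
  qed
qed

lemma proj_lim_DL_Beurling: "proj_lim {0<..} (\<lambda>h. DL_Beurling s \<infinity> h U) = sn_top B {0<..} N"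
proof -
  have "proj_lim {0<..} (\<lambda>h. DL_Beurling s \<infinity> h U) = proj_lim {0<..} (\<lambda>h. sn_top (X h) {h} N)"
    by (rule proj_lim_cong, rule DL_Beurling_eq) simp
  also have "\<dots> = sn_top B {0<..} N"
    using sn_space.family[OF sn_space_B] sn_space.family[OF sn_space_X]
    unfolding B_def by (intro proj_lim_eq_sn_top) auto
  finally show ?thesis .
qed

text \<open>In a directed family, closure is tested with one seminorm at a time. Hence the closure
  taken in the projective limit and the intersection of the closures \<open>X h\<close> are the same
  set \<open>B\<close>.\<close>

lemma B_dot_eq: "B_dot s U = sn_top B {0<..} N"
proof -
  let ?V = "\<Inter>h\<in>{0<..}. V h"
  have fam: "seminorm_family ?V {0<..} N"
    by (rule sn_space.family, rule sn_space_Inter[OF sn_space_V]) (use V_mono in auto)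
  have T: "proj_lim {0<..} (\<lambda>h. DL s \<infinity> h U) = sn_top ?V {0<..} N"
  proof -
    have "proj_lim {0<..} (\<lambda>h. DL s \<infinity> h U) = proj_lim {0<..} (\<lambda>h. sn_top (V h) {h} N)"
      by (rule proj_lim_cong, rule DL_eq) simp
    also have "\<dots> = sn_top ?V {0<..} N"
      using fam sn_space.family[OF sn_space_V] by (intro proj_lim_eq_sn_top) auto
    finally show ?thesis .
  qed
  have cl: "sn_top ?V {0<..} N closure_of Dd = B"
    using in_closure_of_sn_top[OF fam, of _ Dd] Dd_V by (auto simp: B_def X_def)
  show ?thesis
    unfolding B_dot_def Let_def T cl by (rule subtopology_sn_top[OF fam]) (auto simp: B_def X_def)
qed

lemma zero_ext_X: "f \<in> X h \<Longrightarrow> zero_ext U f = f"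
  by (auto simp: zero_ext_def X_def V_def fun_eq_iff)

lemma X_VK: "h > 0 \<Longrightarrow> f \<in> X h \<Longrightarrow> f \<in> VK h"
  using W_VK_iff X_W X_V by blast

lemma X_NK: "h > 0 \<Longrightarrow> f \<in> X h \<Longrightarrow> NK h f = N h f"
  using W_NK_eq_N X_W X_V by blast

text \<open>A function of \<open>VK h\<close> may have nonzero derivatives on the frontier of
  \<open>U\<close>, so membership in \<open>W\<close> has to be derived: evaluation of D^\<alpha> at
  a frontier point is continuous for \<open>NK h\<close> and vanishes on \<open>X h\<close>.\<close>

lemma X_closed_NK:
  assumes h: "h > 0" and f: "f \<in> VK h" and lim: "\<And>\<epsilon>. \<epsilon> > 0 \<Longrightarrow> \<exists>g\<in>X h. NK h (g - f) < \<epsilon>"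
  shows "f \<in> X h"
proof -
  interpret K: sn_space "VK h" "{h}" NK by (rule sn_space_VK[OF h])
  have fs: "smooth_on UNIV f" "supp f \<subseteq> closure U" using f by (auto simp: VK_def)
  have fW: "f \<in> W"
    unfolding W_def
  proof (intro CollectI conjI fs(1) allI impI)
    fix \<alpha> x assume x: "x \<notin> U"
    show "D_multi \<alpha> f x = 0"
    proof (cases "x \<in> closure U")
      case True
      have "cmod (A h (\<alpha>, x) f) \<le> 0"
      proof (rule field_le_epsilon)
        fix \<epsilon> :: real assume "\<epsilon> > 0"
        then obtain g where g: "g \<in> X h" "NK h (g - f) < \<epsilon>" using lim by blast
        have gW: "g \<in> W" by (rule X_W[OF h g(1)])
        have "A h (\<alpha>, x) (g - f) = - A h (\<alpha>, x) f"
          using A_diff[OF open_UNIV W_smooth[OF gW] fs(1)] W_A_outside[OF gW x] by simp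
        then have "cmod (A h (\<alpha>, x) f) \<le> NK h (g - f)"
          using NK_upper[OF h K.diff_mem[OF X_VK[OF h g(1)] f] True, of \<alpha>] by simp
        then show "cmod (A h (\<alpha>, x) f) \<le> 0 + \<epsilon>" using g by simp
      qed
      then show ?thesis using wt_pos[OF h, of \<alpha>] by (simp add: A_def)
    qed (use D_multi_outside_supp[OF _ fs(2)] in auto)
  qed
  show ?thesis
  proof (rule X_closed[OF h])
    show fV: "f \<in> V h" using f fW W_VK_iff[OF h] by blast
    fix \<epsilon> :: real assume "\<epsilon> > 0"
    then obtain g where g: "g \<in> X h" "NK h (g - f) < \<epsilon>" using lim by blast
    have "NK h (g - f) = N h (g - f)"
      using cfun.subspace_diff[OF subspace_W X_W[OF h g(1)] fW]
        sn_space.diff_mem[OF sn_space_V[OF h] X_V[OF g(1)] fV] by (rule W_NK_eq_N[OF h])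
    then show "\<exists>g\<in>X h. N h (g - f) < \<epsilon>" using g by auto
  qed
qed

lemma DL_Beurling_identifies:
  assumes h: "h > 0"
  shows "identifies_with_closed_subspace (DL_Beurling s \<infinity> h U) (DK s (1 / h) (closure U)) (zero_ext U)"
proof (rule identifies_with_closed_subspaceI; 
    unfold DL_Beurling_eq[OF h] DK_eq[OF h] sn_space.topspace_T[OF sn_space_X[OF h]])
  note famK = sn_space.family[OF sn_space_VK[OF h]]
  have sub: "X h \<subseteq> VK h" using X_VK[OF h] by blast
  have "sn_top (X h) {h} NK = sn_top (X h) {h} N"
    using X_NK[OF h] cfun.subspace_diff[OF subspace_X[OF h]] by (intro sn_top_cong) auto
  then show "sn_top (X h) {h} N = subtopology (sn_top (VK h) {h} NK) (X h)"
    by (simp add: subtopology_sn_top[OF famK sub])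
  have "sn_top (VK h) {h} NK closure_of X h \<subseteq> X h"
  proof
    fix f assume "f \<in> sn_top (VK h) {h} NK closure_of X h"
    then have "f \<in> VK h" "\<And>\<epsilon>. \<epsilon> > 0 \<Longrightarrow> \<exists>g\<in>X h. NK h (g - f) < \<epsilon>"
      unfolding in_closure_of_sn_top[OF famK] by auto
    then show "f \<in> X h" by (rule X_closed_NK[OF h])
  qed
  then show "closedin (sn_top (VK h) {h} NK) (X h)"
    unfolding closure_of_subset_eq[symmetric] topspace_sn_top[OF famK] using sub by blast
qed (use zero_ext_X subspace_X[OF h] in auto)

lemma VK_mono: "0 < h \<Longrightarrow> h \<le> h' \<Longrightarrow> f \<in> VK h' \<Longrightarrow> NK h f \<le> NK h' f"
proof -
  assume h: "0 < h" "h \<le> h'" and f: "f \<in> VK h'"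
  have h': "h' > 0" using h by simp
  have "cmod (A h (\<alpha>, x) f) \<le> NK h' f" if "x \<in> closure U" for \<alpha> x
  proof -
    have "wt h \<alpha> \<le> wt h' \<alpha>" unfolding wt_def using h by (intro divide_right_mono power_mono) auto
    then have "cmod (A h (\<alpha>, x) f) \<le> cmod (A h' (\<alpha>, x) f)"
      unfolding norm_A[OF h(1)] norm_A[OF h'] by (rule mult_right_mono) simp
    also have "\<dots> \<le> NK h' f" by (rule NK_upper[OF h' f that])
    finally show ?thesis .
  qed
  then show ?thesis
    unfolding NK_def[of h] using NK_nonneg by (intro NK_char(3)[OF h(1)]) auto
qed

lemma B_dot_identifies:
  "identifies_with_closed_subspace (B_dot s U) (DK_Beurling s (closure U)) (zero_ext U)"
proof -
  let ?V = "\<Inter>h\<in>{0<..}. VK h"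
  have fam: "seminorm_family ?V {0<..} NK"
    by (rule sn_space.family, rule sn_space_Inter[OF sn_space_VK]) (use VK_mono in auto)
  \<comment> \<open>The limit k to 0 on one side is the limit h = 1 / k to infinity on the
    other.\<close>
  have "(\<lambda>h::real. 1 / h) ` {0<..} = {0<..}"
    by (auto simp: image_iff intro!: bexI[of _ "1 / x" for x])
  then have "DK_Beurling s (closure U) = proj_lim {0<..} (\<lambda>h. DK s (1 / h) (closure U))"
    unfolding DK_Beurling_def by (rule proj_lim_reindex)
  also have "\<dots> = proj_lim {0<..} (\<lambda>h. sn_top (VK h) {h} NK)"
    by (rule proj_lim_cong) (simp add: DK_eq)
  also have "\<dots> = sn_top ?V {0<..} NK"
    using fam sn_space.family[OF sn_space_VK] by (intro proj_lim_eq_sn_top) auto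
  finally have Y: "DK_Beurling s (closure U) = sn_top ?V {0<..} NK" .
  have sub: "B \<subseteq> ?V" using X_VK B_X by auto
  interpret B: sn_space B "{0<..}" N by (rule sn_space_B)
  show ?thesis
  proof (rule identifies_with_closed_subspaceI; unfold B_dot_eq Y B.topspace_T)
    have "sn_top B {0<..} NK = sn_top B {0<..} N"
      using X_NK B_X B.diff_mem by (intro sn_top_cong) auto
    then show "sn_top B {0<..} N = subtopology (sn_top ?V {0<..} NK) B"
      by (simp add: subtopology_sn_top[OF fam sub])
    have "sn_top ?V {0<..} NK closure_of B \<subseteq> B"
    proof
      fix f assume f: "f \<in> sn_top ?V {0<..} NK closure_of B"
      have "f \<in> X h" if h: "h > 0" for h
      proof (rule X_closed_NK[OF h])
        note f' = f[unfolded in_closure_of_sn_top[OF fam]]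
        show "f \<in> VK h" using f' h by simp
        fix \<epsilon> :: real assume "\<epsilon> > 0"
        then have "\<exists>g\<in>B. g \<in> ?V \<and> NK h (g - f) < \<epsilon>" using f' h by simp
        then show "\<exists>g\<in>X h. NK h (g - f) < \<epsilon>" using B_X[OF _ h] by blast
      qed
      then show "f \<in> B" by (simp add: B_def)
    qed
    then show "closedin (sn_top ?V {0<..} NK) B"
      unfolding closure_of_subset_eq[symmetric] topspace_sn_top[OF fam] using sub by blast
    show "zero_ext U f = f" if "f \<in> B" for f using zero_ext_X[OF B_X[OF that zero_less_one]] .
  qed (rule B.subspace)
qed

section \<open>Compactness of the inclusions\<close>

lemma D_multi_lipschitz:
  fixes f :: "'d pt \<Rightarrow> complex"
  assumes f: "smooth_on UNIV f" and bd: "\<And>\<beta> z. cmod (D_multi \<beta> f z) \<le> M \<beta>"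
  shows "cmod (D_multi \<alpha> f x - D_multi \<alpha> f y) \<le> (\<Sum>j\<in>UNIV. M (\<lambda>i. count {#j#} i + \<alpha> i)) * norm (x - y)"
proof (rule differentiable_bound[OF convex_UNIV])
  fix z
  show "(D_multi \<alpha> f has_derivative (\<lambda>h. \<Sum>j\<in>UNIV. of_real (h $ j) * (\<i> * Dj j (D_multi \<alpha> f) z))) (at z within UNIV)"
    using smooth_on_has_derivative[OF smooth_on_Dw[OF f]] unfolding D_multi_eq_Dw by simp
  have Dj: "Dj j (D_multi \<alpha> f) z = D_multi (\<lambda>i. count {#j#} i + \<alpha> i) f z" for j
    using D_multi_Dw_append[OF f, of "[j]" \<alpha>] by simp
  show "onorm (\<lambda>h. \<Sum>j\<in>UNIV. complex_of_real (h $ j) * (\<i> * Dj j (D_multi \<alpha> f) z))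
      \<le> (\<Sum>j\<in>UNIV. M (\<lambda>i. count {#j#} i + \<alpha> i))"
  proof (rule onorm_le)
    fix h :: "'d pt"
    have "norm (\<Sum>j\<in>UNIV. complex_of_real (h $ j) * (\<i> * Dj j (D_multi \<alpha> f) z))
        \<le> (\<Sum>j\<in>UNIV. M (\<lambda>i. count {#j#} i + \<alpha> i) * norm h)"
    proof (rule order_trans[OF norm_sum sum_mono])
      fix j
      have "norm (complex_of_real (h $ j) * (\<i> * Dj j (D_multi \<alpha> f) z)) = cmod (Dj j (D_multi \<alpha> f) z) * \<bar>h $ j\<bar>"
        by (simp add: norm_mult)
      also have "\<dots> \<le> M (\<lambda>i. count {#j#} i + \<alpha> i) * norm h"
        using bd component_le_norm_cart[of h j] order_trans[OF norm_ge_zero bd] unfolding Dj by (intro mult_mono) auto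
      finally show "norm (complex_of_real (h $ j) * (\<i> * Dj j (D_multi \<alpha> f) z)) \<le> M (\<lambda>i. count {#j#} i + \<alpha> i) * norm h" .
    qed
    then show "norm (\<Sum>j\<in>UNIV. complex_of_real (h $ j) * (\<i> * Dj j (D_multi \<alpha> f) z))
        \<le> (\<Sum>j\<in>UNIV. M (\<lambda>i. count {#j#} i + \<alpha> i)) * norm h"
      by (simp add: sum_distrib_right)
  qed
qed auto

text \<open>Bounds on the derivatives of order |\<alpha>| + 1 give a common Lipschitz constant,
  hence the equicontinuity for Arzela-Ascoli on the compact closure of \<open>U\<close>. Off
  \<open>U\<close> every term is zero, so the convergence is uniform on R^d.\<close>

lemma uniformly_Cauchy_subseq:
  fixes \<sigma> :: "nat \<Rightarrow> 'd pt \<Rightarrow> complex"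
  assumes \<sigma>: "\<And>n. \<sigma> n \<in> W" and bd: "\<And>n \<beta> z. cmod (D_multi \<beta> (\<sigma> n) z) \<le> M \<beta>"
  shows "\<exists>r. strict_mono r \<and> uniformly_Cauchy_on UNIV (\<lambda>k. D_multi \<alpha> (\<sigma> (r k)))"
proof -
  define L where "L = (\<Sum>j\<in>UNIV. M (\<lambda>i. count {#j#} i + \<alpha> i))"
  have lip: "cmod (D_multi \<alpha> (\<sigma> n) x - D_multi \<alpha> (\<sigma> n) y) \<le> L * norm (x - y)" for n x y
    unfolding L_def by (rule D_multi_lipschitz[OF W_smooth[OF \<sigma>] bd])
  have M0: "0 \<le> M \<beta>" for \<beta> using order_trans[OF norm_ge_zero bd] .
  then have L0: "L \<ge> 0" unfolding L_def by (intro sum_nonneg) auto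
  have "compact (closure U)" using bounded_U by (simp add: compact_closure)
  then obtain g and k :: "nat \<Rightarrow> nat" where k: "strict_mono k"
    and lim: "\<And>e. 0 < e \<Longrightarrow> \<exists>N. \<forall>n x. n \<ge> N \<and> x \<in> closure U \<longrightarrow> norm (D_multi \<alpha> (\<sigma> (k n)) x - g x) < e"
  proof (rule Arzela_Ascoli[of "closure U" "\<lambda>n. D_multi \<alpha> (\<sigma> n)" "M \<alpha>"])
    show "norm (D_multi \<alpha> (\<sigma> n) x) \<le> M \<alpha>" for n x by (rule bd)
    fix x :: "'d pt" and e :: real assume e: "e > 0"
    show "\<exists>d>0. \<forall>n y. y \<in> closure U \<and> norm (x - y) < d \<longrightarrow> norm (D_multi \<alpha> (\<sigma> n) x - D_multi \<alpha> (\<sigma> n) y) < e"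
    proof (intro exI[of _ "e / (L + 1)"] conjI allI impI)
      show "e / (L + 1) > 0" using e L0 by simp
      fix n y assume y: "y \<in> closure U \<and> norm (x - y) < e / (L + 1)"
      have "L * norm (x - y) \<le> (L + 1) * norm (x - y)" by (simp add: mult_right_mono)
      also have "\<dots> < e" using y L0 by (simp add: field_simps)
      finally show "norm (D_multi \<alpha> (\<sigma> n) x - D_multi \<alpha> (\<sigma> n) y) < e" using lip[of n x y] by simp
    qed
  qed auto
  have "uniformly_Cauchy_on UNIV (\<lambda>n. D_multi \<alpha> (\<sigma> (k n)))"
  proof (rule uniformly_Cauchy_onI)
    fix e :: real assume e: "e > 0"
    then obtain K where K: "\<And>n x. n \<ge> K \<Longrightarrow> x \<in> closure U \<Longrightarrow> norm (D_multi \<alpha> (\<sigma> (k n)) x - g x) < e / 2"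
      using lim[of "e / 2"] by auto
    have "dist (D_multi \<alpha> (\<sigma> (k m)) x) (D_multi \<alpha> (\<sigma> (k n)) x) < e" if "m \<ge> K" "n \<ge> K" for m n x
    proof (cases "x \<in> U")
      case True
      then have "x \<in> closure U" using closure_subset by blast
      then have "dist (D_multi \<alpha> (\<sigma> (k m)) x) (g x) < e / 2" "dist (D_multi \<alpha> (\<sigma> (k n)) x) (g x) < e / 2"
        using K[OF that(1)] K[OF that(2)] by (simp_all add: dist_norm)
      then show ?thesis by (rule dist_triangle_half_l)
    next
      case False
      then show ?thesis using W_outside[OF \<sigma> False] e by simp
    qed
    then show "\<exists>K. \<forall>x\<in>UNIV. \<forall>m\<ge>K. \<forall>n\<ge>K. dist (D_multi \<alpha> (\<sigma> (k m)) x) (D_multi \<alpha> (\<sigma> (k n)) x) < e" by blast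
  qed
  then show ?thesis using k by blast
qed

lemma finite_mi_abs_less: "finite {\<alpha> :: 'd \<Rightarrow> nat. mi_abs \<alpha> < n}"
proof (rule finite_subset)
  show "finite (Pi\<^sub>E (UNIV :: 'd set) (\<lambda>_. {..<n}))" by (intro finite_PiE) auto
  show "{\<alpha> :: 'd \<Rightarrow> nat. mi_abs \<alpha> < n} \<subseteq> Pi\<^sub>E UNIV (\<lambda>_. {..<n})"
  proof (intro subsetI PiE_I)
    fix \<alpha> :: "'d \<Rightarrow> nat" and j :: 'd assume "\<alpha> \<in> {\<alpha>. mi_abs \<alpha> < n}"
    moreover have "\<alpha> j \<le> mi_abs \<alpha>" unfolding mi_abs_def by (rule member_le_sum) auto
    ultimately show "\<alpha> j \<in> {..<n}" by simp
  qed auto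
qed

lemma limit_in_W:
  fixes \<sigma> :: "nat \<Rightarrow> 'd pt \<Rightarrow> complex"
  assumes \<sigma>: "\<And>n. \<sigma> n \<in> W" and g: "smooth_on UNIV g"
    and lim: "\<And>\<alpha> x. (\<lambda>n. D_multi \<alpha> (\<sigma> n) x) \<longlonglongrightarrow> D_multi \<alpha> g x"
  shows "g \<in> W"
  unfolding W_def
proof (intro CollectI conjI g allI impI)
  fix \<alpha> x assume "x \<notin> U"
  then have "(\<lambda>n. D_multi \<alpha> (\<sigma> n) x) \<longlonglongrightarrow> 0" by (simp add: W_outside[OF \<sigma>])
  then show "D_multi \<alpha> g x = 0" using lim LIMSEQ_unique by blast
qed

text \<open>Lowering the parameter damps the order |\<alpha>| geometrically; the coefficient bound
  of the nuclear expansion rests on this too.\<close>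

lemma A_scale_param: "h > 0 \<Longrightarrow> h1 > 0 \<Longrightarrow> A h (\<alpha>, x) f = of_real ((h / h1) ^ mi_abs \<alpha>) * A h1 (\<alpha>, x) f"
  by (simp add: A_def wt_def power_divide)

text \<open>The limit keeps the bound m in \<open>V h1\<close>, while convergence in norm is gained
  for every smaller h. \<open>from_nat\<close> enumerates the multi-indices for the diagonal
  argument.\<close>

lemma compact_extraction:
  fixes \<sigma> :: "nat \<Rightarrow> 'd pt \<Rightarrow> complex"
  assumes h1: "h1 > 0" and \<sigma>: "\<And>n. \<sigma> n \<in> W" "\<And>n. \<sigma> n \<in> V h1" and m: "\<And>n. N h1 (\<sigma> n) \<le> m"
  obtains \<phi> r where "strict_mono r" "\<phi> \<in> W" "\<phi> \<in> V h1" "N h1 \<phi> \<le> m"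
    "\<And>h. 0 < h \<Longrightarrow> h < h1 \<Longrightarrow> (\<lambda>n. N h (\<sigma> (r n) - \<phi>)) \<longlonglongrightarrow> 0"
proof -
  have m0: "m \<ge> 0" using N_nonneg m by (rule order_trans)
  have bdA: "cmod (A h1 (\<alpha>, x) (\<sigma> n)) \<le> m" for \<alpha> x n
    using W_N_upper[OF h1 \<sigma>] m order_trans by blast
  have bd: "cmod (D_multi \<alpha> (\<sigma> n) x) \<le> m / wt h1 \<alpha>" for \<alpha> x n
    using bdA[of \<alpha> x n] wt_pos[OF h1, of \<alpha>] by (simp add: norm_A[OF h1] field_simps)
  define P where "P = (\<lambda>i (r :: nat \<Rightarrow> nat). uniformly_Cauchy_on UNIV (\<lambda>k. D_multi (from_nat i) (\<sigma> (r k))))"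
  have P_iff: "P i r \<longleftrightarrow> uniformly_Cauchy_on UNIV (\<lambda>k. D_multi (from_nat i) (\<sigma> (r k)))" for i r
    by (simp add: P_def)
  interpret subseqs P
  proof
    fix i and r :: "nat \<Rightarrow> nat"
    show "\<exists>r'. strict_mono r' \<and> P i (r \<circ> r')"
      unfolding P_iff o_def by (rule uniformly_Cauchy_subseq[of "\<lambda>n. \<sigma> (r n)"]) (use \<sigma> bd in auto)
  qed
  \<comment> \<open>From index \<open>Suc i\<close> on, the diagonal sequence is a subsequence of
    the one extracted for i; the Cauchy property survives passing to subsequences and dropping that
    initial segment.\<close>
  have stable: "P i (r \<circ> r')" if "strict_mono r'" "P i r" for i r r'
  proof -
    have "\<exists>M. \<forall>x\<in>UNIV. \<forall>m\<ge>M. \<forall>n\<ge>M. dist (D_multi (from_nat i) (\<sigma> (r (r' m))) x) (D_multi (from_nat i) (\<sigma> (r (r' n))) x) < e"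
      if "e > 0" for e
      using \<open>P i r\<close> that seq_suble[OF \<open>strict_mono r'\<close>] unfolding P_iff uniformly_Cauchy_on_def
      by (meson order_trans)
    then show ?thesis unfolding P_iff o_def by (rule uniformly_Cauchy_onI)
  qed
  have "P i diagseq" for i
  proof -
    have *: "P i (diagseq \<circ> (+) (Suc i))" by (rule diagseq_holds[OF stable])
    show ?thesis
    proof (rule P_iff[THEN iffD2], rule uniformly_Cauchy_onI)
      fix e :: real assume "e > 0"
      then have "\<exists>M. \<forall>x\<in>UNIV. \<forall>m\<ge>M. \<forall>n\<ge>M.
          dist (D_multi (from_nat i) (\<sigma> (diagseq (Suc i + m))) x) (D_multi (from_nat i) (\<sigma> (diagseq (Suc i + n))) x) < e"
        using P_iff[THEN iffD1, OF *] unfolding uniformly_Cauchy_on_def o_def by simp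
      then obtain M where M: "\<forall>x\<in>UNIV. \<forall>m\<ge>M. \<forall>n\<ge>M.
          dist (D_multi (from_nat i) (\<sigma> (diagseq (Suc i + m))) x) (D_multi (from_nat i) (\<sigma> (diagseq (Suc i + n))) x) < e" ..
      have "dist (D_multi (from_nat i) (\<sigma> (diagseq m)) x) (D_multi (from_nat i) (\<sigma> (diagseq n)) x) < e"
        if "m \<ge> Suc i + M" "n \<ge> Suc i + M" for m n x
        using M[rule_format, of x "m - Suc i" "n - Suc i"] that by simp
      then show "\<exists>M. \<forall>x\<in>UNIV. \<forall>m\<ge>M. \<forall>n\<ge>M. dist (D_multi (from_nat i) (\<sigma> (diagseq m)) x) (D_multi (from_nat i) (\<sigma> (diagseq n)) x) < e"
        by blast
    qed
  qed
  then have "uniformly_Cauchy_on UNIV (\<lambda>k. D_multi (from_nat (to_nat \<alpha>)) (\<sigma> (diagseq k)))" for \<alpha> :: "'d \<Rightarrow> nat"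
    using P_iff[THEN iffD1] by blast
  then have cau: "uniformly_Cauchy_on UNIV (\<lambda>k. D_multi \<alpha> (\<sigma> (diagseq k)))" for \<alpha>
    by simp
  obtain \<phi> where \<phi>: "smooth_on UNIV \<phi>"
    and lim: "\<And>\<alpha>. uniform_limit UNIV (\<lambda>k. D_multi \<alpha> (\<sigma> (diagseq k))) (D_multi \<alpha> \<phi>) sequentially"
    using smooth_limit[OF W_smooth[OF \<sigma>(1)] cau] by blast
  have plim: "(\<lambda>k. D_multi \<alpha> (\<sigma> (diagseq k)) x) \<longlonglongrightarrow> D_multi \<alpha> \<phi> x" for \<alpha> x
    using tendsto_uniform_limitI[OF lim] by simp
  have \<phi>W: "\<phi> \<in> W" by (rule limit_in_W[OF \<sigma>(1) \<phi> plim])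
  have bd\<phi>: "cmod (A h1 (\<alpha>, x) \<phi>) \<le> m" for \<alpha> x
  proof (rule LIMSEQ_le_const2)
    show "(\<lambda>k. cmod (A h1 (\<alpha>, x) (\<sigma> (diagseq k)))) \<longlonglongrightarrow> cmod (A h1 (\<alpha>, x) \<phi>)"
      unfolding A_def fst_conv snd_conv by (intro tendsto_intros plim)
  qed (use bdA in auto)
  have \<phi>V: "\<phi> \<in> V h1" unfolding W_V_iff[OF h1 \<phi>W] using bd\<phi> m0 by blast
  have \<phi>N: "N h1 \<phi> \<le> m" by (rule N_least[OF h1 \<phi>V m0 bd\<phi>])
  have "(\<lambda>n. N h (\<sigma> (diagseq n) - \<phi>)) \<longlonglongrightarrow> 0" if h: "0 < h" "h < h1" for h
  proof (rule tendstoI)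
    fix e :: real assume e: "e > 0"
    have q: "0 \<le> h / h1" "h / h1 < 1" using h h1 by auto
    have "(\<lambda>n. (h / h1) ^ n * (2 * m)) \<longlonglongrightarrow> 0 * (2 * m)"
      by (intro tendsto_intros LIMSEQ_realpow_zero q)
    then have "(\<lambda>n. (h / h1) ^ n * (2 * m)) \<longlonglongrightarrow> 0" by simp
    then have "\<forall>\<^sub>F n in sequentially. (h / h1) ^ n * (2 * m) < e / 2"
      by (rule order_tendstoD(2)) (use e in simp)
    \<comment> \<open>Differences have h1-norm at most 2 m, so the orders from n0 on contribute less
      than e / 2 uniformly in k; only finitely many multi-indices remain.\<close>
    then obtain n0 where n0: "(h / h1) ^ n0 * (2 * m) < e / 2" by (auto simp: eventually_sequentially)
    have "\<forall>\<^sub>F k in sequentially. \<forall>\<alpha>\<in>{\<alpha>. mi_abs \<alpha> < n0}. \<forall>x. cmod (A h (\<alpha>, x) (\<sigma> (diagseq k) - \<phi>)) \<le> e / 2"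
    proof (rule eventually_ball_finite[OF finite_mi_abs_less], rule ballI)
      fix \<alpha> :: "'d \<Rightarrow> nat"
      have w: "wt h \<alpha> > 0" by (rule wt_pos[OF h(1)])
      then have "e / (2 * wt h \<alpha>) > 0" using e by simp
      from uniform_limitD[OF lim[of \<alpha>] this]
      show "\<forall>\<^sub>F k in sequentially. \<forall>x. cmod (A h (\<alpha>, x) (\<sigma> (diagseq k) - \<phi>)) \<le> e / 2"
      proof eventually_elim
        case (elim k)
        show ?case
        proof
          fix x
          have "cmod (A h (\<alpha>, x) (\<sigma> (diagseq k) - \<phi>)) = wt h \<alpha> * dist (D_multi \<alpha> (\<sigma> (diagseq k)) x) (D_multi \<alpha> \<phi> x)"
            by (simp add: norm_A[OF h(1)] D_multi_eq_Dw Dw_diff[OF open_UNIV W_smooth[OF \<sigma>(1)] \<phi>] dist_norm)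
          also have "\<dots> \<le> wt h \<alpha> * (e / (2 * wt h \<alpha>))"
            using elim w by (intro mult_left_mono) (auto intro: less_imp_le)
          also have "\<dots> = e / 2" using w by simp
          finally show "cmod (A h (\<alpha>, x) (\<sigma> (diagseq k) - \<phi>)) \<le> e / 2" .
        qed
      qed
    qed
    then show "\<forall>\<^sub>F k in sequentially. dist (N h (\<sigma> (diagseq k) - \<phi>)) 0 < e"
    proof eventually_elim
      case (elim k)
      have diffV: "\<sigma> (diagseq k) - \<phi> \<in> V h"
        using sn_space.diff_mem[OF sn_space_V[OF h1] \<sigma>(2) \<phi>V] V_mono[of h h1] h by auto
      have "N h (\<sigma> (diagseq k) - \<phi>) \<le> e / 2"
      proof (rule N_least[OF h(1) diffV])
        fix \<alpha> x
        show "cmod (A h (\<alpha>, x) (\<sigma> (diagseq k) - \<phi>)) \<le> e / 2"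
        proof (cases "mi_abs \<alpha> < n0")
          case True
          then show ?thesis using elim by simp
        next
          case False
          have "cmod (A h1 (\<alpha>, x) (\<sigma> (diagseq k) - \<phi>)) \<le> cmod (A h1 (\<alpha>, x) (\<sigma> (diagseq k))) + cmod (A h1 (\<alpha>, x) \<phi>)"
            using A_diff[OF open_UNIV W_smooth[OF \<sigma>(1)] \<phi>, of x h1 \<alpha>] by (simp add: norm_triangle_ineq4)
          also have "\<dots> \<le> 2 * m" using bdA[of \<alpha> x "diagseq k"] bd\<phi>[of \<alpha> x] by simp
          finally have "cmod (A h1 (\<alpha>, x) (\<sigma> (diagseq k) - \<phi>)) \<le> 2 * m" .
          moreover have "(h / h1) ^ mi_abs \<alpha> \<le> (h / h1) ^ n0"
            using False q by (intro power_decreasing) auto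
          ultimately have "cmod (A h (\<alpha>, x) (\<sigma> (diagseq k) - \<phi>)) \<le> (h / h1) ^ n0 * (2 * m)"
            unfolding A_scale_param[OF h(1) h1] norm_mult norm_of_real abs_of_nonneg[OF zero_le_power[OF q(1)]]
            using q m0 by (intro mult_mono) auto
          then show ?thesis using n0 by simp
        qed
      qed (use e in auto)
      then show ?case using e N_nonneg[of h "\<sigma> (diagseq k) - \<phi>"] by simp
    qed
  qed
  then show ?thesis using that[OF subseq_diagseq \<phi>W \<phi>V \<phi>N] by blast
qed

text \<open>A metric for \<open>N h\<close>, introduced for the sequential criteria of compactness
  and total boundedness.\<close>

definition dX :: "real \<Rightarrow> ('d pt \<Rightarrow> complex) \<Rightarrow> ('d pt \<Rightarrow> complex) \<Rightarrow> real" where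
  "dX h f g = (if f \<in> X h \<and> g \<in> X h then N h (f - g) else 0)"

lemma Metric_space_X:
  assumes h: "h > 0"
  shows "Metric_space (X h) (dX h)"
proof -
  interpret sn_space "X h" "{h}" N by (rule sn_space_X[OF h])
  show ?thesis
  proof
    fix f g k
    show "0 \<le> dX h f g" by (simp add: dX_def N_nonneg)
    show "dX h f g = dX h g f" using n_diff_commute[of h f g] by (auto simp: dX_def)
    show "(dX h f g = 0) = (f = g)" if "f \<in> X h" "g \<in> X h"
      using eq_0_if_N_eq_0[OF h X_V[OF diff_mem[OF that]]] n_zero[of h] that by (auto simp: dX_def)
    show "dX h f k \<le> dX h f g + dX h g k" if "f \<in> X h" "g \<in> X h" "k \<in> X h"
      using triangle_diff[of h f g k] that by (simp add: dX_def)
  qed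
qed

lemma mtopology_X:
  assumes h: "h > 0"
  shows "Metric_space.mtopology (X h) (dX h) = sn_top (X h) {h} N"
proof -
  interpret sn_space "X h" "{h}" N by (rule sn_space_X[OF h])
  interpret M: Metric_space "X h" "dX h" by (rule Metric_space_X[OF h])
  have ball: "M.mball f r \<subseteq> G \<longleftrightarrow> (\<forall>g\<in>X h. N h (g - f) < r \<longrightarrow> g \<in> G)" if "f \<in> X h" for f r G
    using that n_diff_commute[of h f] by (auto simp: M.in_mball dX_def)
  show ?thesis
    unfolding topology_eq M.openin_mtopology openin_T sn_open_def using ball by blast
qed

lemma X_limit_closed:
  fixes \<sigma> :: "nat \<Rightarrow> 'd pt \<Rightarrow> complex"
  assumes "h > 0" "\<phi> \<in> V h" "\<And>n. \<sigma> n \<in> X h" "(\<lambda>n. N h (\<sigma> n - \<phi>)) \<longlonglongrightarrow> 0"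
  shows "\<phi> \<in> X h"
proof (rule X_closed[OF assms(1,2)])
  fix \<epsilon> :: real assume "\<epsilon> > 0"
  then have "\<forall>\<^sub>F n in sequentially. N h (\<sigma> n - \<phi>) < \<epsilon>" by (rule order_tendstoD(2)[OF assms(4)])
  then show "\<exists>g\<in>X h. N h (g - \<phi>) < \<epsilon>"
    using assms(3) eventually_happens'[OF sequentially_bot] by blast
qed

lemma subsequence_limit_in_X:
  fixes \<sigma> :: "nat \<Rightarrow> 'd pt \<Rightarrow> complex"
  assumes h: "0 < h" "h < h1" and \<sigma>: "\<And>n. \<sigma> n \<in> X h" "\<And>n. \<sigma> n \<in> V h1" and m: "\<And>n. N h1 (\<sigma> n) \<le> m"
  obtains \<phi> r where "strict_mono r" "\<phi> \<in> X h" "\<phi> \<in> V h1" "N h1 \<phi> \<le> m"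
    "limitin (Metric_space.mtopology (X h) (dX h)) (\<sigma> \<circ> r) \<phi> sequentially"
proof -
  have h1: "h1 > 0" using h by simp
  interpret M: Metric_space "X h" "dX h" by (rule Metric_space_X[OF h(1)])
  obtain \<phi> r where r: "strict_mono r" "\<phi> \<in> W" "\<phi> \<in> V h1" "N h1 \<phi> \<le> m"
    and lim': "\<And>h. 0 < h \<Longrightarrow> h < h1 \<Longrightarrow> (\<lambda>n. N h (\<sigma> (r n) - \<phi>)) \<longlonglongrightarrow> 0"
    by (rule compact_extraction[where \<sigma> = \<sigma> and m = m, OF h1 X_W[OF h(1) \<sigma>(1)] \<sigma>(2) m]) (rule that)
  note lim = lim'[OF h]
  note \<sigma>X = \<sigma>(1)
  have \<phi>X: "\<phi> \<in> X h"
    using V_mono[OF h(1) less_imp_le[OF h(2)] r(3)] by (intro X_limit_closed[OF h(1) _ \<sigma>X lim]) auto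
  have "limitin M.mtopology (\<sigma> \<circ> r) \<phi> sequentially"
    unfolding M.limitin_metric
  proof (intro conjI allI impI \<phi>X)
    fix \<epsilon> :: real assume "\<epsilon> > 0"
    then have "\<forall>\<^sub>F n in sequentially. N h (\<sigma> (r n) - \<phi>) < \<epsilon>" by (rule order_tendstoD(2)[OF lim])
    then show "\<forall>\<^sub>F n in sequentially. (\<sigma> \<circ> r) n \<in> X h \<and> dX h ((\<sigma> \<circ> r) n) \<phi> < \<epsilon>"
      by eventually_elim (use \<sigma>X \<phi>X in \<open>simp add: dX_def\<close>)
  qed
  then show ?thesis using that r \<phi>X by blast
qed

lemma DL_Beurling_compact:
  assumes h: "0 < h" "h < h1"
  shows "compact_linear_map (DL_Beurling s \<infinity> h1 U) (DL_Beurling s \<infinity> h U) (\<lambda>\<phi>. \<phi>)"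
proof -
  have h1: "h1 > 0" using h by simp
  have sub: "X h1 \<subseteq> X h" using X_mono[OF h(1) less_imp_le[OF h(2)]] by blast
  interpret M: Metric_space "X h" "dX h" by (rule Metric_space_X[OF h(1)])
  interpret sn_space "X h1" "{h1}" N by (rule sn_space_X[OF h1])
  \<comment> \<open>Limits of sequences from the h1-ball are known to lie in \<open>X h\<close> and
    in \<open>V h1\<close>, but not in \<open>X h1\<close>. So the compact set is cut out of
    \<open>X h\<close> by the norm of \<open>V h1\<close>, with a closed bound that survives the
    limit.\<close>
  define C where "C = {f \<in> X h. f \<in> V h1 \<and> N h1 f \<le> 1}"
  have "compactin M.mtopology C"
    unfolding M.compactin_sequentially
  proof (intro conjI allI impI)
    show "C \<subseteq> X h" by (auto simp: C_def)
    fix \<sigma> :: "nat \<Rightarrow> 'd pt \<Rightarrow> complex" assume "range \<sigma> \<subseteq> C"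
    then have \<sigma>: "\<sigma> n \<in> X h" "\<sigma> n \<in> V h1" "N h1 (\<sigma> n) \<le> 1" for n by (auto simp: C_def)
    show "\<exists>l r. l \<in> C \<and> strict_mono r \<and> limitin M.mtopology (\<sigma> \<circ> r) l sequentially"
      by (rule subsequence_limit_in_X[where \<sigma> = \<sigma>, OF h \<sigma>]) (auto simp: C_def)
  qed
  then have "compactin (sn_top (X h) {h} N) C" by (simp add: mtopology_X[OF h(1)])
  moreover have "zero_nhd T {f \<in> X h1. N h1 f < 1}" unfolding zero_nhd_iff by (auto intro: exI[of _ 1])
  moreover have "{f \<in> X h1. N h1 f < 1} \<subseteq> C" using sub X_V by (auto simp: C_def)
  ultimately show ?thesis
    unfolding compact_linear_map_def DL_Beurling_eq[OF h1] DL_Beurling_eq[OF h(1)] linear_between_def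
      topspace_T sn_space.topspace_T[OF sn_space_X[OF h(1)]]
    using sub by auto
qed

text \<open>Compactness in the form of finite nets with centres in S, ready for the Schwartz
  property and for separability.\<close>

lemma totally_bounded_in_B:
  assumes h: "0 < h" "h < h1" and S: "S \<subseteq> B" "\<And>f. f \<in> S \<Longrightarrow> N h1 f \<le> m" and e: "\<epsilon> > 0"
  obtains F where "finite F" "F \<subseteq> S" "\<And>f. f \<in> S \<Longrightarrow> \<exists>g\<in>F. N h (f - g) < \<epsilon>"
proof -
  have h1: "h1 > 0" using h by simp
  interpret M: Metric_space "X h" "dX h" by (rule Metric_space_X[OF h(1)])
  interpret sn_space "X h" "{h}" N by (rule sn_space_X[OF h(1)])
  have SX: "S \<subseteq> X h" using S(1) B_X[OF _ h(1)] by blast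
  have "M.mtotally_bounded S"
    unfolding M.mtotally_bounded_sequentially
  proof (intro conjI SX allI impI)
    fix \<sigma> :: "nat \<Rightarrow> 'd pt \<Rightarrow> complex" assume r: "range \<sigma> \<subseteq> S"
    then have \<sigma>: "\<sigma> n \<in> X h" "\<sigma> n \<in> V h1" "N h1 (\<sigma> n) \<le> m" for n
    proof -
      have "\<sigma> n \<in> S" using r by blast
      then show "\<sigma> n \<in> X h" "\<sigma> n \<in> V h1" "N h1 (\<sigma> n) \<le> m"
        using S SX X_V[OF B_X[OF _ h1]] by blast+
    qed
    obtain \<phi> r where "strict_mono r" "limitin M.mtopology (\<sigma> \<circ> r) \<phi> sequentially"
      by (rule subsequence_limit_in_X[where \<sigma> = \<sigma>, OF h \<sigma>])
    moreover have "range (\<sigma> \<circ> r) \<subseteq> X h" using \<sigma> by auto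
    ultimately show "\<exists>r. strict_mono r \<and> M.MCauchy (\<sigma> \<circ> r)" using M.convergent_imp_MCauchy by blast
  qed
  then have "\<exists>F. finite F \<and> F \<subseteq> S \<and> S \<subseteq> (\<Union>g\<in>F. M.mball g \<epsilon>)"
    using e unfolding M.mtotally_bounded_def by simp
  then obtain F where F: "finite F" "F \<subseteq> S" "S \<subseteq> (\<Union>g\<in>F. M.mball g \<epsilon>)"
    by (elim exE conjE)
  have "\<exists>g\<in>F. N h (f - g) < \<epsilon>" if "f \<in> S" for f
  proof -
    have "f \<in> (\<Union>g\<in>F. M.mball g \<epsilon>)" using F(3) that by (rule subsetD)
    then obtain g where g: "g \<in> F" "f \<in> M.mball g \<epsilon>" by (rule UN_E)
    then have "g \<in> X h" "f \<in> X h" "dX h g f < \<epsilon>" unfolding M.in_mball by auto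
    then have "N h (f - g) < \<epsilon>" using n_diff_commute[of h f g] by (simp add: dX_def)
    then show ?thesis using g by blast
  qed
  then show ?thesis using that F by blast
qed

section \<open>Completeness and the Schwartz property\<close>

lemma B_dot_complete:
  fixes \<sigma> :: "nat \<Rightarrow> 'd pt \<Rightarrow> complex"
  assumes "tvs_Cauchy (B_dot s U) \<sigma>"
  shows "\<exists>l. limitin (B_dot s U) \<sigma> l sequentially"
proof -
  interpret sn_space B "{0<..}" N by (rule sn_space_B)
  have \<sigma>: "\<sigma> n \<in> B" for n using assms by (auto simp: tvs_Cauchy_def B_dot_eq topspace_T)
  have cau: "\<exists>M. \<forall>m\<ge>M. \<forall>n\<ge>M. N h (\<sigma> m - \<sigma> n) < e" if "h > 0" "e > 0" for h e
  proof -
    have "zero_nhd T {f \<in> B. N h f < e}" unfolding zero_nhd_iff using that by auto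
    then show ?thesis using assms unfolding tvs_Cauchy_def B_dot_eq by blast
  qed
  have \<sigma>W: "\<sigma> n \<in> W" and \<sigma>V: "h > 0 \<Longrightarrow> \<sigma> n \<in> V h" for n h
    using X_W[OF zero_less_one B_X[OF \<sigma>]] X_V[OF B_X[OF \<sigma>]] by auto
  have diff: "\<sigma> m - \<sigma> n \<in> W" "h > 0 \<Longrightarrow> \<sigma> m - \<sigma> n \<in> V h" for m n h
    using cfun.subspace_diff[OF subspace_W \<sigma>W \<sigma>W] X_V[OF B_X[OF diff_mem[OF \<sigma> \<sigma>]]] by auto
  \<comment> \<open>The single seminorm \<open>N 1\<close> already controls each fixed derivative
    uniformly; the other parameters enter when convergence in every norm is shown.\<close>
  have ucau: "uniformly_Cauchy_on UNIV (\<lambda>n. D_multi \<alpha> (\<sigma> n))" for \<alpha>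
  proof (rule uniformly_Cauchy_onI)
    fix e :: real assume e: "e > 0"
    have w: "wt 1 \<alpha> > 0" by (rule wt_pos) simp
    obtain M where M: "\<And>m n. m \<ge> M \<Longrightarrow> n \<ge> M \<Longrightarrow> N 1 (\<sigma> m - \<sigma> n) < e * wt 1 \<alpha>"
      using cau[of 1 "e * wt 1 \<alpha>"] e w by auto
    have "dist (D_multi \<alpha> (\<sigma> m) x) (D_multi \<alpha> (\<sigma> n) x) < e" if "m \<ge> M" "n \<ge> M" for m n x
    proof -
      have "wt 1 \<alpha> * cmod (D_multi \<alpha> (\<sigma> m - \<sigma> n) x) < e * wt 1 \<alpha>"
        using W_N_upper[OF zero_less_one diff(1) diff(2)[OF zero_less_one], of \<alpha> x m n] M[OF that]
        by (simp add: norm_A)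
      then have "cmod (D_multi \<alpha> (\<sigma> m - \<sigma> n) x) < e" using w by (simp add: mult.commute)
      then show ?thesis
        by (simp add: D_multi_eq_Dw Dw_diff[OF open_UNIV W_smooth[OF \<sigma>W] W_smooth[OF \<sigma>W]] dist_norm)
    qed
    then show "\<exists>M. \<forall>x\<in>UNIV. \<forall>m\<ge>M. \<forall>n\<ge>M. dist (D_multi \<alpha> (\<sigma> m) x) (D_multi \<alpha> (\<sigma> n) x) < e" by blast
  qed
  obtain \<phi> where \<phi>: "smooth_on UNIV \<phi>"
    and lim: "\<And>\<alpha>. uniform_limit UNIV (\<lambda>k. D_multi \<alpha> (\<sigma> k)) (D_multi \<alpha> \<phi>) sequentially"
    using smooth_limit[OF W_smooth[OF \<sigma>W] ucau] by blast
  have plim: "(\<lambda>k. D_multi \<alpha> (\<sigma> k) x) \<longlonglongrightarrow> D_multi \<alpha> \<phi> x" for \<alpha> x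
    using tendsto_uniform_limitI[OF lim] by simp
  have \<phi>W: "\<phi> \<in> W" by (rule limit_in_W[OF \<sigma>W \<phi> plim])
  \<comment> \<open>Fix n and let the other index tend to infinity in the Cauchy estimate; pointwise
    convergence suffices because the estimate is uniform in \<alpha> and x.\<close>
  have bd: "\<exists>M. \<forall>n\<ge>M. \<forall>\<alpha> x. cmod (A h (\<alpha>, x) (\<sigma> n - \<phi>)) \<le> e" if h: "h > 0" and e: "e > 0" for h e
  proof -
    obtain M where M: "\<And>m n. m \<ge> M \<Longrightarrow> n \<ge> M \<Longrightarrow> N h (\<sigma> m - \<sigma> n) < e"
      using cau[OF h e] by auto
    have "cmod (A h (\<alpha>, x) (\<sigma> n - \<phi>)) \<le> e" if n: "n \<ge> M" for n \<alpha> x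
    proof (rule LIMSEQ_le_const2)
      show "(\<lambda>k. cmod (A h (\<alpha>, x) (\<sigma> n) - A h (\<alpha>, x) (\<sigma> k))) \<longlonglongrightarrow> cmod (A h (\<alpha>, x) (\<sigma> n - \<phi>))"
        unfolding A_diff[OF open_UNIV W_smooth[OF \<sigma>W] \<phi> UNIV_I] unfolding A_def fst_conv snd_conv
        by (intro tendsto_intros plim)
      show "\<exists>K. \<forall>k\<ge>K. cmod (A h (\<alpha>, x) (\<sigma> n) - A h (\<alpha>, x) (\<sigma> k)) \<le> e"
        using order_trans[OF W_N_upper[OF h diff(1) diff(2)[OF h]] less_imp_le[OF M[OF n]], of _ \<alpha> x]
        by (auto simp: A_diff[OF open_UNIV W_smooth[OF \<sigma>W] W_smooth[OF \<sigma>W]] intro!: exI[of _ M])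
    qed
    then show ?thesis by blast
  qed
  \<comment> \<open>One \<sigma>_M within distance 1 of \<phi> bounds it.\<close>
  have \<phi>V: "\<phi> \<in> V h" if h: "h > 0" for h
  proof -
    obtain M where M: "\<And>\<alpha> x. cmod (A h (\<alpha>, x) (\<sigma> M - \<phi>)) \<le> 1" using bd[OF h zero_less_one] by blast
    have "cmod (A h (\<alpha>, x) \<phi>) \<le> N h (\<sigma> M) + 1" for \<alpha> x
    proof -
      have "A h (\<alpha>, x) \<phi> = A h (\<alpha>, x) (\<sigma> M) - A h (\<alpha>, x) (\<sigma> M - \<phi>)"
        using A_diff[OF open_UNIV W_smooth[OF \<sigma>W] \<phi> UNIV_I, of h \<alpha> x M] by simp
      also have "cmod \<dots> \<le> N h (\<sigma> M) + 1"
        by (rule order_trans[OF norm_triangle_ineq4 add_mono[OF W_N_upper[OF h \<sigma>W \<sigma>V[OF h]] M]])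
      finally show ?thesis .
    qed
    then show ?thesis unfolding W_V_iff[OF h \<phi>W] using N_nonneg[of h "\<sigma> M"]
      by (intro exI[of _ "N h (\<sigma> M) + 1"]) auto
  qed
  have Nlim: "(\<lambda>n. N h (\<sigma> n - \<phi>)) \<longlonglongrightarrow> 0" if h: "h > 0" for h
  proof (rule LIMSEQ_I)
    fix e :: real assume e: "e > 0"
    obtain M where M: "\<And>n \<alpha> x. n \<ge> M \<Longrightarrow> cmod (A h (\<alpha>, x) (\<sigma> n - \<phi>)) \<le> e / 2"
      using bd[OF h half_gt_zero[OF e]] by blast
    have "N h (\<sigma> n - \<phi>) \<le> e / 2" if "n \<ge> M" for n
      using sn_space.diff_mem[OF sn_space_V[OF h] \<sigma>V[OF h] \<phi>V[OF h]] M[OF that] e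
      by (intro N_least[OF h]) auto
    then show "\<exists>M. \<forall>n\<ge>M. norm (N h (\<sigma> n - \<phi>) - 0) < e"
      using e by (intro exI[of _ M]) (force simp: N_nonneg)
  qed
  have "\<phi> \<in> X h" if h: "h > 0" for h
    by (rule X_limit_closed[OF h \<phi>V[OF h] B_X[OF \<sigma> h] Nlim[OF h]])
  then have "\<phi> \<in> B" by (simp add: B_def)
  then have "limitin T \<sigma> \<phi> sequentially" by (rule limitin_T) (use \<sigma> Nlim in auto)
  then show ?thesis unfolding B_dot_eq by blast
qed

lemma FS_space_B_dot: "FS_space (B_dot s U)"
proof -
  interpret sn_chain B N by (rule sn_chain_B)
  have "Frechet_space T"
    unfolding Frechet_space_def using locally_convex metrizable B_dot_complete unfolding B_dot_eq by blast
  moreover have "Schwartz_space T"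
    unfolding Schwartz_space_def
  proof (intro conjI allI impI locally_convex)
    fix G assume "zero_nhd T G \<and> absolutely_convex G"
    then obtain h \<delta> where h: "h > 0" and \<delta>: "\<delta> > 0" "\<And>f. f \<in> B \<Longrightarrow> N h f < \<delta> \<Longrightarrow> f \<in> G"
      by (auto simp: zero_nhd_iff)
    \<comment> \<open>Any parameter above h would do. The same neighbourhood serves every
      \<epsilon>, through a net of mesh \<epsilon> \<delta> for \<open>N h\<close>.\<close>
    define S where "S = {f \<in> B. N (2 * h) f < 1}"
    have "zero_nhd T S" unfolding zero_nhd_iff S_def using h by (auto intro!: bexI[of _ "2 * h"] exI[of _ 1])
    moreover have "\<exists>F. finite F \<and> F \<subseteq> topspace T \<and> S \<subseteq> {f + cscale (of_real \<epsilon>) w |f w. f \<in> F \<and> w \<in> G}"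
      if e: "\<epsilon> > 0" for \<epsilon>
    proof -
      obtain F where F: "finite F" "F \<subseteq> S" "\<And>f. f \<in> S \<Longrightarrow> \<exists>g\<in>F. N h (f - g) < \<epsilon> * \<delta>"
        by (rule totally_bounded_in_B[of h "2 * h" S 1 "\<epsilon> * \<delta>"]) (use h e \<delta> in \<open>auto simp: S_def\<close>)
      have SB: "S \<subseteq> B" by (auto simp: S_def)
      have "\<exists>g\<in>F. \<exists>w\<in>G. f = g + cscale (of_real \<epsilon>) w" if f: "f \<in> S" for f
      proof -
        obtain g where g: "g \<in> F" "N h (f - g) < \<epsilon> * \<delta>" using F(3)[OF f] by blast
        have fg: "f - g \<in> B" using diff_mem f g F(2) SB by blast
        define w where "w = cscale (of_real (inverse \<epsilon>)) (f - g)"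
        have wB: "w \<in> B" unfolding w_def by (rule scale_mem[OF fg])
        have "N h w = inverse \<epsilon> * N h (f - g)" unfolding w_def using scale[OF _ fg, of h] h e by (simp del: of_real_inverse)
        also have "\<dots> < \<delta>" using g(2) e by (simp add: field_simps)
        finally have "w \<in> G" using \<delta>(2)[OF wB] by blast
        moreover have "f = g + cscale (of_real \<epsilon>) w"
          using e by (simp add: w_def cscale_def fun_eq_iff flip: mult.assoc)
        ultimately show ?thesis using g(1) by blast
      qed
      then have "S \<subseteq> {f + cscale (of_real \<epsilon>) w |f w. f \<in> F \<and> w \<in> G}" by blast
      then show ?thesis using F SB unfolding topspace_T by blast
    qed
    ultimately show "\<exists>V. zero_nhd T V \<and> (\<forall>\<epsilon>>0. \<exists>F. finite F \<and> F \<subseteq> topspace T \<and>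
        V \<subseteq> {f + cscale (of_real \<epsilon>) w |f w. f \<in> F \<and> w \<in> G})" by blast
  qed
  ultimately show ?thesis unfolding FS_space_def B_dot_eq by blast
qed

end

section \<open>Finite exponents\<close>

lemma enn_powr_inverse:
  assumes "q > 0"
  shows "enn_powr (enn_powr x (1 / q)) q = x"
  using assms by (cases x) (auto simp: enn_powr_def powr_powr)

text \<open>Plays the part of Minkowski's inequality. It only has to yield finiteness for
  differences, so the size of the constant does not matter.\<close>

lemma powr_diff_le:
  assumes "q \<ge> 1"
  shows "cmod (a - b) powr q \<le> 2 powr q * (cmod a powr q + cmod b powr q)"
proof -
  have "cmod (a - b) \<le> 2 * max (cmod a) (cmod b)"
    using norm_triangle_ineq4[of a b] by simp
  then have "cmod (a - b) powr q \<le> (2 * max (cmod a) (cmod b)) powr q"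
    using assms by (intro powr_mono2) auto
  also have "\<dots> = 2 powr q * max (cmod a) (cmod b) powr q"
    by (simp add: powr_mult)
  also have "max (cmod a) (cmod b) powr q \<le> cmod a powr q + cmod b powr q"
    by (auto simp: max_def)
  finally show ?thesis by simp
qed

text \<open>A substitute for Hoelder's inequality on finite measure spaces.\<close>

lemma le_plus_powr:
  fixes a \<delta> q :: real
  assumes "a \<ge> 0" "\<delta> > 0" "q \<ge> 1"
  shows "a \<le> \<delta> + \<delta> powr (1 - q) * a powr q"
proof (cases "a \<le> \<delta>")
  case True
  then show ?thesis using assms by (simp add: add_increasing2)
next
  case False
  then have a: "a > 0" "\<delta> \<le> a" using assms by auto
  have "a = a powr (1 - q) * a powr q" using a by (simp flip: powr_add)
  \<comment> \<open>The exponent 1 - q is at most 0, so the power does not increase from \<delta> to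
    a.\<close>
  also have "\<dots> \<le> \<delta> powr (1 - q) * a powr q"
    using a assms by (intro mult_right_mono powr_mono2') auto
  finally show ?thesis using assms by simp
qed

context ultra
begin

text \<open>\<open>S\<close> is the q-th power of the norm. Balls centred at \<phi> are generators
  of the topology, so closure membership yields approximating test functions directly; convergence
  in \<open>S\<close> is then weakened to L^1 convergence of each derivative.\<close>

lemma topspace_DL_Beurling_finite_W:
  assumes h: "h > 0" and p: "p \<ge> 1" "p \<noteq> \<infinity>" and \<phi>: "\<phi> \<in> topspace (DL_Beurling s p h U)"
  shows "\<phi> \<in> W"
proof -
  define q where "q = enn2real p"
  have pq: "p = ennreal q" using p by (simp add: q_def less_top)
  then have q: "q \<ge> 1" using p by (cases "q \<ge> 0") (auto simp: ennreal_neg simp flip: ennreal_1)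
  define I where "I = (\<lambda>\<alpha> f. \<integral>\<^sup>+x. ennreal (cmod (D_multi \<alpha> f x) powr q) \<partial>lebesgue_on U)"
  define c where "c = (\<lambda>\<alpha>::'d \<Rightarrow> nat. h powr (q * mi_abs \<alpha>) / mi_fact \<alpha> powr (q * s))"
  define S where "S = (\<lambda>f. \<Sum>\<^sub>\<infinity>\<alpha>\<in>UNIV. ennreal (c \<alpha>) * I \<alpha> f)"
  have c: "c \<alpha> > 0" for \<alpha> using h mi_fact_pos[of \<alpha>] by (simp add: c_def)
  have DL: "DL_enorm s p h U f = enn_powr (S f) (1 / q)" for f
  proof -
    have "enn_powr (Lp_enorm p U (D_multi \<alpha> f)) q = I \<alpha> f" for \<alpha>
      using p q enn_powr_inverse[of q "I \<alpha> f"] by (simp add: Lp_enorm_def I_def q_def)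
    then show ?thesis using p by (simp add: DL_enorm_def Let_def S_def c_def flip: q_def)
  qed
  \<comment> \<open>An infinite sum in \<open>ennreal\<close> is the supremum of its finite partial
    sums, so termwise estimates pass to \<open>S\<close>.\<close>
  have S_SUP: "S f = (SUP F\<in>{F. finite F \<and> F \<subseteq> UNIV}. \<Sum>\<alpha>\<in>F. ennreal (c \<alpha>) * I \<alpha> f)" for f
    unfolding S_def by (rule nonneg_infsum_complete) simp
  have I_le_S: "ennreal (c \<alpha>) * I \<alpha> f \<le> S f" for \<alpha> f
    unfolding S_SUP by (rule SUP_upper2[of "{\<alpha>}"]) auto
  have S_fin: "S f < \<infinity>" if "DL_enorm s p h U f < \<infinity>" for f
    using that unfolding DL enn_powr_def by (cases "S f = \<infinity>") (auto simp: less_top)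
  have sm_diff: "S (f - g) < \<infinity>" if "smooth_on U f" "smooth_on U g" "S f < \<infinity>" "S g < \<infinity>" for f g
  proof -
    have meas: "(\<lambda>x. ennreal (cmod (D_multi \<alpha> f x) powr q)) \<in> borel_measurable (lebesgue_on U)"
      if "smooth_on U f" for \<alpha> f
      using borel_measurable_lebesgue_on_continuous[OF open_U smooth_on_continuous[OF smooth_on_Dw[OF that]]]
      unfolding D_multi_eq_Dw by measurable
    have "I \<alpha> (f - g) \<le> ennreal (2 powr q) * (I \<alpha> f + I \<alpha> g)" for \<alpha>
    proof -
      have "I \<alpha> (f - g) \<le> (\<integral>\<^sup>+x. ennreal (2 powr q) *
          (ennreal (cmod (D_multi \<alpha> f x) powr q) + ennreal (cmod (D_multi \<alpha> g x) powr q)) \<partial>lebesgue_on U)"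
        unfolding I_def
      proof (rule nn_integral_mono)
        fix x assume "x \<in> space (lebesgue_on U)"
        then have "D_multi \<alpha> (f - g) x = D_multi \<alpha> f x - D_multi \<alpha> g x"
          using that by (simp add: D_multi_eq_Dw Dw_diff[OF open_U])
        then show "ennreal (cmod (D_multi \<alpha> (f - g) x) powr q) \<le> ennreal (2 powr q) *
          (ennreal (cmod (D_multi \<alpha> f x) powr q) + ennreal (cmod (D_multi \<alpha> g x) powr q))"
          using powr_diff_le[OF q, of "D_multi \<alpha> f x" "D_multi \<alpha> g x"]
          by (simp add: ennreal_leI flip: ennreal_plus ennreal_mult)
      qed
      also have "\<dots> = ennreal (2 powr q) * (I \<alpha> f + I \<alpha> g)"
        unfolding I_def using meas[OF that(1), of \<alpha>] meas[OF that(2), of \<alpha>]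
        by (simp add: nn_integral_cmult nn_integral_add)
      finally show ?thesis .
    qed
    then have le: "ennreal (c \<alpha>) * I \<alpha> (f - g) \<le>
        ennreal (2 powr q) * (ennreal (c \<alpha>) * I \<alpha> f + ennreal (c \<alpha>) * I \<alpha> g)" for \<alpha>
      using mult_left_mono[of "I \<alpha> (f - g)" "ennreal (2 powr q) * (I \<alpha> f + I \<alpha> g)" "ennreal (c \<alpha>)"]
      by (simp add: algebra_simps)
    have "S (f - g) \<le> ennreal (2 powr q) * (S f + S g)"
      unfolding S_SUP[of "f - g"]
    proof (rule SUP_least)
      fix F :: "('d \<Rightarrow> nat) set" assume F: "F \<in> {F. finite F \<and> F \<subseteq> UNIV}"
      have "(\<Sum>\<alpha>\<in>F. ennreal (c \<alpha>) * I \<alpha> (f - g)) \<le>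
          (\<Sum>\<alpha>\<in>F. ennreal (2 powr q) * (ennreal (c \<alpha>) * I \<alpha> f + ennreal (c \<alpha>) * I \<alpha> g))"
        by (rule sum_mono) (rule le)
      also have "\<dots> = ennreal (2 powr q) * ((\<Sum>\<alpha>\<in>F. ennreal (c \<alpha>) * I \<alpha> f) + (\<Sum>\<alpha>\<in>F. ennreal (c \<alpha>) * I \<alpha> g))"
        by (simp add: sum_distrib_left sum.distrib distrib_left)
      also have "\<dots> \<le> ennreal (2 powr q) * (S f + S g)"
        unfolding S_SUP by (intro mult_left_mono add_mono SUP_upper F) auto
      finally show "(\<Sum>\<alpha>\<in>F. ennreal (c \<alpha>) * I \<alpha> (f - g)) \<le> ennreal (2 powr q) * (S f + S g)" .
    qed
    also have "\<dots> < \<infinity>" using that by (simp add: ennreal_mult_less_top)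
    finally show ?thesis .
  qed
  let ?Vp = "{\<phi>. smooth_on U \<phi> \<and> (\<forall>x. x \<notin> U \<longrightarrow> \<phi> x = 0) \<and> DL_enorm s p h U \<phi> < \<infinity>}"
  have zero: "DL_norm s p h U 0 = 0"
  proof -
    have "I \<alpha> 0 = 0" for \<alpha> using q by (simp add: I_def D_multi_eq_Dw)
    then have "S 0 = 0" by (simp add: S_def)
    then show ?thesis using q by (simp add: DL_norm_def DL enn_powr_def)
  qed
  have top: "topspace (DL s p h U) = ?Vp"
    unfolding DL_def by (rule topspace_norm_topology[where n = "DL_norm s p h U", OF zero])
  have cl: "\<phi> \<in> DL s p h U closure_of Dd" and "\<phi> \<in> topspace (DL s p h U)"
    using \<phi> by (auto simp: DL_Beurling_def)
  then have \<phi>V: "\<phi> \<in> ?Vp" unfolding top by blast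
  have "\<exists>\<psi>\<in>Dd. S (\<psi> - \<phi>) \<le> ennreal (inverse (Suc n))" for n
  proof -
    let ?e = "inverse (real (Suc n))"
    have e: "0 < ?e" "?e \<le> 1" by (auto simp: field_simps)
    let ?B = "{y \<in> ?Vp. DL_norm s p h U (y - \<phi>) < ?e}"
    have "openin (DL s p h U) ?B"
      unfolding DL_def norm_topology_def using \<phi>V e
      by (intro topology_generated_by_Basis CollectI exI[of _ \<phi>] exI[of _ ?e]) auto
    moreover have "\<phi> \<in> ?B" using \<phi>V zero e by simp
    moreover have "\<forall>G. \<phi> \<in> G \<and> openin (DL s p h U) G \<longrightarrow> (\<exists>y. y \<in> Dd \<and> y \<in> G)"
      using cl by (simp add: in_closure_of)
    ultimately have "\<exists>y. y \<in> Dd \<and> y \<in> ?B" by (elim allE[of _ ?B]) simp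
    then obtain \<psi> where \<psi>: "\<psi> \<in> Dd" "\<psi> \<in> ?Vp" "DL_norm s p h U (\<psi> - \<phi>) < ?e" by blast
    \<comment> \<open>\<open>enn2real\<close> maps infinity to 0, so a small \<open>DL_norm\<close>
      is informative only once \<open>S\<close> of the difference is known to be finite.\<close>
    have fin: "S (\<psi> - \<phi>) < \<infinity>" using \<psi>(2) \<phi>V by (intro sm_diff S_fin) auto
    define r where "r = enn2real (S (\<psi> - \<phi>))"
    have r: "S (\<psi> - \<phi>) = ennreal r" "r \<ge> 0" using fin by (auto simp: r_def less_top)
    have "r powr (1 / q) < ?e" using \<psi>(3) r by (simp add: DL_norm_def DL enn_powr_def)
    then have "(r powr (1 / q)) powr q \<le> ?e powr q" using q by (intro powr_mono2) auto
    then have "r \<le> ?e powr q" using r q by (simp add: powr_powr)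
    also have "\<dots> \<le> ?e powr 1" using e q by (intro powr_mono') auto
    finally have "r \<le> ?e" by simp
    then have "S (\<psi> - \<phi>) \<le> ennreal ?e" unfolding r(1) by (rule ennreal_leI)
    then show ?thesis using \<psi>(1) by blast
  qed
  then obtain \<psi> where \<psi>: "\<And>n. \<psi> n \<in> Dd" "\<And>n. S (\<psi> n - \<phi>) \<le> ennreal (inverse (Suc n))" by metis
  show ?thesis
  proof (rule L1_limit_in_W)
    show "smooth_on U \<phi>" using \<phi>V by simp
    show "\<phi> x = 0" if "x \<notin> U" for x using \<phi>V that by simp
    show "\<psi> n \<in> W" for n by (rule Dd_W[OF \<psi>(1)])
    fix \<alpha>
    define m where "m = measure (lebesgue_on U) (space (lebesgue_on U))"
    have m: "emeasure (lebesgue_on U) (space (lebesgue_on U)) = ennreal m" "m \<ge> 0"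
      using finite_measure_U by (auto simp: m_def emeasure_eq_ennreal_measure)
    define t where "t = (\<lambda>n. inverse (real (Suc n)))"
    \<comment> \<open>\<open>le_plus_powr\<close> leaves \<delta> m + \<delta>^(1 - q) t / c. With
      the exponent 1 / (2 q) the two terms become multiples of the powers 1 / (2 q) and (1 + q) / (2
      q) of t, so both tend to 0.\<close>
    define \<delta> where "\<delta> = (\<lambda>n. t n powr (1 / (2 * q)))"
    define b where "b = (\<lambda>n. \<delta> n * m + \<delta> n powr (1 - q) * (t n / c \<alpha>))"
    have t: "t n > 0" for n by (simp add: t_def)
    have \<delta>: "\<delta> n > 0" for n using t[of n] by (simp add: \<delta>_def)
    have smd: "smooth_on U (\<psi> n - \<phi>)" for n
      using smooth_on_diff[OF open_U smooth_on_subset[OF W_smooth[OF Dd_W[OF \<psi>(1)]]]] \<phi>V by simp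
    have "\<delta> n powr (1 - q) * (t n / c \<alpha>) = t n powr ((1 + q) / (2 * q)) / c \<alpha>" for n
    proof -
      have "\<delta> n powr (1 - q) * t n = t n powr ((1 - q) / (2 * q)) * t n powr 1"
        using t[of n] by (simp add: \<delta>_def powr_powr)
      also have "\<dots> = t n powr ((1 - q) / (2 * q) + 1)" by (rule powr_add[symmetric])
      also have "(1 - q) / (2 * q) + 1 = (1 + q) / (2 * q)" using q by (simp add: field_simps)
      finally show ?thesis by simp
    qed
    then have b_eq: "b n = t n powr (1 / (2 * q)) * m + t n powr ((1 + q) / (2 * q)) / c \<alpha>" for n
      by (simp add: b_def \<delta>_def)
    have tlim: "t \<longlonglongrightarrow> 0" unfolding t_def by (rule LIMSEQ_inverse_real_of_nat)
    have pw: "(\<lambda>n. t n powr r) \<longlonglongrightarrow> 0" if "r > 0" for r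
      by (rule tendsto_zero_powrI[OF tlim tendsto_const]) (use t that less_imp_le in \<open>auto intro!: always_eventually\<close>)
    have "b \<longlonglongrightarrow> 0 * m + 0 / c \<alpha>"
      unfolding b_eq[abs_def] using q c[of \<alpha>] by (intro tendsto_intros pw) auto
    then have blim: "(\<lambda>n. ennreal (b n)) \<longlonglongrightarrow> 0"
      using tendsto_ennrealI[of b 0] by simp
    show "(\<lambda>n. \<integral>\<^sup>+x. ennreal (cmod (D_multi \<alpha> (\<psi> n - \<phi>) x)) \<partial>lebesgue_on U) \<longlonglongrightarrow> 0"
    proof (rule tendsto_sandwich[OF _ _ tendsto_const blim]; intro always_eventually allI)
      fix n
      have meas: "(\<lambda>x. ennreal (cmod (D_multi \<alpha> (\<psi> n - \<phi>) x) powr q)) \<in> borel_measurable (lebesgue_on U)"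
        using borel_measurable_lebesgue_on_continuous[OF open_U smooth_on_continuous[OF smooth_on_Dw[OF smd]]]
        unfolding D_multi_eq_Dw by measurable
      have "(\<integral>\<^sup>+x. ennreal (cmod (D_multi \<alpha> (\<psi> n - \<phi>) x)) \<partial>lebesgue_on U)
          \<le> (\<integral>\<^sup>+x. ennreal (\<delta> n) + ennreal (\<delta> n powr (1 - q)) * ennreal (cmod (D_multi \<alpha> (\<psi> n - \<phi>) x) powr q) \<partial>lebesgue_on U)"
        using le_plus_powr[OF norm_ge_zero \<delta>[of n] q] \<delta>[of n]
        by (intro nn_integral_mono) (simp add: ennreal_leI flip: ennreal_plus ennreal_mult)
      also have "\<dots> = ennreal (\<delta> n) * ennreal m + ennreal (\<delta> n powr (1 - q)) * I \<alpha> (\<psi> n - \<phi>)"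
        using meas m(1) by (simp add: nn_integral_add nn_integral_cmult I_def)
      also have "\<dots> \<le> ennreal (\<delta> n * m) + ennreal (\<delta> n powr (1 - q)) * ennreal (t n / c \<alpha>)"
      proof (intro add_mono mult_left_mono)
        have "ennreal (c \<alpha>) * I \<alpha> (\<psi> n - \<phi>) \<le> ennreal (t n)"
          using I_le_S[of \<alpha> "\<psi> n - \<phi>"] \<psi>(2)[of n] unfolding t_def by (rule order_trans)
        also have "ennreal (t n) = ennreal (c \<alpha>) * ennreal (t n / c \<alpha>)"
          using c[of \<alpha>] t[of n] by (simp flip: ennreal_mult)
        finally show "I \<alpha> (\<psi> n - \<phi>) \<le> ennreal (t n / c \<alpha>)"
          using c[of \<alpha>] by (subst (asm) ennreal_mult_le_mult_iff) auto
      qed (use \<delta>[of n] m in \<open>auto simp: ennreal_mult\<close>)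
      also have "\<dots> = ennreal (b n)"
        using \<delta>[of n] m t[of n] c[of \<alpha>] by (simp add: b_def flip: ennreal_mult ennreal_plus)
      finally show "(\<integral>\<^sup>+x. ennreal (cmod (D_multi \<alpha> (\<psi> n - \<phi>) x)) \<partial>lebesgue_on U) \<le> ennreal (b n)" .
    qed simp
  qed
qed

lemma topspace_DL_Beurling_W:
  assumes "h > 0" "p \<ge> 1" "\<phi> \<in> topspace (DL_Beurling s p h U)"
  shows "\<phi> \<in> W"
  using assms topspace_DL_Beurling_finite_W X_W topspace_DL_Beurling by (cases "p = \<infinity>") blast+

end

section \<open>Orthogonal expansions\<close>

lemmas fun_apply_simps = plus_fun_apply zero_fun_apply minus_apply

text \<open>A positive semidefinite form: nonzero vectors of length zero are allowed, and
  \<open>sq\<close> is the square of a seminorm.\<close>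

locale hermitian_form =
  fixes E :: "('x \<Rightarrow> complex) set" and ip :: "('x \<Rightarrow> complex) \<Rightarrow> ('x \<Rightarrow> complex) \<Rightarrow> complex"
  assumes subspace_E: "cfun.subspace E"
    and ip_add: "f \<in> E \<Longrightarrow> g \<in> E \<Longrightarrow> k \<in> E \<Longrightarrow> ip (f + g) k = ip f k + ip g k"
    and ip_scale: "f \<in> E \<Longrightarrow> k \<in> E \<Longrightarrow> ip (cscale c f) k = c * ip f k"
    and ip_cnj: "f \<in> E \<Longrightarrow> g \<in> E \<Longrightarrow> ip g f = cnj (ip f g)"
    and ip_pos: "f \<in> E \<Longrightarrow> 0 \<le> Re (ip f f)"
begin

definition sq :: "('x \<Rightarrow> complex) \<Rightarrow> real" where
  "sq f = Re (ip f f)"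

lemma E_mem: "0 \<in> E" "f \<in> E \<Longrightarrow> g \<in> E \<Longrightarrow> f + g \<in> E" "f \<in> E \<Longrightarrow> g \<in> E \<Longrightarrow> f - g \<in> E"
    "f \<in> E \<Longrightarrow> cscale c f \<in> E" "(\<And>k. k \<in> K \<Longrightarrow> F k \<in> E) \<Longrightarrow> sum F K \<in> E"
  using subspace_E by (auto intro: cfun.subspace_0 cfun.subspace_add cfun.subspace_diff cfun.subspace_scale cfun.subspace_sum)

lemma ip_sum: "(\<And>k. k \<in> K \<Longrightarrow> F k \<in> E) \<Longrightarrow> g \<in> E \<Longrightarrow> ip (sum F K) g = (\<Sum>k\<in>K. ip (F k) g)"
proof (induction K rule: infinite_finite_induct)
  case empty
  then show ?case using ip_scale[OF E_mem(1) empty(2), of 0] by (simp add: cscale_def zero_fun_def)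
next
  case (infinite K)
  then show ?case using ip_scale[OF E_mem(1) infinite(3), of 0] by (simp add: cscale_def zero_fun_def)
next
  case (insert k K)
  then show ?case by (simp add: ip_add E_mem del: fun_apply_simps)
qed

lemma ip_zero: "g \<in> E \<Longrightarrow> ip 0 g = 0"
  using ip_sum[of "{}" "\<lambda>_. 0" g] by simp

lemma sq_zero: "sq 0 = 0"
  unfolding sq_def ip_zero[OF E_mem(1)] by simp

lemma ip_diff: "f \<in> E \<Longrightarrow> g \<in> E \<Longrightarrow> k \<in> E \<Longrightarrow> ip (f - g) k = ip f k - ip g k"
  using ip_add[of "f - g" g k] E_mem(3) by simp

lemma ip_self: "f \<in> E \<Longrightarrow> ip f f = of_real (sq f)"
  using ip_cnj[of f f] unfolding sq_def by (metis Reals_cnj_iff of_real_Re)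

lemma sq_nonneg: "f \<in> E \<Longrightarrow> 0 \<le> sq f"
  by (simp add: sq_def ip_pos)

lemma ip_add_right: "f \<in> E \<Longrightarrow> g \<in> E \<Longrightarrow> k \<in> E \<Longrightarrow> ip k (f + g) = ip k f + ip k g"
  by (subst (1 2 3) ip_cnj) (auto simp: ip_add E_mem)

lemma ip_scale_right: "f \<in> E \<Longrightarrow> k \<in> E \<Longrightarrow> ip k (cscale c f) = cnj c * ip k f"
  by (subst (1 2) ip_cnj) (auto simp: ip_scale E_mem)

lemma ip_sum_right: "(\<And>k. k \<in> K \<Longrightarrow> F k \<in> E) \<Longrightarrow> g \<in> E \<Longrightarrow> ip g (sum F K) = (\<Sum>k\<in>K. ip g (F k))"
proof -
  assume F: "\<And>k. k \<in> K \<Longrightarrow> F k \<in> E" and g: "g \<in> E"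
  have "ip g (sum F K) = cnj (\<Sum>k\<in>K. ip (F k) g)"
    using ip_cnj[of "sum F K" g] ip_sum[of K F g] F g E_mem(5)[of K F] by (simp del: fun_apply_simps)
  also have "\<dots> = (\<Sum>k\<in>K. ip g (F k))" using ip_cnj[OF F g] by (simp add: cnj_sum)
  finally show ?thesis .
qed

lemma sq_scale: "f \<in> E \<Longrightarrow> sq (cscale c f) = (cmod c)\<^sup>2 * sq f"
proof -
  assume f: "f \<in> E"
  have "ip (cscale c f) (cscale c f) = (c * cnj c) * ip f f"
    using f by (simp add: ip_scale ip_scale_right E_mem)
  then have "ip (cscale c f) (cscale c f) = of_real ((cmod c)\<^sup>2 * sq f)"
    unfolding ip_self[OF f] complex_norm_square[symmetric] of_real_mult .
  then show ?thesis unfolding sq_def[of "cscale c f"] by simp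
qed

lemma sq_orthogonal_add: "f \<in> E \<Longrightarrow> g \<in> E \<Longrightarrow> ip f g = 0 \<Longrightarrow> sq (f + g) = sq f + sq g"
  using ip_cnj[of f g] by (simp add: sq_def ip_add ip_add_right E_mem)

text \<open>Parallelogram law with the term for f - g dropped.\<close>

lemma sq_add_le: "f \<in> E \<Longrightarrow> g \<in> E \<Longrightarrow> sq (f + g) \<le> 2 * sq f + 2 * sq g"
proof -
  assume f: "f \<in> E" and g: "g \<in> E"
  have "ip k (f - g) = ip k f - ip k g" if "k \<in> E" for k
    using ip_add_right[of "f - g" g k] E_mem(3)[OF f g] g that by simp
  then have "sq (f + g) + sq (f - g) = 2 * sq f + 2 * sq g"
    using f g by (simp add: sq_def ip_add ip_diff ip_add_right E_mem)
  then show ?thesis using sq_nonneg[OF E_mem(3)[OF f g]] by simp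
qed

text \<open>Gram-Schmidt. A residual of length zero is replaced by the zero vector, so dependent
  input keeps its index and no division by zero arises.\<close>

fun gs :: "(nat \<Rightarrow> 'x \<Rightarrow> complex) \<Rightarrow> nat \<Rightarrow> 'x \<Rightarrow> complex" where
  "gs g n = (let r = g n - (\<Sum>k<n. cscale (ip (g n) (gs g k)) (gs g k))
     in if sq r = 0 then 0 else cscale (of_real (1 / sqrt (sq r))) r)"

declare gs.simps [simp del]

definition res :: "(nat \<Rightarrow> 'x \<Rightarrow> complex) \<Rightarrow> nat \<Rightarrow> 'x \<Rightarrow> complex" where
  "res g n = g n - (\<Sum>k<n. cscale (ip (g n) (gs g k)) (gs g k))"

lemma gs_eq: "gs g n = (if sq (res g n) = 0 then 0 else cscale (of_real (1 / sqrt (sq (res g n)))) (res g n))"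
  by (subst gs.simps) (simp add: res_def Let_def)

context
  fixes g :: "nat \<Rightarrow> 'x \<Rightarrow> complex"
  assumes g: "\<And>n. g n \<in> E"
begin

lemma gs_mem: "gs g n \<in> E"
proof (induction n rule: less_induct)
  case (less n)
  then have "res g n \<in> E" unfolding res_def by (intro E_mem g) auto
  then show ?case unfolding gs_eq by (auto intro: E_mem)
qed

lemma res_mem: "res g n \<in> E"
  unfolding res_def by (intro E_mem g gs_mem)

lemma gs_sq: "sq (gs g n) = 0 \<and> gs g n = 0 \<or> sq (gs g n) = 1"
proof (cases "sq (res g n) = 0")
  case True
  then show ?thesis using sq_zero by (simp add: gs_eq)
next
  case False
  then have "sq (res g n) > 0" using sq_nonneg[OF res_mem[of n]] by simp
  then show ?thesis using False sq_scale[OF res_mem[of n]]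
    by (simp add: gs_eq norm_divide power_divide)
qed

lemma gs_orthogonal_less: "m < n \<Longrightarrow> ip (gs g n) (gs g m) = 0"
proof (induction n arbitrary: m rule: less_induct)
  case (less n)
  have orth: "ip (gs g k) (gs g m) = 0" if "k < n" "k \<noteq> m" for k
  proof (cases "m < k")
    case True
    then show ?thesis using less.IH that by blast
  next
    case False
    then have "ip (gs g m) (gs g k) = 0" using less.IH[OF less.prems] that by simp
    then show ?thesis using ip_cnj[OF gs_mem gs_mem, of m k] by simp
  qed
  have "ip (res g n) (gs g m) = ip (g n) (gs g m) - (\<Sum>k<n. ip (g n) (gs g k) * ip (gs g k) (gs g m))"
    unfolding res_def by (simp add: ip_diff g gs_mem E_mem ip_sum ip_scale)
  also have "(\<Sum>k<n. ip (g n) (gs g k) * ip (gs g k) (gs g m)) =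
      (\<Sum>k<n. if k = m then ip (g n) (gs g m) * ip (gs g m) (gs g m) else 0)"
    using orth by (intro sum.cong) auto
  also have "\<dots> = ip (g n) (gs g m) * of_real (sq (gs g m))"
    using less.prems ip_self[OF gs_mem, of m] by simp
  \<comment> \<open>Either \<open>gs g m\<close> has length one, or it is the zero vector and both
    sides vanish.\<close>
  also have "\<dots> = ip (g n) (gs g m)"
    using gs_sq[of m] ip_scale_right[OF E_mem(1) g, of n 0] by (auto simp: cscale_def zero_fun_def)
  finally have "ip (res g n) (gs g m) = 0" by simp
  then show ?case by (simp add: gs_eq[of g n] ip_zero gs_mem ip_scale res_mem)
qed

lemma gs_orthogonal: "m \<noteq> n \<Longrightarrow> ip (gs g n) (gs g m) = 0"
  using gs_orthogonal_less[of m n] gs_orthogonal_less[of n m] ip_cnj[OF gs_mem gs_mem, of m n]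
  by (cases "m < n") auto

lemma sq_gs_sum: "sq (\<Sum>k<M. cscale (c k) (gs g k)) = (\<Sum>k<M. (cmod (c k))\<^sup>2 * sq (gs g k))"
proof (induction M)
  case 0
  show ?case by (simp add: sq_zero flip: zero_fun_def)
next
  case (Suc M)
  have "ip (\<Sum>k<M. cscale (c k) (gs g k)) (cscale (c M) (gs g M)) = 0"
    by (simp add: ip_sum ip_scale ip_scale_right E_mem gs_mem gs_orthogonal)
  then have "sq ((\<Sum>k<M. cscale (c k) (gs g k)) + cscale (c M) (gs g M)) =
      sq (\<Sum>k<M. cscale (c k) (gs g k)) + sq (cscale (c M) (gs g M))"
    by (intro sq_orthogonal_add E_mem gs_mem)
  then show ?case by (simp add: Suc sq_scale gs_mem del: fun_apply_simps)
qed

definition proj :: "nat \<Rightarrow> ('x \<Rightarrow> complex) \<Rightarrow> 'x \<Rightarrow> complex" where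
  "proj M f = (\<Sum>k<M. cscale (ip f (gs g k)) (gs g k))"

lemma proj_mem: "proj M f \<in> E"
  unfolding proj_def by (intro E_mem gs_mem)

lemma proj_residual_orthogonal:
  assumes f: "f \<in> E" and m: "m < M"
  shows "ip (f - proj M f) (gs g m) = 0"
proof -
  have "ip (f - proj M f) (gs g m) = ip f (gs g m) - (\<Sum>k<M. ip f (gs g k) * ip (gs g k) (gs g m))"
    unfolding proj_def by (simp add: ip_diff f gs_mem E_mem ip_sum ip_scale)
  also have "(\<Sum>k<M. ip f (gs g k) * ip (gs g k) (gs g m)) =
      (\<Sum>k<M. if k = m then ip f (gs g m) * ip (gs g m) (gs g m) else 0)"
    using gs_orthogonal by (intro sum.cong) auto
  also have "\<dots> = ip f (gs g m) * of_real (sq (gs g m))"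
    using m ip_self[OF gs_mem, of m] by simp
  also have "\<dots> = ip f (gs g m)"
    using gs_sq[of m] ip_scale_right[OF E_mem(1) f, of 0] by (auto simp: cscale_def zero_fun_def)
  finally show ?thesis by (simp del: fun_apply_simps)
qed

text \<open>Pythagoras: the residual is orthogonal to v, the difference between the projection and
  the competitor.\<close>

lemma proj_best:
  assumes f: "f \<in> E"
  shows "sq (f - proj M f) \<le> sq (f - (\<Sum>k<M. cscale (c k) (gs g k)))"
proof -
  define v where "v = (\<Sum>k<M. cscale (ip f (gs g k) - c k) (gs g k))"
  have v: "v \<in> E" unfolding v_def by (intro E_mem gs_mem)
  have "ip (f - proj M f) v = 0"
    unfolding v_def using proj_residual_orthogonal[OF f]
    by (simp add: ip_sum_right ip_scale_right E_mem gs_mem f proj_mem)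
  then have "sq ((f - proj M f) + v) = sq (f - proj M f) + sq v"
    by (intro sq_orthogonal_add E_mem f proj_mem v)
  moreover have "(f - proj M f) + v = f - (\<Sum>k<M. cscale (c k) (gs g k))"
    by (simp add: v_def proj_def cfun.scale_left_diff_distrib sum_subtractf)
  ultimately show ?thesis using sq_nonneg[OF v] by simp
qed

text \<open>Solves the recursion for \<open>g n\<close>: the coefficient of \<open>gs g n\<close> is
  the length of the residual, and continuing by zero lets one choice serve all M > n. Equality holds
  up to length zero, since \<open>gs\<close> discards a degenerate residual.\<close>

lemma gs_spans: "\<exists>c. \<forall>M>n. sq (g n - (\<Sum>k<M. cscale (c k) (gs g k))) = 0"
proof -
  define c where "c = (\<lambda>k. if k < n then ip (g n) (gs g k) else if k = n then of_real (sqrt (sq (res g n))) else 0)"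
  have "sq (g n - (\<Sum>k<M. cscale (c k) (gs g k))) = 0" if M: "M > n" for M
  proof -
    have "(\<Sum>k<M. cscale (c k) (gs g k)) = (\<Sum>k<Suc n. cscale (c k) (gs g k))"
      using M by (intro sum.mono_neutral_right) (auto simp: c_def cscale_def fun_eq_iff)
    also have "\<dots> = (\<Sum>k<n. cscale (ip (g n) (gs g k)) (gs g k)) + cscale (of_real (sqrt (sq (res g n)))) (gs g n)"
      by (simp add: c_def)
    finally have "g n - (\<Sum>k<M. cscale (c k) (gs g k)) = res g n - cscale (of_real (sqrt (sq (res g n)))) (gs g n)"
      by (simp add: res_def)
    moreover have "sq (res g n - cscale (of_real (sqrt (sq (res g n)))) (gs g n)) = 0"
    proof (cases "sq (res g n) = 0")
      case True
      moreover have "cscale (of_real (sqrt 0)) (gs g n) = 0" by (simp add: cscale_def fun_eq_iff)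
      ultimately show ?thesis by (simp del: fun_apply_simps)
    next
      case False
      then have "res g n - cscale (of_real (sqrt (sq (res g n)))) (gs g n) = 0"
        using sq_nonneg[OF res_mem[of n]] by (simp add: gs_eq cscale_def fun_eq_iff)
      then show ?thesis using sq_zero by (simp only:)
    qed
    ultimately show ?thesis by (simp only:)
  qed
  then show ?thesis by blast
qed

text \<open>Some \<open>g n\<close> is close to f. Once M exceeds n, the first M vectors reproduce
  \<open>g n\<close> up to length zero, so best approximation gives smallness for all these M at
  once.\<close>

lemma proj_converges:
  assumes f: "f \<in> E" and dense: "\<And>\<epsilon>. \<epsilon> > 0 \<Longrightarrow> \<exists>n. sq (f - g n) < \<epsilon>"
  shows "(\<lambda>M. sq (f - proj M f)) \<longlonglongrightarrow> 0"
proof (rule LIMSEQ_I)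
  fix e :: real assume e: "e > 0"
  obtain n where n: "sq (f - g n) < e / 2" using dense[of "e / 2"] e by auto
  obtain c where c: "\<And>M. M > n \<Longrightarrow> sq (g n - (\<Sum>k<M. cscale (c k) (gs g k))) = 0"
    using gs_spans[of n] by blast
  have "sq (f - proj M f) < e" if "M > n" for M
  proof -
    let ?v = "\<Sum>k<M. cscale (c k) (gs g k)"
    have v: "?v \<in> E" by (intro E_mem gs_mem)
    have "sq (f - proj M f) \<le> sq (f - ?v)" by (rule proj_best[OF f])
    also have "f - ?v = (f - g n) + (g n - ?v)" by simp
    also have "sq \<dots> \<le> 2 * sq (f - g n) + 2 * sq (g n - ?v)"
      by (intro sq_add_le E_mem(3) f g v)
    finally show ?thesis using n c[OF that] by linarith
  qed
  then show "\<exists>K. \<forall>M\<ge>K. norm (sq (f - proj M f) - 0) < e"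
    using sq_nonneg[OF E_mem(3)[OF f proj_mem]] by (intro exI[of _ "Suc n"]) auto
qed

text \<open>Bessel's inequality for the vector representing l, phrased through l itself: at the sum
  of the vectors \<open>gs g k\<close> with coefficients \<open>cnj (l (gs g k))\<close> the value
  of l is S, and the bound on l turns this into S^2 \<le> K S.\<close>

lemma bessel_functional:
  assumes add: "\<And>f g. f \<in> E \<Longrightarrow> g \<in> E \<Longrightarrow> l (f + g) = l f + l g"
    and scale: "\<And>c f. f \<in> E \<Longrightarrow> l (cscale c f) = c * l f"
    and bd: "\<And>f. f \<in> E \<Longrightarrow> (cmod (l f))\<^sup>2 \<le> K * sq f" and K: "K \<ge> 0"
  shows "(\<Sum>k<M. (cmod (l (gs g k)))\<^sup>2) \<le> K"
proof -
  define S where "S = (\<Sum>k<M. (cmod (l (gs g k)))\<^sup>2)"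
  define f where "f = (\<Sum>k<M. cscale (cnj (l (gs g k))) (gs g k))"
  have S0: "S \<ge> 0" unfolding S_def by (intro sum_nonneg) auto
  have "l (\<Sum>k<n. cscale (cnj (l (gs g k))) (gs g k)) = of_real (\<Sum>k<n. (cmod (l (gs g k)))\<^sup>2)" for n
  proof (induction n)
    case 0
    then show ?case using scale[OF E_mem(1), of 0] by (simp add: cscale_def zero_fun_def)
  next
    case (Suc n)
    then show ?case
      by (simp add: add scale E_mem gs_mem complex_norm_square[symmetric] mult.commute del: of_real_power fun_apply_simps)
  qed
  then have lf: "l f = of_real S" by (simp add: f_def S_def)
  have fE: "f \<in> E" unfolding f_def by (intro E_mem gs_mem)
  have "sq f = (\<Sum>k<M. (cmod (l (gs g k)))\<^sup>2 * sq (gs g k))" unfolding f_def sq_gs_sum by simp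
  also have "\<dots> \<le> (\<Sum>k<M. (cmod (l (gs g k)))\<^sup>2 * 1)"
    using gs_sq by (intro sum_mono mult_left_mono) (auto, metis order.refl zero_le_one)
  finally have "sq f \<le> S" by (simp add: S_def)
  then have "S\<^sup>2 \<le> K * S" using bd[OF fE] K lf mult_left_mono[of "sq f" S K] by simp
  then show ?thesis
    unfolding S_def[symmetric] using S0 K by (cases "S = 0") (auto simp: power2_eq_square)
qed

end

end

text \<open>Cauchy-Schwarz against the constant 1, read off from the integral of ((m + 1) f - I)^2
  \<ge> 0. The factor m + 1 in place of m keeps the divisor positive.\<close>

lemma (in finite_measure) integral_square_le:
  fixes f :: "'a \<Rightarrow> real"
  assumes "integrable M f" "integrable M (\<lambda>x. (f x)\<^sup>2)"
  shows "(integral\<^sup>L M f)\<^sup>2 \<le> (measure M (space M) + 1) * integral\<^sup>L M (\<lambda>x. (f x)\<^sup>2)"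
proof -
  define m where "m = measure M (space M)"
  define I where "I = integral\<^sup>L M f"
  define Q where "Q = integral\<^sup>L M (\<lambda>x. (f x)\<^sup>2)"
  have m: "m \<ge> 0" by (simp add: m_def)
  have "0 \<le> integral\<^sup>L M (\<lambda>x. ((m + 1) * f x - I)\<^sup>2)" by simp
  also have "(\<lambda>x. ((m + 1) * f x - I)\<^sup>2) = (\<lambda>x. (m + 1)\<^sup>2 * (f x)\<^sup>2 - 2 * (m + 1) * I * f x + I\<^sup>2)"
    by (auto simp: power2_eq_square algebra_simps)
  also have "integral\<^sup>L M \<dots> = (m + 1)\<^sup>2 * Q - 2 * (m + 1) * I * I + I\<^sup>2 * m"
    using assms by (simp add: Q_def I_def m_def mult.commute)
  finally have "2 * (m + 1) * I\<^sup>2 - I\<^sup>2 * m \<le> (m + 1)\<^sup>2 * Q"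
    by (simp add: power2_eq_square mult.assoc)
  moreover have "(m + 1) * I\<^sup>2 \<le> 2 * (m + 1) * I\<^sup>2 - I\<^sup>2 * m"
    by (simp add: algebra_simps)
  ultimately have "(m + 1) * I\<^sup>2 \<le> (m + 1) * ((m + 1) * Q)"
    by (simp add: power2_eq_square mult.assoc)
  moreover have "m + 1 > 0" using m by simp
  ultimately have "I\<^sup>2 \<le> (m + 1) * Q" by (simp only: mult_le_cancel_left_pos)
  then show ?thesis by (simp add: I_def Q_def m_def)
qed

text \<open>Raising \<alpha>_j by one multiplies \<alpha>!^s by (\<alpha>_j + 1)^s; this polynomial
  growth is to be absorbed into one factor 2 of the parameter h.\<close>

lemma shift_factor_bounded:
  fixes s :: real
  obtains K where "K > 0" "\<And>a :: nat. (real a + 1) powr s \<le> K * 2 ^ a"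
proof -
  have "(\<lambda>a :: nat. (real a + 1) powr s / 2 ^ a) \<longlonglongrightarrow> 0"
    by real_asymp
  then have "Bseq (\<lambda>a :: nat. (real a + 1) powr s / 2 ^ a)"
    using convergent_imp_Bseq convergent_def by blast
  then obtain K where K: "K > 0" "\<And>a :: nat. norm ((real a + 1) powr s / 2 ^ a) \<le> K"
    by (auto simp: Bseq_def)
  have "(real a + 1) powr s \<le> K * 2 ^ a" for a :: nat
    using K(2)[of a] by (simp add: field_simps)
  then show ?thesis using that K(1) by blast
qed

context ultra
begin

section \<open>Nuclearity\<close>

text \<open>
  Integrating over a probability distribution on the multi-indices instead of summing over them makes
  the measure finite, so that the bounded functions \<open>j \<mapsto> A h j f\<close> are square integrable.
\<close>

definition Q :: "('d \<Rightarrow> nat) pmf" where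
  "Q = Pi_pmf UNIV 0 (\<lambda>_. geometric_pmf (1 / 2))"

definition M :: "(('d \<Rightarrow> nat) \<times> 'd pt) measure" where
  "M = measure_pmf Q \<Otimes>\<^sub>M lebesgue_on U"

text \<open>The mass decays no faster than exponentially in |\<alpha>|, so dividing by it amounts to
  another factor 2 in the parameter h.\<close>

lemma pmf_Q: "pmf Q \<alpha> = (1 / 2) ^ (mi_abs \<alpha> + CARD('d))"
proof -
  have "pmf Q \<alpha> = (\<Prod>j\<in>UNIV. (1 / 2) ^ \<alpha> j * (1 / 2))"
    unfolding Q_def by (subst pmf_Pi') auto
  then show ?thesis by (simp add: prod_dividef prod.distrib mi_abs_def power_add power_sum power_one_over)
qed

lemma finite_measure_lebesgue_on_U: "finite_measure (lebesgue_on U)"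
  using finite_measure_U by (intro finite_measureI) auto

sublocale M: finite_measure M
  unfolding M_def
  by (rule finite_measure_pair_measure[OF finite_measure_lebesgue_on_U])
    (rule prob_space.finite_measure, rule prob_space_measure_pmf)

text \<open>The first variable is discrete and ranges over a countable set, so measurability is
  checked slice by slice, where continuity gives it.\<close>

lemma A_measurable:
  assumes "f \<in> W"
  shows "(\<lambda>j. A h j f) \<in> borel_measurable M"
proof -
  have "(\<lambda>x. A h (\<alpha>, x) f) \<in> borel_measurable (lebesgue_on U)" for \<alpha>
  proof (rule borel_measurable_lebesgue_on_continuous[OF open_U])
    have "continuous_on U (D_multi \<alpha> f)"
      unfolding D_multi_eq_Dw
      by (rule smooth_on_continuous[OF smooth_on_subset[OF smooth_on_Dw[OF W_smooth[OF assms]] subset_UNIV]])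
    then show "continuous_on U (\<lambda>x. A h (\<alpha>, x) f)"
      unfolding A_def fst_conv snd_conv by (intro continuous_intros)
  qed
  then have "(\<lambda>j. A h j f) \<in> borel_measurable (count_space UNIV \<Otimes>\<^sub>M lebesgue_on U)"
    by (intro measurable_pair_measure_countable1) auto
  moreover have sets: "sets M = sets (count_space UNIV \<Otimes>\<^sub>M lebesgue_on U)"
    unfolding M_def by (rule sets_pair_measure_cong) auto
  ultimately show ?thesis by (subst measurable_cong_sets[OF sets refl])
qed

lemma A_bound:
  assumes "h > 0" "f \<in> W" "f \<in> V h"
  shows "cmod (A h j f) \<le> N h f"
  using W_N_upper[OF assms, of "fst j" "snd j"] by simp

lemma integrable_norm_A:
  assumes "h > 0" "f \<in> W" "f \<in> V h"
  shows "integrable M (\<lambda>j. cmod (A h j f))"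
  using A_measurable[OF assms(2)] A_bound[OF assms] by (intro M.integrable_const_bound[of _ "N h f"]) auto

lemma integrable_norm_A2:
  assumes "h > 0" "f \<in> W" "f \<in> V h"
  shows "integrable M (\<lambda>j. (cmod (A h j f))\<^sup>2)"
  using A_measurable[OF assms(2)] power_mono[OF A_bound[OF assms] norm_ge_zero, where n = 2]
  by (intro M.integrable_const_bound[of _ "(N h f)\<^sup>2"]) auto

lemma integrable_A_cnj_A:
  assumes h: "h > 0" and f: "f \<in> W" "f \<in> V h" and g: "g \<in> W" "g \<in> V h"
  shows "integrable M (\<lambda>j. A h j f * cnj (A h j g))"
proof (rule M.integrable_const_bound[of _ "N h f * N h g"])
  show "AE j in M. cmod (A h j f * cnj (A h j g)) \<le> N h f * N h g"
    using A_bound[OF h f] A_bound[OF h g] by (intro AE_I2) (simp add: norm_mult mult_mono N_nonneg)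
  show "(\<lambda>j. A h j f * cnj (A h j g)) \<in> borel_measurable M"
    using A_measurable[OF f(1)] A_measurable[OF g(1)]
    by (intro borel_measurable_times measurable_compose[OF _ borel_measurable_continuous_onI[of cnj]])
      (auto intro: continuous_intros)
qed

lemma mi_abs_Suc: "mi_abs (\<lambda>j. Suc (\<alpha> j)) = mi_abs \<alpha> + CARD('d)" for \<alpha> :: "'d \<Rightarrow> nat"
  by (simp add: mi_abs_def sum.distrib sum_Suc)

lemma mi_fact_Suc: "mi_fact (\<lambda>j. Suc (\<alpha> j)) = (\<Prod>j\<in>UNIV. real (\<alpha> j) + 1) * mi_fact \<alpha>" for \<alpha> :: "'d \<Rightarrow> nat"
  by (simp add: mi_fact_def prod.distrib add.commute)

text \<open>Of the factor 4^|\<alpha>| gained by passing to 4 h, one 2^|\<alpha>| pays for the point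
  mass of \<open>Q\<close> and the other for the shift of the factorials in the Sobolev
  bound.\<close>

lemma pietsch:
  assumes h: "h > 0"
  obtains C where "C > 0"
    "\<And>f. f \<in> W \<Longrightarrow> f \<in> V (4 * h) \<Longrightarrow> N h f \<le> C * (\<integral>j. cmod (A (4 * h) j f) \<partial>M)"
proof -
  let ?d = "CARD('d)"
  have h4: "4 * h > 0" using h by simp
  obtain K where K: "K > 0" "\<And>a :: nat. (real a + 1) powr s \<le> K * 2 ^ a"
    by (rule shift_factor_bounded[where s = s]) (rule that)
  \<comment> \<open>K^d collects the shift bounds of the d coordinates, and h^(-d) undoes the
    surplus in h^|\<beta>| = h^(|\<alpha>| + d). The remaining constants, 4^d from the parameter and
    2^(-2 d) from the point mass, cancel.\<close>
  define C where "C = (K / h) ^ ?d"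
  have C: "C > 0" using K h by (simp add: C_def)
  have "N h f \<le> C * (\<integral>j. cmod (A (4 * h) j f) \<partial>M)" if f: "f \<in> W" "f \<in> V (4 * h)" for f
  proof (rule N_least[OF h])
    define J where "J = (\<integral>j. cmod (A (4 * h) j f) \<partial>M)"
    have J0: "J \<ge> 0" by (simp add: J_def)
    show "f \<in> V h" using V_mono[of h "4 * h" f] h f by simp
    show "0 \<le> C * (\<integral>j. cmod (A (4 * h) j f) \<partial>M)" using C by simp
    fix \<alpha> :: "'d \<Rightarrow> nat" and x
    define \<beta> where "\<beta> = (\<lambda>j. Suc (\<alpha> j))"
    define w where "w = pmf Q \<beta> * wt (4 * h) \<beta>"
    have w: "w > 0" using wt_pos[OF h4, of \<beta>] by (simp add: w_def pmf_Q)
    have "ennreal w * ennreal (cmod (D_multi \<alpha> f x)) \<le>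
        ennreal w * (\<integral>\<^sup>+y. ennreal (cmod (D_multi \<beta> f y)) \<partial>lebesgue_on U)"
      unfolding \<beta>_def by (intro mult_left_mono W_sobolev[OF f(1)]) auto
    also have "\<dots> = ennreal (pmf Q \<beta>) * (\<integral>\<^sup>+y. ennreal (cmod (A (4 * h) (\<beta>, y) f)) \<partial>lebesgue_on U)"
    proof -
      have "(\<lambda>y. ennreal (cmod (D_multi \<beta> f y))) \<in> borel_measurable (lebesgue_on U)"
        using borel_measurable_lebesgue_on_continuous[OF open_U smooth_on_continuous[OF smooth_on_subset[OF
              smooth_on_Dw[OF W_smooth[OF f(1)]] subset_UNIV]]]
        unfolding D_multi_eq_Dw by measurable
      then show ?thesis
        using wt_pos[OF h4, of \<beta>] by (simp add: w_def norm_A[OF h4] ennreal_mult nn_integral_cmult mult.assoc)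
    qed
    \<comment> \<open>Written as the contribution of the single atom \<beta>, which the integral
      over all multi-indices dominates.\<close>
    also have "\<dots> = (\<integral>\<^sup>+\<gamma>. (\<integral>\<^sup>+y. ennreal (cmod (A (4 * h) (\<beta>, y) f)) \<partial>lebesgue_on U) * indicator {\<beta>} \<gamma> \<partial>measure_pmf Q)"
      by (subst nn_integral_cmult_indicator) (simp_all add: emeasure_pmf_single mult.commute)
    also have "\<dots> \<le> (\<integral>\<^sup>+\<gamma>. (\<integral>\<^sup>+y. ennreal (cmod (A (4 * h) (\<gamma>, y) f)) \<partial>lebesgue_on U) \<partial>measure_pmf Q)"
      by (intro nn_integral_mono) (auto simp: indicator_def)
    also have "\<dots> = (\<integral>\<^sup>+j. ennreal (cmod (A (4 * h) j f)) \<partial>M)"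
    proof -
      interpret U: finite_measure "lebesgue_on U" by (rule finite_measure_lebesgue_on_U)
      have "(\<lambda>j. ennreal (cmod (A (4 * h) j f))) \<in> borel_measurable M"
        using A_measurable[OF f(1)] by measurable
      then show ?thesis unfolding M_def by (rule U.nn_integral_fst)
    qed
    also have "\<dots> = ennreal J"
      unfolding J_def by (rule nn_integral_eq_integral[OF integrable_norm_A[OF h4 f]]) auto
    finally have le: "w * cmod (D_multi \<alpha> f x) \<le> J"
      using w J0 by (simp flip: ennreal_mult add: ennreal_le_iff)
    have wt_le: "wt h \<alpha> \<le> C * w"
    proof -
      have "(\<Prod>j\<in>UNIV. real (\<alpha> j) + 1) powr s = (\<Prod>j\<in>UNIV. (real (\<alpha> j) + 1) powr s)"
        by (rule prod_powr_distrib)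
      also have "\<dots> \<le> (\<Prod>j\<in>UNIV. K * 2 ^ \<alpha> j)"
        using K(2) by (intro prod_mono) auto
      also have "\<dots> = K ^ ?d * 2 ^ mi_abs \<alpha>"
        by (simp add: prod.distrib mi_abs_def power_sum)
      finally have prod_le: "(\<Prod>j\<in>UNIV. real (\<alpha> j) + 1) powr s \<le> K ^ ?d * 2 ^ mi_abs \<alpha>" .
      define P where "P = (\<Prod>j\<in>UNIV. real (\<alpha> j) + 1) powr s"
      have "(\<Prod>j\<in>UNIV. real (\<alpha> j) + 1) > 0" by (intro prod_pos) auto
      then have P: "P > 0" by (simp add: P_def)
      have F: "mi_fact \<alpha> powr s > 0" using mi_fact_pos[of \<alpha>] by simp
      have fact\<beta>: "mi_fact \<beta> powr s = P * mi_fact \<alpha> powr s"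
        unfolding \<beta>_def mi_fact_Suc P_def by (rule powr_mult)
      have abs\<beta>: "mi_abs \<beta> = mi_abs \<alpha> + ?d" unfolding \<beta>_def by (rule mi_abs_Suc)
      have "C * w = (K / h) ^ ?d * ((1 / 2) ^ (mi_abs \<alpha> + ?d + ?d) * ((4 * h) ^ (mi_abs \<alpha> + ?d) / (P * mi_fact \<alpha> powr s)))"
        by (simp add: C_def w_def wt_def pmf_Q abs\<beta> fact\<beta>)
      also have "\<dots> = (K ^ ?d * 2 ^ mi_abs \<alpha> / P) * wt h \<alpha>"
      proof -
        have "(4::real) ^ n = 2 ^ n * 2 ^ n" for n by (simp flip: power_mult_distrib)
        then show ?thesis
          using h P F by (simp add: wt_def power_add power_mult_distrib power_divide field_simps)
      qed
      finally have eq: "C * w = (K ^ ?d * 2 ^ mi_abs \<alpha> / P) * wt h \<alpha>" .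
      have "1 \<le> K ^ ?d * 2 ^ mi_abs \<alpha> / P" using prod_le P by (simp add: P_def[symmetric])
      then have "1 * wt h \<alpha> \<le> (K ^ ?d * 2 ^ mi_abs \<alpha> / P) * wt h \<alpha>"
        using wt_pos[OF h, of \<alpha>] by (intro mult_right_mono) auto
      then show ?thesis unfolding eq by simp
    qed
    have "cmod (A h (\<alpha>, x) f) \<le> C * w * cmod (D_multi \<alpha> f x)"
      unfolding norm_A[OF h] by (rule mult_right_mono[OF wt_le norm_ge_zero])
    also have "\<dots> \<le> C * J" using mult_left_mono[OF le less_imp_le[OF C]] by (simp add: mult.assoc)
    finally show "cmod (A h (\<alpha>, x) f) \<le> C * (\<integral>j. cmod (A (4 * h) j f) \<partial>M)" by (simp add: J_def)
  qed
  then show ?thesis using that C by blast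
qed

definition ip :: "real \<Rightarrow> ('d pt \<Rightarrow> complex) \<Rightarrow> ('d pt \<Rightarrow> complex) \<Rightarrow> complex" where
  "ip h f g = (\<integral>j. A h j f * cnj (A h j g) \<partial>M)"

lemma B_W: "f \<in> B \<Longrightarrow> f \<in> W"
  using X_W[OF zero_less_one B_X] by simp

lemma B_V: "f \<in> B \<Longrightarrow> h > 0 \<Longrightarrow> f \<in> V h"
  using X_V[OF B_X] by simp

lemma A_add_W: "f \<in> W \<Longrightarrow> g \<in> W \<Longrightarrow> A h j (f + g) = A h j f + A h j g"
  using A_add[OF open_UNIV W_smooth W_smooth, of f g "snd j" h "fst j"] by simp

lemma A_scale_W: "f \<in> W \<Longrightarrow> A h j (cscale c f) = c * A h j f"
  using A_scale[OF open_UNIV W_smooth, of f "snd j" h "fst j"] by simp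

lemma ip_self_eq: "ip h f f = of_real (\<integral>j. (cmod (A h j f))\<^sup>2 \<partial>M)"
  unfolding ip_def by (simp add: complex_norm_square[symmetric] integral_complex_of_real del: of_real_power)

lemma hermitian_form_ip:
  assumes h: "h > 0"
  shows "hermitian_form B (ip h)"
proof
  interpret sn_space B "{0<..}" N by (rule sn_space_B)
  show "cfun.subspace B" by (rule subspace)
  fix f g k c assume f: "f \<in> B" and k: "k \<in> B"
  note int = integrable_A_cnj_A[OF h B_W B_V[OF _ h] B_W B_V[OF _ h]]
  show "ip h (cscale c f) k = c * ip h f k"
    by (simp add: ip_def A_scale_W[OF B_W[OF f]] mult.assoc)
  show "0 \<le> Re (ip h f f)" by (simp add: ip_self_eq)
  assume g: "g \<in> B"
  show "ip h (f + g) k = ip h f k + ip h g k"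
    using int[OF f f k k] int[OF g g k k]
    by (simp add: ip_def A_add_W[OF B_W[OF f] B_W[OF g]] distrib_right)
  show "ip h g f = cnj (ip h f g)"
  proof -
    have "cnj (ip h f g) = (\<integral>j. cnj (A h j f * cnj (A h j g)) \<partial>M)"
      unfolding ip_def by (rule Bochner_Integration.integral_cnj[symmetric])
    also have "\<dots> = ip h g f"
      unfolding ip_def by (intro Bochner_Integration.integral_cong) (simp_all add: mult.commute)
    finally show ?thesis by (rule sym)
  qed
qed

text \<open>Each ball of \<open>N (2 * h)\<close> of radius m has finite nets for \<open>N h\<close>
  of mesh 1 / (k + 1); their union over all m and k is countable and dense.\<close>

lemma B_separable:
  assumes h: "h > 0"
  shows "\<exists>g :: nat \<Rightarrow> 'd pt \<Rightarrow> complex. (\<forall>n. g n \<in> B) \<and> (\<forall>f\<in>B. \<forall>\<epsilon>>0. \<exists>n. N h (f - g n) < \<epsilon>)"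
proof -
  interpret sn_space B "{0<..}" N by (rule sn_space_B)
  define P where "P = (\<lambda>(m :: nat) (k :: nat) F. finite F \<and> F \<subseteq> B \<and>
      (\<forall>f\<in>B. N (2 * h) f \<le> real m \<longrightarrow> (\<exists>g\<in>F. N h (f - g) < inverse (Suc k))))"
  have "\<exists>F. P m k F" for m k
  proof -
    obtain F where "finite F" "F \<subseteq> {f \<in> B. N (2 * h) f \<le> real m}"
      "\<And>f. f \<in> {f \<in> B. N (2 * h) f \<le> real m} \<Longrightarrow> \<exists>g\<in>F. N h (f - g) < inverse (Suc k)"
      by (rule totally_bounded_in_B[of h "2 * h" "{f \<in> B. N (2 * h) f \<le> real m}" "real m" "inverse (Suc k)"])
        (use h in auto)
    then have "P m k F" unfolding P_def by blast
    then show ?thesis by blast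
  qed
  then have "\<exists>F. \<forall>k. P m k (F k)" for m by (intro choice) blast
  then have "\<exists>F. \<forall>m. \<forall>k. P m k (F m k)" by (intro choice) blast
  then obtain F where "\<forall>m k. P m k (F m k)" ..
  then have F: "finite (F m k)" "F m k \<subseteq> B"
    "f \<in> B \<Longrightarrow> N (2 * h) f \<le> real m \<Longrightarrow> \<exists>g\<in>F m k. N h (f - g) < inverse (Suc k)" for m k f
    unfolding P_def by blast+
  \<comment> \<open>The element 0 makes S nonempty, as \<open>from_nat_into\<close>
    requires.\<close>
  define S where "S = insert 0 (\<Union>m k. F m k)"
  have S: "countable S" "S \<noteq> {}"
    unfolding S_def by (intro countable_insert countable_UN countableI_type countable_finite F(1)) simp
  have SB: "S \<subseteq> B" unfolding S_def using F(2) zero_mem by blast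
  show ?thesis
  proof (intro exI[of _ "from_nat_into S"] conjI allI ballI impI)
    show "from_nat_into S n \<in> B" for n using from_nat_into[OF S(2)] SB by blast
    fix f and \<epsilon> :: real assume f: "f \<in> B" and e: "\<epsilon> > 0"
    obtain k where k: "inverse (real (Suc k)) < \<epsilon>" using reals_Archimedean[OF e] by blast
    obtain m :: nat where "N (2 * h) f \<le> real m" using real_arch_simple by blast
    then obtain g where g: "g \<in> F m k" "N h (f - g) < inverse (Suc k)" using F(3)[OF f] by blast
    then have "g \<in> S" by (auto simp: S_def)
    then obtain n where "from_nat_into S n = g" using from_nat_into_surj[OF S(1)] by auto
    then show "\<exists>n. N h (f - from_nat_into S n) < \<epsilon>" using g k by (intro exI[of _ n]) auto
  qed
qed

text \<open>
  The expansion is orthogonal for the form \<open>ip (16 * h)\<close>. With \<open>v n\<close> the integral of \<open>|A (4 * h) j (e n)|\<close>,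
  the identity \<open>|A (16 * h) j f| * |A (16 * h) j g| = |A (64 * h) j f| * |A (4 * h) j g|\<close> lets the same
  sequence bound the coefficient functionals and the norms of the \<open>e n\<close>; it is square summable by
  Bessel's inequality for the functionals \<open>A (4 * h) j\<close>.
\<close>

lemma nuclear_expansion:
  assumes h: "h > 0"
  obtains e :: "nat \<Rightarrow> 'd pt \<Rightarrow> complex" and v :: "nat \<Rightarrow> real" and u :: "nat \<Rightarrow> ('d pt \<Rightarrow> complex) \<Rightarrow> complex"
    and C H where "C > 0" "H > 0" "\<And>n. e n \<in> B" "\<And>n. v n \<ge> 0" "summable (\<lambda>n. (v n)\<^sup>2)"
    "\<And>n. N h (e n) \<le> C * v n" "\<And>n. linear_functional (B_dot s U) (u n)"
    "\<And>n f. f \<in> B \<Longrightarrow> cmod (u n f) \<le> v n * N H f"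
    "\<And>f. f \<in> B \<Longrightarrow> (\<lambda>K. N h (f - (\<Sum>n<K. cscale (u n f) (e n)))) \<longlonglongrightarrow> 0"
proof -
  interpret sn_space B "{0<..}" N by (rule sn_space_B)
  \<comment> \<open>The domination is applied from h to h1, to bound \<open>N h (e n)\<close> by
    \<open>v n\<close>, and from h1 to h2, to bound \<open>N h1\<close> by the form at h2; h3 serves
    the bound on the coefficients.\<close>
  define h1 where "h1 = 4 * h"
  define h2 where "h2 = 4 * h1"
  define h3 where "h3 = 4 * h2"
  have hs: "h1 > 0" "h2 > 0" "h3 > 0" using h by (auto simp: h1_def h2_def h3_def)
  obtain Ca where Ca: "Ca > 0" "\<And>f. f \<in> B \<Longrightarrow> N h f \<le> Ca * (\<integral>j. cmod (A h1 j f) \<partial>M)"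
    unfolding h1_def by (rule pietsch[OF h]) (use B_W B_V h in auto)
  obtain Cb where Cb: "Cb > 0" "\<And>f. f \<in> B \<Longrightarrow> N h1 f \<le> Cb * (\<integral>j. cmod (A h2 j f) \<partial>M)"
    unfolding h2_def by (rule pietsch[OF hs(1)]) (use B_W B_V hs in auto)
  interpret H: hermitian_form B "ip h2" by (rule hermitian_form_ip[OF hs(2)])
  have sq: "H.sq f = (\<integral>j. (cmod (A h2 j f))\<^sup>2 \<partial>M)" for f
    by (simp add: H.sq_def ip_self_eq)
  define \<mu> where "\<mu> = measure M (space M)"
  have \<mu>: "\<mu> \<ge> 0" by (simp add: \<mu>_def)
  \<comment> \<open>Domination by an integral gives Cb, Cauchy-Schwarz on the finite measure gives
    \<mu> + 1.\<close>
  define K where "K = Cb\<^sup>2 * (\<mu> + 1)"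
  have K0: "K \<ge> 0" using \<mu> by (simp add: K_def)
  have N1: "(N h1 f)\<^sup>2 \<le> K * H.sq f" if f: "f \<in> B" for f
  proof -
    have "(N h1 f)\<^sup>2 \<le> (Cb * (\<integral>j. cmod (A h2 j f) \<partial>M))\<^sup>2"
      by (rule power_mono[OF Cb(2)[OF f] N_nonneg])
    also have "\<dots> = Cb\<^sup>2 * (\<integral>j. cmod (A h2 j f) \<partial>M)\<^sup>2" by (simp add: power_mult_distrib)
    also have "\<dots> \<le> Cb\<^sup>2 * ((\<mu> + 1) * H.sq f)"
      unfolding sq \<mu>_def
      by (intro mult_left_mono M.integral_square_le integrable_norm_A integrable_norm_A2 hs B_W B_V f) auto
    finally show ?thesis by (simp add: K_def mult.assoc)
  qed
  obtain g :: "nat \<Rightarrow> 'd pt \<Rightarrow> complex" where g': "\<forall>n. g n \<in> B" "\<forall>f\<in>B. \<forall>\<epsilon>>0. \<exists>n. N h2 (f - g n) < \<epsilon>"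
    using B_separable[OF hs(2)] by (elim exE conjE)
  then have g: "\<And>n. g n \<in> B" "\<And>f \<epsilon>. f \<in> B \<Longrightarrow> \<epsilon> > 0 \<Longrightarrow> \<exists>n. N h2 (f - g n) < \<epsilon>"
    by simp_all
  define e where "e = H.gs g"
  have e: "e n \<in> B" for n unfolding e_def by (rule H.gs_mem[OF g(1)])
  define v where "v = (\<lambda>n. \<integral>j. cmod (A h1 j (e n)) \<partial>M)"
  have v0: "v n \<ge> 0" for n by (simp add: v_def)
  have bessel: "(\<Sum>n<L. (cmod (A h1 j (e n)))\<^sup>2) \<le> K" for j L
    unfolding e_def
  proof (rule H.bessel_functional[OF g(1)])
    show "(cmod (A h1 j f))\<^sup>2 \<le> K * H.sq f" if f: "f \<in> B" for f
      using power_mono[OF A_bound[OF hs(1) B_W[OF f] B_V[OF f hs(1)], of j] norm_ge_zero, where n = 2] N1[OF f]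
      by linarith
    show "A h1 j (f + k) = A h1 j f + A h1 j k" if "f \<in> B" "k \<in> B" for f k
      by (rule A_add_W[OF B_W[OF that(1)] B_W[OF that(2)]])
    show "A h1 j (cscale c f) = c * A h1 j f" if "f \<in> B" for f c
      by (rule A_scale_W[OF B_W[OF that]])
  qed (rule K0)
  \<comment> \<open>Bessel's inequality holds at every j with the same K, so it may be integrated
    over j; Cauchy-Schwarz passes from squares of integrals to integrals of squares.\<close>
  have v_sums: "(\<Sum>n<L. (v n)\<^sup>2) \<le> (\<mu> + 1) * (K * \<mu>)" for L
  proof -
    have int: "integrable M (\<lambda>j. (cmod (A h1 j (e n)))\<^sup>2)" for n
      by (rule integrable_norm_A2[OF hs(1) B_W[OF e] B_V[OF e hs(1)]])
    have "(\<Sum>n<L. (v n)\<^sup>2) \<le> (\<Sum>n<L. (\<mu> + 1) * (\<integral>j. (cmod (A h1 j (e n)))\<^sup>2 \<partial>M))"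
      unfolding v_def \<mu>_def
      by (intro sum_mono M.integral_square_le int integrable_norm_A[OF hs(1) B_W[OF e] B_V[OF e hs(1)]])
    also have "\<dots> = (\<mu> + 1) * (\<integral>j. (\<Sum>n<L. (cmod (A h1 j (e n)))\<^sup>2) \<partial>M)"
      using int by (simp add: sum_distrib_left Bochner_Integration.integral_sum)
    also have "(\<integral>j. (\<Sum>n<L. (cmod (A h1 j (e n)))\<^sup>2) \<partial>M) \<le> (\<integral>j. K \<partial>M)"
      using bessel int by (intro integral_mono Bochner_Integration.integrable_sum) auto
    also have "(\<integral>j. K \<partial>M) = K * \<mu>" by (simp add: \<mu>_def)
    finally show ?thesis using \<mu> by (simp add: mult_left_mono)
  qed
  have summable: "summable (\<lambda>n. (v n)\<^sup>2)"
  proof (rule bounded_imp_summable)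
    show "(\<Sum>k\<le>n. (v k)\<^sup>2) \<le> (\<mu> + 1) * (K * \<mu>)" for n
      unfolding lessThan_Suc_atMost[symmetric] by (rule v_sums)
  qed simp
  define u where "u = (\<lambda>n f. ip h2 f (e n))"
  have u_lin: "linear_functional (B_dot s U) (u n)" for n
    unfolding linear_functional_def B_dot_eq topspace_T u_def
    using H.ip_add[OF _ _ e] H.ip_scale[OF _ e] by blast
  have u_bd: "cmod (u n f) \<le> v n * N h3 f" if f: "f \<in> B" for n f
  proof -
    have "cmod (u n f) \<le> (\<integral>j. cmod (A h2 j f * cnj (A h2 j (e n))) \<partial>M)"
      unfolding u_def ip_def by (rule integral_norm_bound)
    also have "\<dots> \<le> (\<integral>j. N h3 f * cmod (A h1 j (e n)) \<partial>M)"
    proof (rule integral_mono)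
      show "integrable M (\<lambda>j. cmod (A h2 j f * cnj (A h2 j (e n))))"
        by (intro integrable_norm integrable_A_cnj_A[OF hs(2) B_W B_V B_W B_V] f e hs)
      show "integrable M (\<lambda>j. N h3 f * cmod (A h1 j (e n)))"
        by (intro integrable_mult_right integrable_norm_A[OF hs(1) B_W[OF e] B_V[OF e hs(1)]])
      fix j :: "('d \<Rightarrow> nat) \<times> 'd pt"
      obtain \<alpha> x where j: "j = (\<alpha>, x)" by (cases j)
      have "A h2 j f = of_real ((h2 / h3) ^ mi_abs \<alpha>) * A h3 j f"
        unfolding j by (rule A_scale_param[OF hs(2,3)])
      then have 1: "cmod (A h2 j f) = (1 / 4) ^ mi_abs \<alpha> * cmod (A h3 j f)"
        using hs by (simp add: norm_mult norm_power h3_def)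
      have "A h1 j (e n) = of_real ((h1 / h2) ^ mi_abs \<alpha>) * A h2 j (e n)"
        unfolding j by (rule A_scale_param[OF hs(1,2)])
      then have 2: "cmod (A h1 j (e n)) = (1 / 4) ^ mi_abs \<alpha> * cmod (A h2 j (e n))"
        using hs by (simp add: norm_mult norm_power h2_def)
      have "cmod (A h2 j f * cnj (A h2 j (e n))) = cmod (A h3 j f) * cmod (A h1 j (e n))"
        by (simp add: norm_mult 1 2)
      also have "\<dots> \<le> N h3 f * cmod (A h1 j (e n))"
        by (intro mult_right_mono A_bound hs B_W B_V f) auto
      finally show "cmod (A h2 j f * cnj (A h2 j (e n))) \<le> N h3 f * cmod (A h1 j (e n))" .
    qed
    also have "\<dots> = v n * N h3 f" by (simp add: v_def mult.commute)
    finally show ?thesis .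
  qed
  have Ne: "N h (e n) \<le> Ca * v n" for n
    using Ca(2)[OF e] by (simp add: v_def)
  have conv: "(\<lambda>L. N h (f - (\<Sum>n<L. cscale (u n f) (e n)))) \<longlonglongrightarrow> 0" if f: "f \<in> B" for f
  proof -
    have "(\<lambda>L. H.sq (f - H.proj g L f)) \<longlonglongrightarrow> 0"
    proof (rule H.proj_converges[OF g(1) f])
      fix \<epsilon> :: real assume eps: "\<epsilon> > 0"
      \<comment> \<open>The form is at most \<mu> times the square of \<open>N h2\<close>, so
        density for \<open>N h2\<close> implies density for the form.\<close>
      define r where "r = sqrt (\<epsilon> / (\<mu> + 1))"
      have r: "r > 0" using eps \<mu> by (simp add: r_def)
      obtain n where n: "N h2 (f - g n) < r" using g(2)[OF f r] by blast
      have d: "f - g n \<in> B" by (rule diff_mem[OF f g(1)])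
      have "H.sq (f - g n) \<le> (\<integral>j. (N h2 (f - g n))\<^sup>2 \<partial>M)"
        unfolding sq using power_mono[OF A_bound[OF hs(2) B_W[OF d] B_V[OF d hs(2)]] norm_ge_zero, where n = 2]
        by (intro integral_mono integrable_norm_A2[OF hs(2) B_W[OF d] B_V[OF d hs(2)]]) auto
      also have "\<dots> = \<mu> * (N h2 (f - g n))\<^sup>2" by (simp add: \<mu>_def)
      also have "\<dots> \<le> (\<mu> + 1) * (N h2 (f - g n))\<^sup>2" by (simp add: mult_right_mono)
      also have "\<dots> < (\<mu> + 1) * r\<^sup>2"
        using n r \<mu> N_nonneg by (intro mult_strict_left_mono power_strict_mono) auto
      also have "\<dots> = \<epsilon>" using eps \<mu> by (simp add: r_def)
      finally show "\<exists>n. H.sq (f - g n) < \<epsilon>" by blast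
    qed
    then have "(\<lambda>L. sqrt (K * H.sq (f - H.proj g L f))) \<longlonglongrightarrow> sqrt (K * 0)"
      by (intro tendsto_intros)
    then have lim: "(\<lambda>L. sqrt (K * H.sq (f - H.proj g L f))) \<longlonglongrightarrow> 0" by simp
    have proj: "H.proj g L f = (\<Sum>n<L. cscale (u n f) (e n))" for L
      unfolding H.proj_def[OF g(1)] u_def e_def by simp
    show ?thesis
      unfolding proj[symmetric]
    proof (rule tendsto_sandwich[OF _ _ tendsto_const lim]; intro always_eventually allI)
      fix L
      have d: "f - H.proj g L f \<in> B" by (rule diff_mem[OF f H.proj_mem[OF g(1)]])
      have "N h (f - H.proj g L f) \<le> N h1 (f - H.proj g L f)"
        using mono[of h h1, OF _ _ d] h by (simp add: h1_def)
      also have "\<dots> \<le> sqrt (K * H.sq (f - H.proj g L f))"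
        using N1[OF d] by (rule real_le_rsqrt)
      finally show "N h (f - H.proj g L f) \<le> sqrt (K * H.sq (f - H.proj g L f))" .
    qed (rule N_nonneg)
  qed
  show ?thesis
    by (rule that[OF Ca(1) hs(3) e v0 summable Ne u_lin u_bd conv])
qed

text \<open>p is dominated by a multiple of some \<open>N h\<close>. Each term of the expansion is
  split as v_n^2 times (u_n / v_n)(f) times e_n / v_n: summable weights, functionals bounded by
  \<open>N H\<close>, and vectors bounded by C in \<open>N h\<close>.\<close>

lemma nuclear_space_B_dot: "nuclear_space (B_dot s U)"
proof -
  interpret sn_chain B N by (rule sn_chain_B)
  show ?thesis
    unfolding nuclear_space_def
  proof (intro conjI allI impI)
    show "locally_convex (B_dot s U)" unfolding B_dot_eq by (rule locally_convex)
    fix p assume p: "continuous_seminorm (B_dot s U) p"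
    then obtain h C0 where h: "h \<in> {0<..}" and C0: "C0 > 0" and pN: "\<And>f. f \<in> B \<Longrightarrow> p f \<le> C0 * N h f"
      unfolding B_dot_eq by (rule continuous_seminorm_le) blast
    have h0: "h > 0" using h by simp
    have p_scale: "p (cscale c f) = cmod c * p f" if "f \<in> B" for c f
      using p that unfolding continuous_seminorm_def B_dot_eq topspace_T by blast
    have p_triangle: "p (f + g) \<le> p f + p g" if "f \<in> B" "g \<in> B" for f g
      using p that unfolding continuous_seminorm_def B_dot_eq topspace_T by blast
    have "p (cscale 0 0) = 0" using p_scale[OF zero_mem, of 0] by simp
    then have p0: "p 0 = 0" by (simp add: cscale_def zero_fun_def)
    have p_nonneg: "p f \<ge> 0" if f: "f \<in> B" for f
      using p_triangle[OF f scale_mem[OF f, of "-1"]] p_scale[OF f, of "-1"] p0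
      by (simp add: cscale_def plus_fun_def zero_fun_def)
    obtain e v u C H where C: "C > 0" and H: "H > 0" and e: "\<And>n. e n \<in> B" and v: "\<And>n. v n \<ge> 0"
      and sum: "summable (\<lambda>n. (v n)\<^sup>2)" and Ne: "\<And>n. N h (e n) \<le> C * v n"
      and u: "\<And>n. linear_functional (B_dot s U) (u n)"
      and ubd: "\<And>n f. f \<in> B \<Longrightarrow> cmod (u n f) \<le> v n * N H f"
      and conv: "\<And>f. f \<in> B \<Longrightarrow> (\<lambda>K. N h (f - (\<Sum>n<K. cscale (u n f) (e n)))) \<longlonglongrightarrow> 0"
      by (rule nuclear_expansion[OF h0]) (rule that)
    define c where "c = (\<lambda>n. complex_of_real ((v n)\<^sup>2))"
    define u' where "u' = (\<lambda>n f. u n f / of_real (v n))"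
    \<comment> \<open>The vectors lie in the space itself, so constant sequences represent them in
      the completion and \<open>completion_norm\<close> is the value of p.\<close>
    define y where "y = (\<lambda>n (k :: nat). cscale (of_real (1 / v n)) (e n))"
    have y: "y n k \<in> B" for n k unfolding y_def by (rule scale_mem[OF e])
    have norm_y: "completion_norm p (y n) = p (cscale (of_real (1 / v n)) (e n))" for n
      unfolding completion_norm_def y_def by (rule limI) simp
    \<comment> \<open>If \<open>v n = 0\<close> then \<open>N h (e n) = 0\<close>, so
      \<open>e n = 0\<close> and the convention x / 0 = 0 loses nothing.\<close>
    have term_eq: "cscale (c n * u' n f) (y n k) = cscale (u n f) (e n)" for n f k
    proof (cases "v n = 0")
      case True
      then have "N h (e n) = 0" using Ne[of n] N_nonneg[of h "e n"] by simp
      then have "e n = 0" using separating[of h "e n"] h e by simp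
      then show ?thesis by (simp add: y_def cscale_def fun_eq_iff)
    next
      case False
      then show ?thesis by (simp add: y_def c_def u'_def cscale_def fun_eq_iff power2_eq_square)
    qed
    show "\<exists>(c :: nat \<Rightarrow> complex) u y.
        summable (\<lambda>n. cmod (c n)) \<and> (\<forall>n. linear_functional (B_dot s U) (u n)) \<and>
        (\<exists>V. zero_nhd (B_dot s U) V \<and> (\<forall>n. \<forall>f\<in>V. cmod (u n f) \<le> 1)) \<and>
        (\<forall>n. completion_rep (B_dot s U) p (y n)) \<and> (\<exists>C. \<forall>n. completion_norm p (y n) \<le> C) \<and>
        (\<forall>f\<in>topspace (B_dot s U).
          (\<lambda>N. completion_norm p (\<lambda>k. f - (\<Sum>n<N. cscale (c n * u n f) (y n k)))) \<longlonglongrightarrow> 0)"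
    proof (rule exI[of _ c], rule exI[of _ u'], rule exI[of _ y], intro conjI allI ballI)
      show "summable (\<lambda>n. cmod (c n))" using sum by (simp add: c_def norm_power)
      show "linear_functional (B_dot s U) (u' n)" for n
        using u[of n] unfolding linear_functional_def u'_def by (simp add: add_divide_distrib)
      show "\<exists>V. zero_nhd (B_dot s U) V \<and> (\<forall>n. \<forall>f\<in>V. cmod (u' n f) \<le> 1)"
      proof (intro exI[of _ "{f \<in> B. N H f < 1}"] conjI allI ballI)
        show "zero_nhd (B_dot s U) {f \<in> B. N H f < 1}"
          unfolding B_dot_eq zero_nhd_iff using H by (auto intro!: bexI[of _ H] exI[of _ 1])
        fix n f assume f: "f \<in> {f \<in> B. N H f < 1}"
        show "cmod (u' n f) \<le> 1"
        proof (cases "v n = 0")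
          case False
          have "cmod (u n f) \<le> v n * N H f" using ubd f by blast
          also have "\<dots> \<le> v n * 1" using f v[of n] by (intro mult_left_mono) auto
          finally show ?thesis using False v[of n] by (simp add: u'_def norm_divide)
        qed (simp add: u'_def)
      qed
      show "completion_rep (B_dot s U) p (y n)" for n
        unfolding completion_rep_def B_dot_eq topspace_T using y p0 by (auto simp: y_def)
      show "\<exists>C. \<forall>n. completion_norm p (y n) \<le> C"
      proof (intro exI[of _ "C0 * C"] allI)
        fix n
        have "completion_norm p (y n) = \<bar>1 / v n\<bar> * p (e n)"
          unfolding norm_y p_scale[OF e] norm_of_real ..
        also have "\<dots> \<le> \<bar>1 / v n\<bar> * (C0 * (C * v n))"
          by (intro mult_left_mono order_trans[OF pN[OF e] mult_left_mono[OF Ne]])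
            (use C0 in auto)
        also have "\<dots> \<le> C0 * C" using C0 C v[of n] by (cases "v n = 0") auto
        finally show "completion_norm p (y n) \<le> C0 * C" .
      qed
      fix f assume "f \<in> topspace (B_dot s U)"
      then have f: "f \<in> B" by (simp add: B_dot_eq topspace_T)
      have "completion_norm p (\<lambda>k. f - (\<Sum>n<K. cscale (c n * u' n f) (y n k))) =
          p (f - (\<Sum>n<K. cscale (u n f) (e n)))" for K
        unfolding completion_norm_def term_eq by (rule limI) simp
      moreover have "(\<lambda>K. p (f - (\<Sum>n<K. cscale (u n f) (e n)))) \<longlonglongrightarrow> 0"
      proof -
        have "(\<lambda>K. C0 * N h (f - (\<Sum>n<K. cscale (u n f) (e n)))) \<longlonglongrightarrow> C0 * 0"
          by (intro tendsto_intros conv f)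
        then have lim: "(\<lambda>K. C0 * N h (f - (\<Sum>n<K. cscale (u n f) (e n)))) \<longlonglongrightarrow> 0" by simp
        have mem: "f - (\<Sum>n<K. cscale (u n f) (e n)) \<in> B" for K
          by (intro diff_mem f sum_mem scale_mem e)
        show ?thesis
          by (rule tendsto_sandwich[OF _ _ tendsto_const lim]; intro always_eventually allI p_nonneg pN mem)
      qed
      ultimately show "(\<lambda>K. completion_norm p (\<lambda>k. f - (\<Sum>n<K. cscale (c n * u' n f) (y n k)))) \<longlonglongrightarrow> 0"
        by simp
    qed
  qed
qed

end

theorem proposition3p3:
  fixes s :: real and U :: "(real^'d::{finite,linorder}) set"
  assumes "s > 1" and "open U" and "bounded U"
  shows
    "(\<forall>h>0.
        (\<forall>p\<ge>1. \<forall>\<phi>\<in>topspace (DL_Beurling s p h U).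
           smooth_on UNIV (zero_ext U \<phi>) \<and> supp (zero_ext U \<phi>) \<subseteq> closure U) \<and>
        identifies_with_closed_subspace
          (DL_Beurling s \<infinity> h U) (DK s (1 / h) (closure U)) (zero_ext U) \<and>
        (\<forall>\<phi>\<in>topspace (DL_Beurling s \<infinity> h U).
           DK_norm s (1 / h) (closure U) (zero_ext U \<phi>) = DL_norm s \<infinity> h U \<phi>)) \<and>
     identifies_with_closed_subspace (B_dot s U) (DK_Beurling s (closure U)) (zero_ext U) \<and>
     nuclear_space (B_dot s U) \<and> FS_space (B_dot s U) \<and>
     B_dot s U = proj_lim {0<..} (\<lambda>h. DL_Beurling s \<infinity> h U) \<and>
     (\<forall>h>0. \<forall>h1>h.
        compact_linear_map (DL_Beurling s \<infinity> h1 U) (DL_Beurling s \<infinity> h U) (\<lambda>\<phi>. \<phi>))"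
proof -
  interpret ultra s U by standard (use assms in auto)
  have ext: "smooth_on UNIV (zero_ext U \<phi>) \<and> supp (zero_ext U \<phi>) \<subseteq> closure U"
    if "h > 0" "p \<ge> 1" "\<phi> \<in> topspace (DL_Beurling s p h U)" for h p \<phi>
  proof -
    \<comment> \<open>Membership in \<open>W\<close> makes \<open>zero_ext U\<close> act as the
      identity and carries smoothness across the frontier.\<close>
    have \<phi>: "\<phi> \<in> W" by (rule topspace_DL_Beurling_W[OF that])
    then have "zero_ext U \<phi> = \<phi>" by (auto simp: zero_ext_def fun_eq_iff W_vanish)
    moreover have "supp \<phi> \<subseteq> closure U"
      unfolding supp_def by (rule closure_mono) (use W_vanish[OF \<phi>] in blast)
    ultimately show ?thesis using W_smooth[OF \<phi>] by simp
  qed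
  have norm: "DK_norm s (1 / h) (closure U) (zero_ext U \<phi>) = DL_norm s \<infinity> h U \<phi>"
    if "h > 0" "\<phi> \<in> topspace (DL_Beurling s \<infinity> h U)" for h \<phi>
    using X_NK[OF that(1)] zero_ext_X[of \<phi> h] that(2)
    unfolding topspace_DL_Beurling[OF that(1)] NK_def N_def by simp
  show ?thesis
    using ext norm DL_Beurling_identifies B_dot_identifies nuclear_space_B_dot FS_space_B_dot
      DL_Beurling_compact B_dot_eq proj_lim_DL_Beurling
    by (intro conjI allI impI ballI) (auto simp del: infinity_ennreal_def)
qed

end
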